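(* Let $T>0$, $p\ge1$, $s=1/p$, $f(u)=\frac{|u|^{p+1}}{p+1}$, and $g=h\circ f'$ where $h:\mathbb{R}\to\mathbb{R}$ is a Lipschitz function. Then there exist compactly supported initial data $u_0,v_0\in L^\infty(\mathbb{R})$ such that the corresponding entropy solution $(u,v)$ of the triangular system $$\partial_t u+\partial_x f(u)=0,\qquad \partial_t v+\partial_x(g(u)v)=0,\qquad (u,v)(x,0)=(u_0,v_0)(x),$$ satisfies $u,v\in L^\infty([0,T]\times\mathbb{R})$ and, for all $t\in[0,T]$, $$TV^{s+\varepsilon}u(\cdot,t)=\infty\ \text{ for all } \varepsilon>0\quad\text{and}\quad TV^{s'}v(\cdot,t)=\infty\ \text{ for all } s'\in(0,1].$$
   Context: For $\sigma>0$ and a function $w:\mathbb{R}\to\mathbb{R}$, the $TV^\sigma$ variation is $$TV^\sigma w=\sup\sum_{i=2}^n|w(x_i)-w(x_{i-1})|^{1/\sigma},$$ the supremum being over all $n\ge2$ and all $x_1<\dots<x_n$ in $\mathbb{R}$. For a function defined only almost everywhere, $TV^\sigma$ denotes the infimum over its representatives. Entropy solution $(u,v)$ of the triangular system on $[0,T]$: $u$ is the Kruzhkov entropy solution of the scalar conservation law $\partial_t u+\partial_x f(u)=0$ with initial datum $u_0$ (bounded, in $C([0,T];L^1_{loc}(\mathbb{R}))$, $u(\cdot,0)=u_0$, and $\partial_t|u-k|+\partial_x(\mathrm{sgn}(u-k)(f(u)-f(k)))\le0$ in the sense of distributions for every $k\in\mathbb{R}$), and $v$ is a weak (distributional) solution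 of the linear transport equation $\partial_t v+\partial_x(g(u)v)=0$ with initial datum $v_0$, continuous in time with values in $L^1_{loc}(\mathbb{R})$. *)

theory Defs
  imports "HOL-Analysis.Analysis"
begin

definition TV :: "real \<Rightarrow> (real \<Rightarrow> real) \<Rightarrow> ennreal" where
  "TV \<sigma> w = (SUP (n, x) \<in> {(n :: nat, x :: nat \<Rightarrow> real). 2 \<le> n \<and> strict_mono_on {1..n} x}.
     \<Sum>i = 2..n. ennreal (\<bar>w (x i) - w (x (i - 1))\<bar> powr (1 / \<sigma>)))"

definition TV_ae :: "real \<Rightarrow> (real \<Rightarrow> real) \<Rightarrow> ennreal" where
  "TV_ae \<sigma> w = (INF w' \<in> {w'. AE x in lborel. w' x = w x}. TV \<sigma> w')"

definition in_Linf :: "'a::euclidean_space set \<Rightarrow> ('a \<Rightarrow> real) \<Rightarrow> bool" where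
  "in_Linf S w \<longleftrightarrow> set_borel_measurable lborel S w \<and>
     (\<exists>C. AE z in lborel. z \<in> S \<longrightarrow> \<bar>w z\<bar> \<le> C)"

text \<open>Compact support of an almost-everywhere class: some compact set carries it.\<close>

definition compactly_supported :: "(real \<Rightarrow> real) \<Rightarrow> bool" where
  "compactly_supported w \<longleftrightarrow> (\<exists>K. compact K \<and> (AE x in lborel. x \<notin> K \<longrightarrow> w x = 0))"

text \<open>A space-time function \<open>w(x,t)\<close> is written \<open>w t x\<close>.  Elements of
  \<open>C([0,T]; L\<^sup>1\<^sub>l\<^sub>o\<^sub>c)\<close> are given by representatives; the first clause asks for one that is jointly
  measurable, which every element of that space has.  Values at times outside \<open>[0,T]\<close> are
  irrelevant.\<close>

definition C_L1loc :: "real \<Rightarrow> (real \<Rightarrow> real \<Rightarrow> real) \<Rightarrow> bool" where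
  "C_L1loc T w \<longleftrightarrow>
     set_borel_measurable lborel ({0..T} \<times> UNIV) (\<lambda>(t, x). w t x) \<and>
     (\<forall>K. compact K \<longrightarrow>
        (\<forall>t \<in> {0..T}. set_integrable lborel K (w t)) \<and>
        (\<forall>t\<^sub>0 \<in> {0..T}.
           ((\<lambda>t. LINT x:K|lborel. \<bar>w t x - w t\<^sub>0 x\<bar>) \<longlongrightarrow> 0) (at t\<^sub>0 within {0..T})))"

fun Ck :: "nat \<Rightarrow> ('a::real_normed_vector \<Rightarrow> real) \<Rightarrow> bool" where
  "Ck 0 \<phi> \<longleftrightarrow> continuous_on UNIV \<phi>"
| "Ck (Suc k) \<phi> \<longleftrightarrow> (\<forall>z. \<phi> differentiable (at z)) \<and>
     (\<forall>d. Ck k (\<lambda>z. frechet_derivative \<phi> (at z) d))"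

text \<open>\<open>C\<^sub>c\<^sup>\<infinity>((0,T) \<times> \<real>)\<close>, arguments in the order \<open>(t,x)\<close>.\<close>

definition test_function :: "real \<Rightarrow> (real \<times> real \<Rightarrow> real) \<Rightarrow> bool" where
  "test_function T \<phi> \<longleftrightarrow> (\<forall>k. Ck k \<phi>) \<and> compact (closure {z. \<phi> z \<noteq> 0}) \<and>
     closure {z. \<phi> z \<noteq> 0} \<subseteq> {0<..<T} \<times> UNIV"

text \<open>The distribution \<open>\<partial>\<^sub>t a + \<partial>\<^sub>x b\<close> on \<open>(0,T) \<times> \<real>\<close>, evaluated at the test function \<open>\<phi>\<close>.\<close>

definition distr_div ::
  "real \<Rightarrow> (real \<Rightarrow> real \<Rightarrow> real) \<Rightarrow> (real \<Rightarrow> real \<Rightarrow> real) \<Rightarrow> (real \<times> real \<Rightarrow> real) \<Rightarrow> real" where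
  "distr_div T a b \<phi> = - (LINT (t, x):({0<..<T} \<times> UNIV)|lborel.
     a t x * deriv (\<lambda>\<tau>. \<phi> (\<tau>, x)) t + b t x * deriv (\<lambda>y. \<phi> (t, y)) x)"

text \<open>The fluxes \<open>f\<close> and \<open>g\<close> below are meant to be continuous; then all integrands in the weak
  formulations are integrable, because \<open>u\<close> is bounded and \<open>v \<in> C([0,T]; L\<^sup>1\<^sub>l\<^sub>o\<^sub>c)\<close>.\<close>

definition kruzhkov_solution ::
  "real \<Rightarrow> (real \<Rightarrow> real) \<Rightarrow> (real \<Rightarrow> real) \<Rightarrow> (real \<Rightarrow> real \<Rightarrow> real) \<Rightarrow> bool" where
  "kruzhkov_solution T f u\<^sub>0 u \<longleftrightarrow>
     in_Linf ({0..T} \<times> UNIV) (\<lambda>(t, x). u t x) \<and>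
     C_L1loc T u \<and>
     (AE x in lborel. u 0 x = u\<^sub>0 x) \<and>
     (\<forall>k \<phi>. test_function T \<phi> \<and> (\<forall>z. 0 \<le> \<phi> z) \<longrightarrow>
        distr_div T (\<lambda>t x. \<bar>u t x - k\<bar>) (\<lambda>t x. sgn (u t x - k) * (f (u t x) - f k)) \<phi> \<le> 0)"

definition weak_transport_solution ::
  "real \<Rightarrow> (real \<Rightarrow> real \<Rightarrow> real) \<Rightarrow> (real \<Rightarrow> real) \<Rightarrow> (real \<Rightarrow> real \<Rightarrow> real) \<Rightarrow> bool" where
  "weak_transport_solution T c v\<^sub>0 v \<longleftrightarrow>
     C_L1loc T v \<and>
     (AE x in lborel. v 0 x = v\<^sub>0 x) \<and>
     (\<forall>\<phi>. test_function T \<phi> \<longrightarrow> distr_div T v (\<lambda>t x. c t x * v t x) \<phi> = 0)"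

definition triangular_entropy_solution ::
  "real \<Rightarrow> (real \<Rightarrow> real) \<Rightarrow> (real \<Rightarrow> real) \<Rightarrow> (real \<Rightarrow> real) \<Rightarrow> (real \<Rightarrow> real) \<Rightarrow>
   (real \<Rightarrow> real \<Rightarrow> real) \<Rightarrow> (real \<Rightarrow> real \<Rightarrow> real) \<Rightarrow> bool" where
  "triangular_entropy_solution T f g u\<^sub>0 v\<^sub>0 u v \<longleftrightarrow>
     kruzhkov_solution T f u\<^sub>0 u \<and> weak_transport_solution T (\<lambda>t x. g (u t x)) v\<^sub>0 v"

end

(*
For nonnegative, compactly supported w\<^sub>0 with small Lipschitz constant, the wave speed w = f'(u) of the
solution u = w powr (1/p) solves w = w\<^sub>0(x - t w): no shock forms before time T and u(t) is u\<^sub>0 moved by an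
increasing homeomorphism, so its variation does not decrease. If w\<^sub>0 has bumps of height
d\<^sub>n = 1/ln n - 1/ln (n+1), then u\<^sub>0 has oscillations of size about d\<^sub>n powr (1/p), and no power of d\<^sub>n with
exponent below 1 is summable. The datum v\<^sub>0 is sin (1/y), cut off and placed so far from the support
of w that it is only translated, with speed h 0.

The set where k < u is a level set of w\<^sub>0 translated with speed f'(k), so u satisfies every Kruzhkov
entropy relation with equality. Conversely let z be the difference between an arbitrary entropy
solution and u. Since f lies above its tangents, the primitive D of z is nonpositive along the
characteristic lines of u. Averaging the entropy inequalities shows that the integral of f can only
decrease; that integral is the derivative of the first moment, so the integral of D is nonnegative.
Hence D = 0. For the linear equation, the mass between two characteristics is conserved.
*)

theory Submission
  imports Defs "HOL-Real_Asymp.Real_Asymp"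
begin

section \<open>Smooth functions and a smooth step\<close>

text \<open>The conclusion is asserted for every solution with the given data, so uniqueness has to
  be proved inside the class of the definition. The obstacle is the root: for p > 1 the function u
  is only Hoelder continuous, so stability estimates that want a Lipschitz reference solution do not
  apply to it. The wave speed w = u^p is Lipschitz, however, and it suffices: w gives the slopes of
  the tangents to f, and the coefficient h(w) of the linear equation is Lipschitz because g factors
  through f'. The heights d_n telescope, so bumps of one common slope fit into a bounded interval.
  The exponents that occur, (1/p)/(1/p + eps), come arbitrarily close to 1; no fixed power of n is
  both summable and non-summable after raising to each of them, hence the logarithm. The slope lam =
  1/(8 T (L + 1)), with L a Lipschitz constant of h, serves two purposes: the characteristics of w
  do not cross before T, and the Picard map for the characteristics of the linear equation contracts
  on all of [0,T] at once, so that no continuation in time is needed.\<close>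

lemma Ck_SucI:
  assumes "\<And>z. (f has_derivative f' z) (at z)" and "\<And>d. Ck k (\<lambda>z. f' z d)"
  shows "Ck (Suc k) f"
proof -
  have "frechet_derivative f (at z) = f' z" for z
    by (rule frechet_derivative_at[symmetric, OF assms(1)])
  moreover have "f differentiable (at z)" for z
    using assms(1) by (rule differentiableI)
  ultimately show ?thesis
    using assms(2) by simp
qed

lemma Ck_Suc_has_derivative:
  "Ck (Suc k) f \<Longrightarrow> (f has_derivative frechet_derivative f (at z)) (at z)"
  by (simp add: frechet_derivative_works)

lemma Ck_Suc_imp: "Ck (Suc k) f \<Longrightarrow> Ck k f"
proof (induction k arbitrary: f)
  case 0
  then show ?case
    by (auto intro!: differentiable_imp_continuous_on simp: differentiable_on_def
        intro: differentiable_at_withinI)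
next
  case (Suc k)
  show ?case
    unfolding Ck.simps(2)
  proof (intro conjI allI)
    fix d show "Ck k (\<lambda>z. frechet_derivative f (at z) d)"
      using Suc.prems by (intro Suc.IH) simp
  qed (use Suc.prems in simp)
qed

lemma Ck_const: "Ck k (\<lambda>z. c)"
proof (induction k arbitrary: c)
  case (Suc k)
  then show ?case by (intro Ck_SucI[where f' = "\<lambda>_ _. 0"]) auto
qed auto

lemma Ck_bounded_linear: "bounded_linear f \<Longrightarrow> Ck k f"
proof (induction k)
  case 0
  then show ?case by (simp add: linear_continuous_on)
next
  case (Suc k)
  then show ?case
    by (intro Ck_SucI[where f' = "\<lambda>_. f"] Ck_const) (auto intro: bounded_linear_imp_has_derivative)
qed

lemma Ck_add: "Ck k f \<Longrightarrow> Ck k g \<Longrightarrow> Ck k (\<lambda>z. f z + g z)"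
proof (induction k arbitrary: f g)
  case 0
  then show ?case by (auto intro: continuous_intros)
next
  case (Suc k)
  show ?case
  proof (rule Ck_SucI)
    fix z
    show "((\<lambda>z. f z + g z) has_derivative
        (\<lambda>d. frechet_derivative f (at z) d + frechet_derivative g (at z) d)) (at z)"
      using Suc.prems by (intro has_derivative_add Ck_Suc_has_derivative)
  next
    fix d
    show "Ck k (\<lambda>z. frechet_derivative f (at z) d + frechet_derivative g (at z) d)"
      using Suc.prems by (intro Suc.IH) auto
  qed
qed

lemma Ck_mult: "Ck k f \<Longrightarrow> Ck k g \<Longrightarrow> Ck k (\<lambda>z. f z * g z)"
proof (induction k arbitrary: f g)
  case 0
  then show ?case by (auto intro: continuous_intros)
next
  case (Suc k)
  show ?case
  proof (rule Ck_SucI)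
    fix z
    show "((\<lambda>z. f z * g z) has_derivative
        (\<lambda>d. f z * frechet_derivative g (at z) d + frechet_derivative f (at z) d * g z)) (at z)"
      using Suc.prems by (intro has_derivative_mult Ck_Suc_has_derivative)
  next
    fix d
    have "Ck k f" "Ck k g" using Suc.prems by (blast dest: Ck_Suc_imp)+
    then show "Ck k (\<lambda>z. f z * frechet_derivative g (at z) d + frechet_derivative f (at z) d * g z)"
      using Suc.prems by (intro Ck_add Suc.IH) auto
  qed
qed

lemma Ck_real_SucI:
  fixes f :: "real \<Rightarrow> real"
  assumes "\<And>x. (f has_real_derivative f' x) (at x)" and "Ck k f'"
  shows "Ck (Suc k) f"
  by (rule Ck_SucI[where f' = "\<lambda>x d. f' x * d"])
    (use assms in \<open>simp_all add: has_field_derivative_def Ck_mult Ck_const\<close>)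

text \<open>The derivative of a function of one real variable is multiplication by its value in
  direction 1. The chain rule therefore gives a product, and \<open>Ck_mult\<close> closes the
  induction.\<close>

lemma Ck_compose:
  fixes s :: "real \<Rightarrow> real"
  shows "Ck k s \<Longrightarrow> Ck k g \<Longrightarrow> Ck k (\<lambda>z. s (g z))"
proof (induction k arbitrary: s g)
  case 0
  then show ?case using continuous_on_compose2[of UNIV s UNIV g] by simp
next
  case (Suc k)
  let ?s' = "\<lambda>y. frechet_derivative s (at y) 1"
  have lin: "frechet_derivative s (at y) d = d * ?s' y" for y d
  proof -
    have "linear (frechet_derivative s (at y))"
      using Suc.prems by (auto intro: linear_frechet_derivative)
    from linear_scale[OF this, of d 1] show ?thesis by simp
  qed
  show ?case
  proof (rule Ck_SucI)
    fix z
    have "((s \<circ> g) has_derivative (frechet_derivative s (at (g z)) \<circ> frechet_derivative g (at z))) (at z)"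
      using Suc.prems by (intro diff_chain_at Ck_Suc_has_derivative)
    moreover have "frechet_derivative s (at (g z)) \<circ> frechet_derivative g (at z) =
        (\<lambda>d. frechet_derivative g (at z) d * ?s' (g z))"
      by (rule ext) (simp only: o_def, rule lin)
    ultimately show "((\<lambda>z. s (g z)) has_derivative
        (\<lambda>d. frechet_derivative g (at z) d * ?s' (g z))) (at z)"
      by (simp add: o_def)
  next
    fix d
    have "Ck k g" using Suc.prems(2) by (rule Ck_Suc_imp)
    moreover have "Ck k ?s'" using Suc.prems(1) by simp
    ultimately have "Ck k (\<lambda>z. ?s' (g z))"
      by (rule Suc.IH[of ?s' g, rotated])
    then show "Ck k (\<lambda>z. frechet_derivative g (at z) d * ?s' (g z))"
      using Suc.prems by (intro Ck_mult) auto
  qed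
qed

definition smooth :: "('a::real_normed_vector \<Rightarrow> real) \<Rightarrow> bool" where
  "smooth f \<longleftrightarrow> (\<forall>k. Ck k f)"

named_theorems smooth_intros

lemma smooth_const [smooth_intros]: "smooth (\<lambda>z. c)"
  by (simp add: smooth_def Ck_const)

lemma smooth_bounded_linear: "bounded_linear f \<Longrightarrow> smooth f"
  by (simp add: smooth_def Ck_bounded_linear)

lemma smooth_ident [smooth_intros]: "smooth (\<lambda>x. x)"
  and smooth_fst [smooth_intros]: "smooth (\<lambda>z. fst z)"
  and smooth_snd [smooth_intros]: "smooth (\<lambda>z. snd z)"
  by (auto intro: smooth_bounded_linear bounded_linear_fst bounded_linear_snd)

lemma smooth_add [smooth_intros]: "smooth f \<Longrightarrow> smooth g \<Longrightarrow> smooth (\<lambda>z. f z + g z)"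
  and smooth_mult [smooth_intros]: "smooth f \<Longrightarrow> smooth g \<Longrightarrow> smooth (\<lambda>z. f z * g z)"
  by (simp_all add: smooth_def Ck_add Ck_mult)

lemma smooth_minus [smooth_intros]: "smooth f \<Longrightarrow> smooth (\<lambda>z. - f z)"
  using smooth_mult[OF smooth_const[of "-1"]] by simp

lemma smooth_diff [smooth_intros]: "smooth f \<Longrightarrow> smooth g \<Longrightarrow> smooth (\<lambda>z. f z - g z)"
  using smooth_add[OF _ smooth_minus] by force

lemma smooth_divide_const [smooth_intros]: "smooth f \<Longrightarrow> smooth (\<lambda>z. f z / c)"
  using smooth_mult[OF _ smooth_const[of "inverse c"]] by (simp add: divide_inverse)

lemma smooth_compose: "smooth s \<Longrightarrow> smooth g \<Longrightarrow> smooth (\<lambda>z. s (g z))"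
  for s :: "real \<Rightarrow> real"
  by (simp add: smooth_def Ck_compose)

lemma smooth_antiderivative:
  fixes f :: "real \<Rightarrow> real"
  assumes "\<And>x. (f has_real_derivative f' x) (at x)" and "smooth f'"
  shows "smooth f"
  unfolding smooth_def
proof
  fix k show "Ck k f"
    by (rule Ck_Suc_imp, rule Ck_real_SucI[of f f']) (use assms in \<open>simp_all add: smooth_def\<close>)
qed

text \<open>Polynomials enter through the Weierstrass approximation of characteristic speeds, whose
  primitives are used to build test functions.\<close>

lemma smooth_real_polynomial_function:
  fixes f :: "real \<Rightarrow> real"
  assumes "real_polynomial_function f" shows "smooth f"
  using assms
proof (induction rule: real_polynomial_function.induct)
qed (auto intro: smooth_intros smooth_bounded_linear)

lemma smooth_imp_continuous_on: "smooth f \<Longrightarrow> continuous_on A f"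
proof -
  assume "smooth f"
  then have "Ck 0 f" by (simp add: smooth_def)
  then show ?thesis by (auto intro: continuous_on_subset)
qed

lemma smooth_deriv:
  fixes f :: "real \<Rightarrow> real"
  assumes "smooth f"
  shows "(f has_real_derivative deriv f x) (at x)" and "smooth (deriv f)"
proof -
  have Ck: "Ck k f" for k using assms by (simp add: smooth_def)
  have d: "f differentiable (at x)" for x using Ck[of "Suc 0"] by simp
  then show "(f has_real_derivative deriv f x) (at x)"
    using DERIV_deriv_iff_real_differentiable by blast
  have eq: "deriv f = (\<lambda>x. frechet_derivative f (at x) 1)"
  proof
    fix x
    have "(f has_derivative (*) (deriv f x)) (at x)"
      using d DERIV_deriv_iff_real_differentiable has_field_derivative_def by blast
    then have "(*) (deriv f x) = frechet_derivative f (at x)"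
      by (rule frechet_derivative_at)
    then show "deriv f x = frechet_derivative f (at x) 1" by (metis mult.right_neutral)
  qed
  show "smooth (deriv f)"
    unfolding smooth_def eq
  proof
    fix k show "Ck k (\<lambda>x. frechet_derivative f (at x) 1)"
      using Ck[of "Suc k"] by simp
  qed
qed

section \<open>Flat functions and a smooth step\<close>

definition flat :: "nat \<Rightarrow> real \<Rightarrow> real" where
  "flat n x = (if x > 0 then exp (- inverse x) * inverse x ^ n else 0)"

text \<open>This is the difference quotient at the origin, where two formulas meet. Substituting y =
  1/h on the right turns it into y^(n+1) / exp y.\<close>

lemma flat_limit: "((\<lambda>h. flat n h / h) \<longlongrightarrow> 0) (at 0)"
proof -
  have 1: "((\<lambda>h. flat n h / h) \<longlongrightarrow> 0) (at_left 0)"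
    by (rule tendsto_eventually) (auto simp: flat_def eventually_at_filter)
  have "filterlim (\<lambda>h::real. inverse h) at_top (at_right 0)"
    by (rule filterlim_inverse_at_top_right)
  from filterlim_compose[OF tendsto_power_div_exp_0[of "Suc n"] this]
  have "((\<lambda>h::real. inverse h ^ Suc n / exp (inverse h)) \<longlongrightarrow> 0) (at_right 0)" .
  then have 2: "((\<lambda>h. flat n h / h) \<longlongrightarrow> 0) (at_right 0)"
    by (rule Lim_transform_eventually)
      (auto simp: flat_def eventually_at_filter exp_minus field_simps)
  from 1 2 show ?thesis by (simp add: filterlim_at_split)
qed

text \<open>The derivative of exp(-1/x) x^(-n) is a combination of functions of the same form. The
  family is thus closed under differentiation, and one induction over all n makes every member
  smooth.\<close>

lemma flat_has_derivative:
  "(flat n has_real_derivative flat (n + 2) x - n * flat (Suc n) x) (at x)"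
proof (cases x "0::real" rule: linorder_cases)
  case less
  have "((\<lambda>_. 0) has_real_derivative 0) (at x)" by auto
  moreover have "\<forall>\<^sub>F y in nhds x. 0 = flat n y"
    using eventually_nhds_in_open[of "{..<0}" x] less by (auto elim!: eventually_mono simp: flat_def)
  ultimately have "(flat n has_real_derivative 0) (at x)"
    using DERIV_cong_ev[of x x "\<lambda>_. 0" "flat n" 0 0] by simp
  then show ?thesis using less by (simp add: flat_def)
next
  case equal
  then show ?thesis
    using flat_limit[of n] by (simp add: has_field_derivative_iff flat_def)
next
  case greater
  define i where "i = inverse x"
  have d: "(inverse has_real_derivative - (i ^ 2)) (at x)"
    using DERIV_inverse[of x] greater by (simp add: i_def power2_eq_square)
  have p: "((\<lambda>x. inverse x ^ n) has_real_derivative of_nat n * i ^ (n - 1) * (- (i ^ 2))) (at x)"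
    using DERIV_power[OF d, of n] by (simp add: i_def mult_ac)
  have "((\<lambda>x. exp (- inverse x) * inverse x ^ n) has_real_derivative
      exp (- i) * (- (- (i ^ 2))) * i ^ n + (of_nat n * i ^ (n - 1) * (- (i ^ 2))) * exp (- i)) (at x)"
    unfolding i_def
    by (intro DERIV_mult DERIV_fun_exp DERIV_minus d[unfolded i_def] p[unfolded i_def])
  moreover have "exp (- i) * (- (- (i ^ 2))) * i ^ n + (of_nat n * i ^ (n - 1) * (- (i ^ 2))) * exp (- i) =
      flat (n + 2) x - n * flat (Suc n) x"
    using greater by (cases n) (simp_all add: flat_def i_def power2_eq_square algebra_simps)
  moreover have "\<forall>\<^sub>F y in nhds x. exp (- inverse y) * inverse y ^ n = flat n y"
    using eventually_nhds_in_open[of "{0<..}" x] greater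
    by (auto elim!: eventually_mono simp: flat_def)
  ultimately show ?thesis
    using DERIV_cong_ev[OF refl _ refl] by fastforce
qed

lemma smooth_flat: "smooth (flat n)"
  unfolding smooth_def
proof
  fix k show "Ck k (flat n)"
  proof (induction k arbitrary: n)
    case 0
    have "continuous_on UNIV (flat n)"
      by (rule DERIV_continuous_on) (rule flat_has_derivative)
    then show ?case by simp
  next
    case (Suc k)
    have "Ck k (\<lambda>x. flat (n + 2) x + (- n) * flat (Suc n) x)"
      by (intro Ck_add Ck_mult Ck_const Suc)
    then show ?case
      by (intro Ck_real_SucI[OF flat_has_derivative]) simp
  qed
qed

text \<open>The step is the primitive of a smooth bump that is positive exactly on (0,1), normalised
  to have total increase 1.\<close>

lemma smooth_step_exists:
  "\<exists>S :: real \<Rightarrow> real. smooth S \<and> (\<forall>x\<le>0. S x = 0) \<and> (\<forall>x\<ge>1. S x = 1) \<and> mono S"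
proof -
  define B where "B x = flat 0 x * flat 0 (1 - x)" for x
  have sB: "smooth B"
    unfolding B_def by (intro smooth_intros smooth_flat smooth_compose[OF smooth_flat])
  have B0: "B x \<ge> 0" for x by (simp add: B_def flat_def)
  have Bpos: "B x > 0" if "0 < x" "x < 1" for x using that by (simp add: B_def flat_def)
  have Bz: "B x = 0" if "x \<le> 0 \<or> 1 \<le> x" for x using that by (auto simp: B_def flat_def)
  have "isCont B x" for x
    using smooth_imp_continuous_on[OF sB, of UNIV] by (simp add: continuous_on_eq_continuous_at)
  then obtain F where F: "\<And>x. (F has_vector_derivative B x) (at x)"
    using einterval_antiderivative[of "-\<infinity>" "\<infinity>" B] by auto
  then have F: "(F has_real_derivative B x) (at x)" for x
    by (simp add: has_real_derivative_iff_has_vector_derivative)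
  have contF: "continuous_on A F" for A
    by (rule DERIV_continuous_on) (rule DERIV_subset[OF F], simp)
  have mono: "F x \<le> F y" if "x \<le> y" for x y
    using DERIV_nonneg_imp_nondecreasing[OF that, of F] F B0 by blast
  have "F 0 < F 1"
    by (rule DERIV_pos_imp_increasing_open[of 0 1 F])
      (use F Bpos contF in auto)
  have F0: "F x = F 0" if "x \<le> 0" for x
  proof (cases "x = 0")
    case False
    have "\<exists>l z. x < z \<and> z < 0 \<and> (F has_real_derivative l) (at z) \<and> F 0 - F x = (0 - x) * l"
      by (rule MVT) (use that False F contF in \<open>auto simp: real_differentiable_def\<close>)
    then obtain l z where "x < z" "z < 0" "(F has_real_derivative l) (at z)" "F 0 - F x = (0 - x) * l"
      by blast
    moreover from this have "l = 0" using DERIV_unique[OF F[of z]] Bz[of z] by fastforce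
    ultimately show ?thesis by simp
  qed auto
  have F1: "F x = F 1" if "x \<ge> 1" for x
  proof (cases "x = 1")
    case False
    have "\<exists>l z. 1 < z \<and> z < x \<and> (F has_real_derivative l) (at z) \<and> F x - F 1 = (x - 1) * l"
      by (rule MVT) (use that False F contF in \<open>auto simp: real_differentiable_def\<close>)
    then obtain l z where "1 < z" "z < x" "(F has_real_derivative l) (at z)" "F x - F 1 = (x - 1) * l"
      by blast
    moreover from this have "l = 0" using DERIV_unique[OF F[of z]] Bz[of z] by fastforce
    ultimately show ?thesis by simp
  qed auto
  let ?S = "\<lambda>x. (F x - F 0) / (F 1 - F 0)"
  have "smooth ?S"
    by (intro smooth_intros smooth_antiderivative[OF F sB])
  moreover have "mono ?S"
    using mono \<open>F 0 < F 1\<close> by (auto intro!: monoI divide_right_mono)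
  moreover have "?S x = 0" if "x \<le> 0" for x using F0[OF that] by simp
  moreover have "?S x = 1" if "x \<ge> 1" for x using F1[OF that] \<open>F 0 < F 1\<close> by simp
  ultimately show ?thesis by blast
qed

definition step :: "real \<Rightarrow> real" where
  "step = (SOME S. smooth S \<and> (\<forall>x\<le>0. S x = 0) \<and> (\<forall>x\<ge>1. S x = 1) \<and> mono S)"

definition step' :: "real \<Rightarrow> real" where
  "step' = deriv step"

lemma smooth_step: "smooth step"
  and step_0 [simp]: "x \<le> 0 \<Longrightarrow> step x = 0"
  and step_1 [simp]: "x \<ge> 1 \<Longrightarrow> step x = 1"
  and step_mono: "x \<le> y \<Longrightarrow> step x \<le> step y"
  using someI_ex[OF smooth_step_exists] by (auto simp: step_def[symmetric] dest: monoD)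

lemma step_ge_0 [simp]: "0 \<le> step x" and step_le_1 [simp]: "step x \<le> 1"
  using step_mono[of 0 x] step_mono[of x 0] step_mono[of x 1] step_mono[of 1 x]
  by (cases "x \<le> 0"; cases "x \<le> 1"; simp)+

lemma step_deriv: "(step has_real_derivative step' x) (at x)"
  and smooth_step': "smooth step'"
  unfolding step'_def using smooth_deriv[OF smooth_step] by auto

lemma step'_ge_0 [simp]: "0 \<le> step' x"
proof (rule ccontr)
  assume "\<not> 0 \<le> step' x"
  then obtain d where "d > 0" "\<And>h. h > 0 \<Longrightarrow> h < d \<Longrightarrow> step (x + h) < step x"
    using DERIV_neg_dec_right[OF step_deriv] by (meson not_le)
  from this(1) this(2)[of "d/2"] step_mono[of x "x + d/2"] show False by auto
qed

lemma continuous_step: "continuous_on A step" and continuous_step': "continuous_on A step'"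
  by (auto intro: smooth_imp_continuous_on smooth_step smooth_step')

lemma step'_0_aux: "x < 0 \<or> 1 < x \<Longrightarrow> step' x = 0"
proof -
  assume *: "x < 0 \<or> 1 < x"
  have "(step has_real_derivative 0) (at x)"
  proof (cases "x < 0")
    case True
    have "\<forall>\<^sub>F y in nhds x. 0 = step y"
      using eventually_nhds_in_open[of "{..<0}" x] True by (auto elim!: eventually_mono)
    then show ?thesis using DERIV_cong_ev[of x x "\<lambda>_. 0" step 0 0] by simp
  next
    case False
    have "\<forall>\<^sub>F y in nhds x. 1 = step y"
      using eventually_nhds_in_open[of "{1<..}" x] False * by (auto elim!: eventually_mono)
    then show ?thesis using DERIV_cong_ev[of x x "\<lambda>_. 1" step 0 0] by simp
  qed
  then show ?thesis using DERIV_unique[OF step_deriv] by blast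
qed

lemma step'_0 [simp]: assumes "x \<le> 0 \<or> 1 \<le> x" shows "step' x = 0"
proof -
  have c: "isCont step' y" for y
    using continuous_step'[of UNIV] by (simp add: continuous_on_eq_continuous_at)
  \<comment> \<open>At the two endpoints \<open>step'\<close> is the one-sided limit of values that
    vanish.\<close>
  have "step' 0 = 0"
  proof (rule tendsto_unique[of "at_left (0::real)"])
    show "(step' \<longlongrightarrow> step' 0) (at_left 0)"
      using c[of 0] by (auto simp: isCont_def intro: tendsto_within_subset)
    show "(step' \<longlongrightarrow> 0) (at_left 0)"
      by (rule tendsto_eventually) (auto simp: eventually_at_filter step'_0_aux)
  qed auto
  moreover have "step' 1 = 0"
  proof (rule tendsto_unique[of "at_right (1::real)"])
    show "(step' \<longlongrightarrow> step' 1) (at_right 1)"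
      using c[of 1] by (auto simp: isCont_def intro: tendsto_within_subset)
    show "(step' \<longlongrightarrow> 0) (at_right 1)"
      by (rule tendsto_eventually) (auto simp: eventually_at_filter step'_0_aux)
  qed auto
  ultimately show ?thesis using assms step'_0_aux[of x] by (metis less_eq_real_def)
qed

lemma step'_bounded: "\<exists>M\<ge>0. \<forall>x. step' x \<le> M"
proof -
  have "compact (step' ` {0..1})"
    by (intro compact_continuous_image continuous_step') auto
  then obtain M where M: "\<forall>y\<in>step' ` {0..1}. \<bar>y\<bar> \<le> M"
    by (meson bounded_real compact_imp_bounded)
  have "step' x \<le> max M 0" for x
  proof (cases "x \<in> {0..1}")
    case True
    then have "\<bar>step' x\<bar> \<le> M" using M by blast
    then show ?thesis by linarith
  next
    case False
    then have "x \<le> 0 \<or> 1 \<le> x" by auto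
    then show ?thesis using step'_0 by simp
  qed
  then show ?thesis by (intro exI[of _ "max M 0"]) auto
qed

lemma borel_measurable_step [measurable]:
  "step \<in> borel_measurable borel" "step' \<in> borel_measurable borel"
  by (auto intro!: borel_measurable_continuous_onI continuous_step continuous_step')

lemmas smooth_step_comp [smooth_intros] = smooth_compose[OF smooth_step]

section \<open>Test functions\<close>

lemma borel_measurable_fst_snd [measurable]:
  "(fst :: 'a::topological_space \<times> 'b::topological_space \<Rightarrow> 'a) \<in> borel_measurable borel"
  "(snd :: 'a::topological_space \<times> 'b::topological_space \<Rightarrow> 'b) \<in> borel_measurable borel"
  by (intro borel_measurable_continuous_onI continuous_intros)+

lemma integral_lborel_Pair:
  fixes f :: "real \<times> real \<Rightarrow> real"
  assumes "integrable lborel f"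
  shows "integral\<^sup>L lborel f = (\<integral>t. \<integral>x. f (t, x) \<partial>lborel \<partial>lborel)"
  using lborel_pair.integral_fst'[of f] assms by (simp add: lborel_prod)

lemma integral_lborel_Pair_swap:
  fixes f :: "real \<times> real \<Rightarrow> real"
  assumes "integrable lborel f"
  shows "integral\<^sup>L lborel f = (\<integral>x. \<integral>t. f (t, x) \<partial>lborel \<partial>lborel)"
  using lborel_pair.integral_snd[of "\<lambda>t x. f (t, x)"] assms by (simp add: lborel_prod)

lemma integrable_lborel_bounded:
  fixes f :: "'a::euclidean_space \<Rightarrow> real"
  assumes "f \<in> borel_measurable borel" and "\<And>z. \<bar>f z\<bar> \<le> C"
    and "\<And>z. z \<notin> A \<Longrightarrow> f z = 0" and "bounded A"
  shows "integrable lborel f"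
proof -
  obtain a b where A: "A \<subseteq> cbox a b"
    using bounded_subset_cbox_symmetric[OF \<open>bounded A\<close>] by metis
  show ?thesis
  proof (rule Bochner_Integration.integrable_bound)
    show "integrable lborel (\<lambda>z. C * indicator (cbox a b) z)"
      by (intro integrable_mult_right integrable_real_indicator) (simp_all add: emeasure_lborel_cbox_finite[simplified])
    show "AE z in lborel. norm (f z) \<le> norm (C * indicator (cbox a b) z)"
      using A assms(2,3) by (intro AE_I2) (force simp: indicator_def intro: order_trans[OF _ abs_ge_self])
  qed (use assms in auto)
qed

section \<open>Partial derivatives and supports of test functions\<close>

abbreviation dt :: "(real \<times> real \<Rightarrow> real) \<Rightarrow> real \<times> real \<Rightarrow> real" where
  "dt \<phi> z \<equiv> frechet_derivative \<phi> (at z) (1, 0)"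

abbreviation dx :: "(real \<times> real \<Rightarrow> real) \<Rightarrow> real \<times> real \<Rightarrow> real" where
  "dx \<phi> z \<equiv> frechet_derivative \<phi> (at z) (0, 1)"

lemma smooth_has_derivative:
  "smooth \<phi> \<Longrightarrow> (\<phi> has_derivative frechet_derivative \<phi> (at z)) (at z)"
  using Ck_Suc_has_derivative by (auto simp: smooth_def simp del: Ck.simps)

lemma smooth_frechet_derivative: "smooth \<phi> \<Longrightarrow> smooth (\<lambda>z. frechet_derivative \<phi> (at z) d)"
  unfolding smooth_def by (metis Ck.simps(2))

lemma continuous_dt: "smooth \<phi> \<Longrightarrow> continuous_on A (dt \<phi>)"
  and continuous_dx: "smooth \<phi> \<Longrightarrow> continuous_on A (dx \<phi>)"
  by (simp_all add: smooth_imp_continuous_on smooth_frechet_derivative)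

lemma frechet_derivative_Pair:
  assumes "smooth \<phi>"
  shows "frechet_derivative \<phi> (at z) (a, b) = a * dt \<phi> z + b * dx \<phi> z"
proof -
  have lin: "linear (frechet_derivative \<phi> (at z))"
    using smooth_has_derivative[OF assms] has_derivative_linear by blast
  have "(a, b) = a *\<^sub>R (1, 0) + b *\<^sub>R (0, 1::real)" by simp
  then have "frechet_derivative \<phi> (at z) (a, b) = frechet_derivative \<phi> (at z) (a *\<^sub>R (1, 0) + b *\<^sub>R (0, 1))"
    by simp
  also have "\<dots> = a * dt \<phi> z + b * dx \<phi> z"
    by (simp only: linear_add[OF lin] linear_scale[OF lin] real_scaleR_def)
  finally show ?thesis .
qed

lemma smooth_along_line:
  assumes "smooth \<phi>"
  shows "((\<lambda>t. \<phi> (t, y + k * t)) has_real_derivative dt \<phi> (t, y + k * t) + k * dx \<phi> (t, y + k * t)) (at t)"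
proof -
  have "((\<lambda>t. (t, y + k * t)) has_derivative (\<lambda>h. (h, k * h))) (at t)"
    by (auto intro!: derivative_eq_intros)
  note diff_chain_at[OF this smooth_has_derivative[OF assms]]
  moreover have "frechet_derivative \<phi> (at (t, y + k * t)) \<circ> (\<lambda>h. (h, k * h)) =
      (*) (dt \<phi> (t, y + k * t) + k * dx \<phi> (t, y + k * t))"
    by (rule ext, simp only: o_def, subst frechet_derivative_Pair[OF assms]) (simp only: algebra_simps)
  ultimately show ?thesis
    by (simp add: has_field_derivative_def o_def)
qed

lemma smooth_deriv_dt: "smooth \<phi> \<Longrightarrow> ((\<lambda>\<tau>. \<phi> (\<tau>, x)) has_real_derivative dt \<phi> (t, x)) (at t)"
  using smooth_along_line[of \<phi> x 0 t] by simp

lemma smooth_deriv_dx: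
  assumes "smooth \<phi>" shows "((\<lambda>y. \<phi> (t, y)) has_real_derivative dx \<phi> (t, x)) (at x)"
proof -
  have "((\<lambda>y. (t, y)) has_derivative (\<lambda>h. (0, h))) (at x)"
    by (auto intro!: derivative_eq_intros)
  note diff_chain_at[OF this smooth_has_derivative[OF assms]]
  moreover have "frechet_derivative \<phi> (at (t, x)) \<circ> (\<lambda>h. (0, h)) = (*) (dx \<phi> (t, x))"
    by (rule ext, simp only: o_def, subst frechet_derivative_Pair[OF assms]) simp
  ultimately show ?thesis
    by (simp add: has_field_derivative_def o_def)
qed

lemma frechet_derivative_zero_outside_support:
  assumes "z \<notin> closure {z. \<phi> z \<noteq> (0::real)}"
  shows "frechet_derivative \<phi> (at z) = (\<lambda>_. 0)"
proof -
  have "((\<lambda>_. 0) has_derivative (\<lambda>_. 0)) (at z)" by simp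
  then have "(\<phi> has_derivative (\<lambda>_. 0)) (at z)"
  proof (rule has_derivative_transform_within_open)
    show "open (- closure {z. \<phi> z \<noteq> 0})" by auto
    fix y assume "y \<in> - closure {z. \<phi> z \<noteq> 0}"
    then show "0 = \<phi> y" using closure_subset[of "{z. \<phi> z \<noteq> 0}"] by auto
  qed (use assms in auto)
  then show ?thesis by (rule frechet_derivative_at[symmetric])
qed

lemma test_function_smooth: "test_function T \<phi> \<Longrightarrow> smooth \<phi>"
  by (simp add: test_function_def smooth_def)

lemma test_function_box:
  assumes "test_function T \<phi>"
  obtains B where "B > 0" "closure {z. \<phi> z \<noteq> 0} \<subseteq> {0<..<T} \<times> {-B..B}"
proof -
  obtain B where B: "B > 0" "\<And>z. z \<in> closure {z. \<phi> z \<noteq> 0} \<Longrightarrow> norm z \<le> B"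
    using assms compact_imp_bounded bounded_pos unfolding test_function_def by metis
  have "closure {z. \<phi> z \<noteq> 0} \<subseteq> {0<..<T} \<times> {-B..B}"
  proof
    fix z assume z: "z \<in> closure {z. \<phi> z \<noteq> 0}"
    then have "z \<in> {0<..<T} \<times> UNIV" using assms by (auto simp: test_function_def)
    moreover have "\<bar>snd z\<bar> \<le> B" using B(2)[OF z] norm_snd_le[of "snd z" "fst z"] by simp
    ultimately show "z \<in> {0<..<T} \<times> {-B..B}" by (cases z) auto
  qed
  with B that show ?thesis by blast
qed

text \<open>The support of the test function lies in the open strip, so the integral may run over
  the whole plane. The derivatives of the slices become values of one Frechet derivative, to which
  the smoothness calculus applies.\<close>

lemma distr_div_eq:
  assumes "test_function T \<phi>"
  shows "distr_div T a b \<phi> =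
    - (\<integral>z. a (fst z) (snd z) * dt \<phi> z + b (fst z) (snd z) * dx \<phi> z \<partial>lborel)"
proof -
  have s: "smooth \<phi>" by (rule test_function_smooth[OF assms])
  obtain B where B: "closure {z. \<phi> z \<noteq> 0} \<subseteq> {0<..<T} \<times> {-B..B}"
    using test_function_box[OF assms] by metis
  have "deriv (\<lambda>\<tau>. \<phi> (\<tau>, x)) t = dt \<phi> (t, x)" "deriv (\<lambda>y. \<phi> (t, y)) x = dx \<phi> (t, x)" for t x
    using s by (auto intro!: DERIV_imp_deriv smooth_deriv_dt smooth_deriv_dx)
  moreover have "indicator ({0<..<T} \<times> UNIV) z *\<^sub>R (a (fst z) (snd z) * dt \<phi> z + b (fst z) (snd z) * dx \<phi> z)
      = a (fst z) (snd z) * dt \<phi> z + b (fst z) (snd z) * dx \<phi> z" for z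
  proof (cases "z \<in> {0<..<T} \<times> UNIV")
    case False
    then have "z \<notin> closure {z. \<phi> z \<noteq> 0}" using B by auto
    then show ?thesis using frechet_derivative_zero_outside_support[of z \<phi>] by simp
  qed simp
  ultimately show ?thesis
    unfolding distr_div_def set_lebesgue_integral_def case_prod_beta prod.collapse
    by (simp only: prod.collapse)
qed

lemma continuous_zero_outside_bounded:
  fixes g :: "'a::euclidean_space \<Rightarrow> real"
  assumes "continuous_on UNIV g" and "bounded A" and "\<And>z. z \<notin> A \<Longrightarrow> g z = 0"
  obtains C where "C \<ge> 0" "\<And>z. \<bar>g z\<bar> \<le> C"
proof -
  have "bounded (g ` closure A)"
    using assms by (intro compact_imp_bounded compact_continuous_image)
      (auto simp: compact_closure intro: continuous_on_subset)
  then obtain C where C: "C > 0" "\<And>z. z \<in> closure A \<Longrightarrow> \<bar>g z\<bar> \<le> C"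
    unfolding bounded_pos by auto
  have "\<bar>g z\<bar> \<le> C" for z
    using C assms(3)[of z] closure_subset[of A] by (cases "z \<in> A") auto
  then show ?thesis using that[of C] C(1) by simp
qed

text \<open>A profile translated with speed \<open>k\<close> solves the transport equation, without any regularity of
  the profile: shearing the plane turns the integral over \<open>t\<close> into that of a total derivative.\<close>

lemma integral_translated_profile:
  assumes \<phi>: "test_function T \<phi>" and w[measurable]: "w \<in> borel_measurable borel"
    and C: "\<And>y. \<bar>w y\<bar> \<le> C"
  shows "(\<integral>z. w (snd z - k * fst z) * (dt \<phi> z + k * dx \<phi> z) \<partial>lborel) = 0"
proof -
  have s: "smooth \<phi>" by (rule test_function_smooth[OF \<phi>])
  obtain B where B: "B > 0" "closure {z. \<phi> z \<noteq> 0} \<subseteq> {0<..<T} \<times> {-B..B}"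
    using test_function_box[OF \<phi>] by metis
  define \<psi> where "\<psi> z = dt \<phi> z + k * dx \<phi> z" for z
  have cont: "continuous_on UNIV \<psi>"
    unfolding \<psi>_def using s by (intro continuous_intros continuous_dt continuous_dx)
  then have [measurable]: "\<psi> \<in> borel_measurable borel" by (rule borel_measurable_continuous_onI)
  have zero: "\<psi> z = 0" if "z \<notin> {0<..<T} \<times> {-B..B}" for z
  proof -
    have "z \<notin> closure {z. \<phi> z \<noteq> 0}" using that B(2) by blast
    then show ?thesis using frechet_derivative_zero_outside_support[of z \<phi>] by (simp add: \<psi>_def)
  qed
  have bdd: "bounded ({0<..<T} \<times> {-B..B})" by (intro bounded_Times) auto
  obtain M where M: "M \<ge> 0" "\<And>z. \<bar>\<psi> z\<bar> \<le> M"
    using continuous_zero_outside_bounded[OF cont bdd zero] by metis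
  have C0: "C \<ge> 0" using C[of 0] by linarith
  have bound: "\<bar>w y * \<psi> z\<bar> \<le> C * M" for y z
    using C[of y] M(2)[of z] C0 by (simp add: abs_mult mult_mono)
  have int1: "integrable lborel (\<lambda>z. w (snd z - k * fst z) * \<psi> z)"
    by (rule integrable_lborel_bounded[OF _ bound _ bdd]) (use zero in simp_all)
  \<comment> \<open>The shear moves points of the strip by at most |k| T, so the box of this
    half-width contains the sheared support.\<close>
  let ?B = "B + \<bar>k\<bar> * \<bar>T\<bar>"
  have int2: "integrable lborel (\<lambda>z. w (snd z) * \<psi> (fst z, snd z + k * fst z))"
  proof (rule integrable_lborel_bounded[OF _ bound])
    show "bounded ({0<..<T} \<times> {-?B..?B})" by (intro bounded_Times) auto
    fix z assume z: "z \<notin> {0<..<T} \<times> {-?B..?B}"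
    have "(fst z, snd z + k * fst z) \<notin> {0<..<T} \<times> {-B..B}"
    proof
      assume *: "(fst z, snd z + k * fst z) \<in> {0<..<T} \<times> {-B..B}"
      then have "\<bar>k * fst z\<bar> \<le> \<bar>k\<bar> * \<bar>T\<bar>" by (auto simp: abs_mult intro!: mult_mono)
      with * z show False by (cases z) (auto simp: abs_le_iff)
    qed
    then show "w (snd z) * \<psi> (fst z, snd z + k * fst z) = 0" by (simp add: zero)
  qed auto
  have "(\<integral>z. w (snd z - k * fst z) * \<psi> z \<partial>lborel) =
      (\<integral>t. \<integral>x. w (x - k * t) * \<psi> (t, x) \<partial>lborel \<partial>lborel)"
    using integral_lborel_Pair[OF int1] by simp
  also have "\<dots> = (\<integral>t. \<integral>x. w x * \<psi> (t, x + k * t) \<partial>lborel \<partial>lborel)"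
  proof (rule Bochner_Integration.integral_cong[OF refl])
    fix t
    show "(\<integral>x. w (x - k * t) * \<psi> (t, x) \<partial>lborel) = (\<integral>x. w x * \<psi> (t, x + k * t) \<partial>lborel)"
      by (subst lborel_integral_real_affine[where c = 1 and t = "k * t"]) (simp_all add: add.commute)
  qed
  also have "\<dots> = (\<integral>x. \<integral>t. w x * \<psi> (t, x + k * t) \<partial>lborel \<partial>lborel)"
    using integral_lborel_Pair[OF int2] integral_lborel_Pair_swap[OF int2] by (simp only: fst_conv snd_conv)
  also have "\<dots> = (\<integral>x. 0 \<partial>(lborel :: real measure))"
  proof (rule Bochner_Integration.integral_cong[OF refl])
    fix x
    show "(\<integral>t. w x * \<psi> (t, x + k * t) \<partial>lborel) = 0"
    \<comment> \<open>For negative T the strip is empty and \<open>\<psi>\<close> vanishes;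
      otherwise the fundamental theorem applies on [0,T].\<close>
    proof (cases "T \<ge> 0")
      case True
      have "(\<integral>t. \<psi> (t, x + k * t) * indicator {0..T} t \<partial>lborel) = \<phi> (T, x + k * T) - \<phi> (0, x + k * 0)"
        unfolding \<psi>_def
      proof (rule integral_FTC_Icc_real[OF True])
        fix t
        show "((\<lambda>t. \<phi> (t, x + k * t)) has_real_derivative
            dt \<phi> (t, x + k * t) + k * dx \<phi> (t, x + k * t)) (at t)"
          by (rule smooth_along_line[OF s])
        have "continuous_on UNIV (\<lambda>t. \<psi> (t, x + k * t))"
          by (intro continuous_on_compose2[OF cont] continuous_intros) auto
        then show "isCont (\<lambda>t. dt \<phi> (t, x + k * t) + k * dx \<phi> (t, x + k * t)) t"
          by (simp add: \<psi>_def continuous_on_eq_continuous_at)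
      qed
      moreover have "\<phi> (T, x + k * T) = 0" "\<phi> (0, x + k * 0) = 0"
        using B(2) closure_subset[of "{z. \<phi> z \<noteq> 0}"] by auto
      moreover have "(\<integral>t. \<psi> (t, x + k * t) * indicator {0..T} t \<partial>lborel) = (\<integral>t. \<psi> (t, x + k * t) \<partial>lborel)"
        by (rule Bochner_Integration.integral_cong[OF refl]) (auto simp: indicator_def intro!: zero)
      ultimately show ?thesis by simp
    next
      case False
      then have "\<psi> z = 0" for z by (rule_tac zero) auto
      then show ?thesis by simp
    qed
  qed
  finally show ?thesis by (simp add: \<psi>_def)
qed

section \<open>Functions in \<open>C([0,T]; L\<^sup>1\<^sub>l\<^sub>o\<^sub>c)\<close>\<close>

lemma C_L1loc_measurable:
  assumes "C_L1loc T a"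
  shows "(\<lambda>z. indicator ({0..T} \<times> UNIV) z * a (fst z) (snd z)) \<in> borel_measurable borel"
  using assms by (simp add: C_L1loc_def set_borel_measurable_def case_prod_beta)

lemma C_L1loc_integrable:
  assumes "C_L1loc T a" "t \<in> {0..T}"
  shows "set_integrable lborel {-B..B} (a t)"
  using assms by (simp add: C_L1loc_def)

lemma C_L1loc_tendsto:
  assumes "C_L1loc T a" "t\<^sub>0 \<in> {0..T}"
  shows "((\<lambda>t. LINT x:{-B..B}|lborel. \<bar>a t x - a t\<^sub>0 x\<bar>) \<longlongrightarrow> 0) (at t\<^sub>0 within {0..T})"
  using assms by (simp add: C_L1loc_def)

lemma set_integrable_times_continuous:
  fixes f g :: "'a::euclidean_space \<Rightarrow> real"
  assumes f: "set_integrable lborel A f" and "bounded A" and g: "continuous_on UNIV g"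
  shows "set_integrable lborel A (\<lambda>z. f z * g z)"
proof -
  have "compact (g ` closure A)"
    using \<open>bounded A\<close> g by (intro compact_continuous_image) (auto simp: compact_closure intro: continuous_on_subset)
  then have "bounded (g ` closure A)" by (rule compact_imp_bounded)
  then obtain M where "\<forall>y\<in>g ` closure A. \<bar>y\<bar> \<le> M" unfolding bounded_real by (elim exE)
  then have M: "\<bar>g z\<bar> \<le> M" if "z \<in> A" for z
    using that closure_subset by fastforce
  have [measurable]: "g \<in> borel_measurable borel"
    using g by (rule borel_measurable_continuous_onI)
  have *: "integrable lborel (\<lambda>z. indicator A z * f z)"
    using f by (simp add: set_integrable_def)
  then have m: "(\<lambda>z. indicator A z * f z) \<in> borel_measurable borel"
    by (simp add: borel_measurable_integrable[of lborel, simplified])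
  have "integrable lborel (\<lambda>z. (indicator A z * f z) * g z)"
  proof (rule Bochner_Integration.integrable_bound)
    show "integrable lborel (\<lambda>z. M * (indicator A z * f z))"
      using * by (rule integrable_mult_right)
    show "AE z in lborel. norm (indicator A z * f z * g z) \<le> norm (M * (indicator A z * f z))"
    proof (rule AE_I2)
      fix z
      show "norm (indicator A z * f z * g z) \<le> norm (M * (indicator A z * f z))"
      proof (cases "z \<in> A")
        case True
        then have "\<bar>g z\<bar> \<le> \<bar>M\<bar>" using M[of z] by linarith
        then have "\<bar>f z\<bar> * \<bar>g z\<bar> \<le> \<bar>f z\<bar> * \<bar>M\<bar>" by (rule mult_left_mono) simp
        then show ?thesis using True by (simp add: abs_mult mult.commute)
      qed simp
    qed
    have "(\<lambda>z. indicator A z * f z * g z) \<in> borel_measurable borel"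
      using m by measurable
    then show "(\<lambda>z. indicator A z * f z * g z) \<in> borel_measurable lborel" by simp
  qed
  then show ?thesis by (simp add: set_integrable_def mult.assoc)
qed

text \<open>By the reverse triangle inequality the local norm is a continuous function of time,
  hence bounded on the compact interval.\<close>

lemma C_L1loc_bounded:
  assumes a: "C_L1loc T a"
  obtains C where "\<And>t. t \<in> {0..T} \<Longrightarrow> (LINT x:{-B..B}|lborel. \<bar>a t x\<bar>) \<le> C"
proof -
  define m where "m t = (LINT x:{-B..B}|lborel. \<bar>a t x\<bar>)" for t
  have "continuous_on {0..T} m"
    unfolding continuous_on_def
  proof
    fix t0 assume t0: "t0 \<in> {0..T}"
    have "((\<lambda>t. m t - m t0) \<longlongrightarrow> 0) (at t0 within {0..T})"
    proof (rule Lim_null_comparison[OF _ C_L1loc_tendsto[OF a t0, of B]])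
      show "\<forall>\<^sub>F t in at t0 within {0..T}. norm (m t - m t0) \<le> (LINT x:{-B..B}|lborel. \<bar>a t x - a t0 x\<bar>)"
        unfolding eventually_at_filter
      proof (intro always_eventually allI impI)
        fix t assume t: "t \<in> {0..T}"
        note i = C_L1loc_integrable[OF a t, of B] C_L1loc_integrable[OF a t0, of B]
        have "m t - m t0 = (LINT x:{-B..B}|lborel. \<bar>a t x\<bar> - \<bar>a t0 x\<bar>)"
          unfolding m_def using i by (intro set_integral_diff(2)[symmetric] set_integrable_abs)
        also have "norm \<dots> \<le> (LINT x:{-B..B}|lborel. norm (\<bar>a t x\<bar> - \<bar>a t0 x\<bar>))"
          using i by (intro set_integral_norm_bound set_integral_diff set_integrable_abs)
        also have "\<dots> \<le> (LINT x:{-B..B}|lborel. \<bar>a t x - a t0 x\<bar>)"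
          using i by (intro set_integral_mono set_integrable_norm set_integrable_abs set_integral_diff) auto
        finally show "norm (m t - m t0) \<le> (LINT x:{-B..B}|lborel. \<bar>a t x - a t0 x\<bar>)" .
      qed
    qed
    then show "(m \<longlongrightarrow> m t0) (at t0 within {0..T})" by (simp add: LIM_zero_iff)
  qed
  then have "bounded (m ` {0..T})"
    by (intro compact_imp_bounded compact_continuous_image) auto
  then obtain C where "\<forall>y\<in>m ` {0..T}. \<bar>y\<bar> \<le> C" unfolding bounded_real by blast
  then have "m t \<le> C" if "t \<in> {0..T}" for t
    using that by (meson abs_ge_self image_eqI order_trans)
  then show ?thesis using that[of C] by (simp add: m_def)
qed

text \<open>Fubini's criterion: the slices are integrable with uniformly bounded norms, and the
  joint measurability in \<open>C_L1loc\<close> makes the criterion applicable.\<close>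

lemma C_L1loc_integrable_spacetime:
  assumes a: "C_L1loc T a"
  shows "set_integrable lborel ({0..T} \<times> {-B..B}) (\<lambda>z. a (fst z) (snd z))"
proof -
  define F where "F z = indicator ({0..T} \<times> {-B..B}) z * a (fst z) (snd z)" for z
  have "F = (\<lambda>z. indicator (UNIV \<times> {-B..B}) z * (indicator ({0..T} \<times> UNIV) z * a (fst z) (snd z)))"
    by (auto simp: F_def indicator_def fun_eq_iff)
  also have "\<dots> \<in> borel_measurable borel"
    by (intro borel_measurable_times borel_measurable_indicator C_L1loc_measurable[OF a])
      (simp add: closed_Times borel_closed)
  finally have F[measurable]: "F \<in> borel_measurable borel" .
  then have F': "F \<in> borel_measurable (lborel \<Otimes>\<^sub>M lborel)" by (simp add: lborel_prod)
  obtain C where C: "\<And>t. t \<in> {0..T} \<Longrightarrow> (LINT x:{-B..B}|lborel. \<bar>a t x\<bar>) \<le> C"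
    using C_L1loc_bounded[OF a] by metis
  have slice: "(\<lambda>x. F (t, x)) = (\<lambda>x. indicator {0..T} t * (indicator {-B..B} x * a t x))" for t
    by (auto simp: F_def indicator_def)
  have inner: "integrable lborel (\<lambda>x. F (t, x))" for t
    using C_L1loc_integrable[OF a, of t B] by (cases "t \<in> {0..T}") (auto simp: slice set_integrable_def)
  have norm: "(\<integral>x. \<bar>F (t, x)\<bar> \<partial>lborel) = indicator {0..T} t * (LINT x:{-B..B}|lborel. \<bar>a t x\<bar>)" for t
    by (cases "t \<in> {0..T}") (simp_all add: F_def indicator_times set_lebesgue_integral_def abs_mult)
  have "integrable (lborel \<Otimes>\<^sub>M lborel) F"
  proof (rule lborel_pair.Fubini_integrable[OF F'])
    show "integrable lborel (\<lambda>t. \<integral>x. norm (F (t, x)) \<partial>lborel)"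
      unfolding real_norm_def
    proof (rule integrable_lborel_bounded[where A = "{0..T}" and C = "max C 0"])
      show "(\<lambda>t. \<integral>x. \<bar>F (t, x)\<bar> \<partial>lborel) \<in> borel_measurable borel"
        using F' by measurable
      show "\<bar>\<integral>x. \<bar>F (t, x)\<bar> \<partial>lborel\<bar> \<le> max C 0" for t
        using C[of t] by (cases "t \<in> {0..T}")
          (simp_all add: norm set_lebesgue_integral_def max.coboundedI1)
    qed (simp_all add: norm)
  qed (use inner in auto)
  then show ?thesis by (simp add: F_def[abs_def] set_integrable_def lborel_prod)
qed

text \<open>Stability under Lipschitz functions of two arguments covers sums, negatives and the
  Kruzhkov entropies |u - k| in one proof.\<close>

lemma C_L1loc_compose:
  assumes a: "C_L1loc T a" and b: "C_L1loc T b"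
    and G: "\<And>x y x' y'. \<bar>G x y - G x' y'\<bar> \<le> M * (\<bar>x - x'\<bar> + \<bar>y - y'\<bar>)" and M: "M \<ge> 0"
    and meas: "(\<lambda>z. G (fst z) (snd z)) \<in> borel_measurable borel"
  shows "C_L1loc T (\<lambda>t x. G (a t x) (b t x))"
proof -
  note [measurable] = C_L1loc_measurable[OF a] C_L1loc_measurable[OF b]
  have Gm: "(\<lambda>z. G (f z) (g z)) \<in> borel_measurable N"
    if [measurable]: "f \<in> borel_measurable N" "g \<in> borel_measurable N" for f g and N :: "'c measure"
  proof -
    have "(\<lambda>z. (f z, g z)) \<in> borel_measurable N" by measurable
    from measurable_compose[OF this meas] show ?thesis by simp
  qed
  have "(\<lambda>z. indicator ({0..T} \<times> UNIV) z * G (a (fst z) (snd z)) (b (fst z) (snd z))) =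
      (\<lambda>z. indicator ({0..T} \<times> UNIV) z * G (indicator ({0..T} \<times> UNIV) z * a (fst z) (snd z))
         (indicator ({0..T} \<times> UNIV) z * b (fst z) (snd z)))"
    by (auto simp: indicator_def fun_eq_iff)
  also have "\<dots> \<in> borel_measurable borel"
    by (intro borel_measurable_times Gm borel_measurable_indicator C_L1loc_measurable[OF a] C_L1loc_measurable[OF b])
      (simp_all add: closed_Times borel_closed)
  finally have 1: "set_borel_measurable lborel ({0..T} \<times> UNIV) (\<lambda>(t, x). G (a t x) (b t x))"
    by (simp add: set_borel_measurable_def case_prod_beta)
  have int: "set_integrable lborel K (\<lambda>x. G (a t x) (b t x))" if K: "compact K" and t: "t \<in> {0..T}" for K t
  proof -
    have ia: "set_integrable lborel K (a t)" "set_integrable lborel K (b t)"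
      using a b K t by (auto simp: C_L1loc_def)
    have [measurable]: "K \<in> sets borel" using K by (simp add: compact_imp_closed)
    have mk: "(\<lambda>x. indicator K x * a t x) \<in> borel_measurable lborel" "(\<lambda>x. indicator K x * b t x) \<in> borel_measurable lborel"
      using ia by (auto simp: set_integrable_def)
    show ?thesis
      unfolding set_integrable_def
    proof (rule Bochner_Integration.integrable_bound)
      show "integrable lborel (\<lambda>x. \<bar>G 0 0\<bar> * indicator K x + M * (\<bar>indicator K x * a t x\<bar> + \<bar>indicator K x * b t x\<bar>))"
        using ia K by (intro Bochner_Integration.integrable_add integrable_mult_right integrable_abs integrable_real_indicator)
          (simp_all add: set_integrable_def emeasure_compact_finite[OF K, simplified])
      have "(\<lambda>x. indicator K x *\<^sub>R G (a t x) (b t x)) =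
          (\<lambda>x. indicator K x * G (indicator K x * a t x) (indicator K x * b t x))"
        by (auto simp: indicator_def)
      also have "\<dots> \<in> borel_measurable lborel"
        by (intro borel_measurable_times Gm mk) auto
      finally show "(\<lambda>x. indicator K x *\<^sub>R G (a t x) (b t x)) \<in> borel_measurable lborel" .
      show "AE x in lborel. norm (indicator K x *\<^sub>R G (a t x) (b t x)) \<le>
          norm (\<bar>G 0 0\<bar> * indicator K x + M * (\<bar>indicator K x * a t x\<bar> + \<bar>indicator K x * b t x\<bar>))"
      proof (rule AE_I2)
        fix x
        have "\<bar>G (a t x) (b t x)\<bar> \<le> \<bar>G 0 0\<bar> + M * (\<bar>a t x\<bar> + \<bar>b t x\<bar>)"
          using G[of "a t x" "b t x" 0 0] by auto
        then show "norm (indicator K x *\<^sub>R G (a t x) (b t x)) \<le>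
          norm (\<bar>G 0 0\<bar> * indicator K x + M * (\<bar>indicator K x * a t x\<bar> + \<bar>indicator K x * b t x\<bar>))"
          by (cases "x \<in> K") auto
      qed
    qed
  qed
  have lim: "((\<lambda>t. LINT x:K|lborel. \<bar>G (a t x) (b t x) - G (a t0 x) (b t0 x)\<bar>) \<longlongrightarrow> 0) (at t0 within {0..T})"
    if K: "compact K" and t0: "t0 \<in> {0..T}" for K t0
  proof (rule Lim_null_comparison)
    have "((\<lambda>t. LINT x:K|lborel. \<bar>a t x - a t0 x\<bar>) \<longlongrightarrow> 0) (at t0 within {0..T})"
      "((\<lambda>t. LINT x:K|lborel. \<bar>b t x - b t0 x\<bar>) \<longlongrightarrow> 0) (at t0 within {0..T})"
      using a b K t0 by (auto simp: C_L1loc_def)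
    from tendsto_mult_left[OF tendsto_add[OF this], of M]
    show "((\<lambda>t. M * ((LINT x:K|lborel. \<bar>a t x - a t0 x\<bar>) + (LINT x:K|lborel. \<bar>b t x - b t0 x\<bar>))) \<longlongrightarrow> 0)
        (at t0 within {0..T})" by simp
    show "\<forall>\<^sub>F t in at t0 within {0..T}. norm (LINT x:K|lborel. \<bar>G (a t x) (b t x) - G (a t0 x) (b t0 x)\<bar>) \<le>
        M * ((LINT x:K|lborel. \<bar>a t x - a t0 x\<bar>) + (LINT x:K|lborel. \<bar>b t x - b t0 x\<bar>))"
      unfolding eventually_at_filter
    proof (intro always_eventually allI impI)
      fix t assume t: "t \<in> {0..T}"
      have ia: "set_integrable lborel K (\<lambda>x. \<bar>a t x - a t0 x\<bar>)" "set_integrable lborel K (\<lambda>x. \<bar>b t x - b t0 x\<bar>)"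
        using a b K t t0 by (auto simp: C_L1loc_def intro!: set_integrable_abs set_integral_diff)
      have "norm (LINT x:K|lborel. \<bar>G (a t x) (b t x) - G (a t0 x) (b t0 x)\<bar>) =
          (LINT x:K|lborel. \<bar>G (a t x) (b t x) - G (a t0 x) (b t0 x)\<bar>)"
        by (simp add: set_lebesgue_integral_def)
      also have "\<dots> \<le> (LINT x:K|lborel. M * (\<bar>a t x - a t0 x\<bar> + \<bar>b t x - b t0 x\<bar>))"
      proof (rule set_integral_mono)
        show "set_integrable lborel K (\<lambda>x. \<bar>G (a t x) (b t x) - G (a t0 x) (b t0 x)\<bar>)"
          by (intro set_integrable_abs set_integral_diff int K t t0)
        show "set_integrable lborel K (\<lambda>x. M * (\<bar>a t x - a t0 x\<bar> + \<bar>b t x - b t0 x\<bar>))"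
          using ia by (simp add: set_integral_add)
      qed (rule G)
      also have "\<dots> = M * ((LINT x:K|lborel. \<bar>a t x - a t0 x\<bar>) + (LINT x:K|lborel. \<bar>b t x - b t0 x\<bar>))"
        using ia by (simp add: set_integral_add)
      finally show "norm (LINT x:K|lborel. \<bar>G (a t x) (b t x) - G (a t0 x) (b t0 x)\<bar>) \<le>
        M * ((LINT x:K|lborel. \<bar>a t x - a t0 x\<bar>) + (LINT x:K|lborel. \<bar>b t x - b t0 x\<bar>))" .
    qed
  qed
  show ?thesis
    unfolding C_L1loc_def using 1 int lim by blast
qed

section \<open>From weak inequalities to inequalities at fixed times\<close>

lemma weighted_average:
  fixes F k m :: "real \<Rightarrow> real"
  assumes "a \<le> b" and F: "\<And>x. (F has_real_derivative k x) (at x)" and k: "continuous_on UNIV k"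
    and "\<And>x. 0 \<le> k x" and 1: "F b - F a = 1"
    and m: "continuous_on {a..b} m"
  shows "integrable lborel (\<lambda>x. indicator {a..b} x * (k x * m x))"
    and "(\<And>x. x \<in> {a..b} \<Longrightarrow> m x \<le> M) \<Longrightarrow> (\<integral>x. indicator {a..b} x * (k x * m x) \<partial>lborel) \<le> M"
    and "(\<And>x. x \<in> {a..b} \<Longrightarrow> M \<le> m x) \<Longrightarrow> M \<le> (\<integral>x. indicator {a..b} x * (k x * m x) \<partial>lborel)"
proof -
  have "continuous_on {a..b} (\<lambda>x. k x * m x)"
    using k m by (intro continuous_on_mult) (auto intro: continuous_on_subset)
  from borel_integrable_atLeastAtMost'[OF this]
  show int: "integrable lborel (\<lambda>x. indicator {a..b} x * (k x * m x))"
    by (simp add: set_integrable_def)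
  have "has_bochner_integral lborel (\<lambda>x. k x * indicator {a..b} x) 1"
    unfolding 1[symmetric]
    by (rule has_bochner_integral_FTC_Icc_real[OF \<open>a \<le> b\<close> F])
      (use k in \<open>simp add: continuous_on_eq_continuous_at\<close>)
  then have int1: "integrable lborel (\<lambda>x. k x * indicator {a..b} x)"
    and eq1: "(\<integral>x. k x * indicator {a..b} x \<partial>lborel) = 1"
    by (simp_all add: has_bochner_integral_iff)
  have eqM: "(\<integral>x. M * (k x * indicator {a..b} x) \<partial>lborel) = M" by (simp add: eq1)
  have intM: "integrable lborel (\<lambda>x. M * (k x * indicator {a..b} x))"
    using int1 by (rule integrable_mult_right)
  show "(\<integral>x. indicator {a..b} x * (k x * m x) \<partial>lborel) \<le> M" if *: "\<And>x. x \<in> {a..b} \<Longrightarrow> m x \<le> M"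
  proof -
    have "(\<integral>x. indicator {a..b} x * (k x * m x) \<partial>lborel) \<le> (\<integral>x. M * (k x * indicator {a..b} x) \<partial>lborel)"
    proof (rule integral_mono[OF int intM])
      fix x
      have "k x * m x \<le> k x * M" if "x \<in> {a..b}"
        using *[OF that] assms(4) by (rule mult_left_mono)
      then show "indicator {a..b} x * (k x * m x) \<le> M * (k x * indicator {a..b} x)"
        by (auto simp: indicator_def mult.commute)
    qed
    then show ?thesis by (simp only: eqM)
  qed
  show "M \<le> (\<integral>x. indicator {a..b} x * (k x * m x) \<partial>lborel)" if *: "\<And>x. x \<in> {a..b} \<Longrightarrow> M \<le> m x"
  proof -
    have "(\<integral>x. M * (k x * indicator {a..b} x) \<partial>lborel) \<le> (\<integral>x. indicator {a..b} x * (k x * m x) \<partial>lborel)"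
    proof (rule integral_mono[OF intM int])
      fix x
      have "k x * M \<le> k x * m x" if "x \<in> {a..b}"
        using *[OF that] assms(4) by (rule mult_left_mono)
      then show "M * (k x * indicator {a..b} x) \<le> indicator {a..b} x * (k x * m x)"
        by (auto simp: indicator_def mult.commute)
    qed
    then show ?thesis by (simp only: eqM)
  qed
qed

text \<open>For a smooth \<open>\<theta>\<close> close to the indicator of [t1,t2], the derivative
  is nearly a unit mass at t1 minus one at t2, so the hypothesis tends to - C <= m(t1) - m(t2).
  Supports inside (0,T) reach only interior times; continuity of m adds the times 0 and T.\<close>

lemma time_slices_le:
  fixes m :: "real \<Rightarrow> real"
  assumes cont: "continuous_on {0..T} m" and "0 \<le> C"
    and test: "\<And>\<theta> s\<^sub>1 s\<^sub>2. smooth \<theta> \<Longrightarrow> (\<And>t. 0 \<le> \<theta> t \<and> \<theta> t \<le> 1) \<Longrightarrow> 0 < s\<^sub>1 \<Longrightarrow> s\<^sub>2 < T \<Longrightarrow>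
      (\<And>t. t \<notin> {s\<^sub>1..s\<^sub>2} \<Longrightarrow> \<theta> t = 0) \<Longrightarrow>
      - C \<le> (\<integral>t. indicator {0<..<T} t * (deriv \<theta> t * m t) \<partial>lborel)"
    and t: "0 \<le> t\<^sub>1" "t\<^sub>1 \<le> t\<^sub>2" "t\<^sub>2 \<le> T"
  shows "m t\<^sub>2 \<le> m t\<^sub>1 + C"
proof -
  have interior: "m t2 \<le> m t1 + C" if t: "0 < t1" "t1 < t2" "t2 < T" for t1 t2
  proof (rule field_le_epsilon)
    fix e :: real assume "e > 0"
    define \<eta> where "\<eta> = e / 2"
    have "\<eta> > 0" using \<open>e > 0\<close> by (simp add: \<eta>_def)
    from cont have c: "\<forall>x\<in>{0..T}. \<forall>e>0. \<exists>d>0. \<forall>x'\<in>{0..T}. dist x' x < d \<longrightarrow> dist (m x') (m x) < e"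
      by (simp add: continuous_on_iff)
    obtain d1 where d1: "d1 > 0" "\<And>x'. x' \<in> {0..T} \<Longrightarrow> dist x' t1 < d1 \<Longrightarrow> dist (m x') (m t1) < \<eta>"
      using c[rule_format, of t1 \<eta>] t \<open>\<eta> > 0\<close> by auto
    obtain d2 where d2: "d2 > 0" "\<And>x'. x' \<in> {0..T} \<Longrightarrow> dist x' t2 < d2 \<Longrightarrow> dist (m x') (m t2) < \<eta>"
      using c[rule_format, of t2 \<eta>] t \<open>\<eta> > 0\<close> by auto
    \<comment> \<open>A third of the minimum keeps the two transition layers disjoint and inside the
      intervals of continuity around t1 and t2.\<close>
    define \<epsilon> where "\<epsilon> = min (min d1 d2) (t2 - t1) / 3"
    have \<epsilon>: "\<epsilon> > 0" "\<epsilon> < d1" "\<epsilon> < d2" "2 * \<epsilon> < t2 - t1"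
      using d1 d2 t by (auto simp: \<epsilon>_def min_def)
    define \<theta> where "\<theta> t = step ((t - t1) / \<epsilon>) * step ((t2 - t) / \<epsilon>)" for t
    define k1 where "k1 t = step' ((t - t1) / \<epsilon>) / \<epsilon>" for t
    define k2 where "k2 t = step' ((t2 - t) / \<epsilon>) / \<epsilon>" for t
    have D1: "((\<lambda>t. step ((t - t1) / \<epsilon>)) has_real_derivative k1 t) (at t)" for t
      unfolding k1_def by (rule DERIV_cong[OF DERIV_chain2[OF step_deriv]])
        (use \<epsilon> in \<open>auto intro!: derivative_eq_intros\<close>)
    have D2: "((\<lambda>t. step ((t2 - t) / \<epsilon>)) has_real_derivative - k2 t) (at t)" for t
      unfolding k2_def by (rule DERIV_cong[OF DERIV_chain2[OF step_deriv]])
        (use \<epsilon> in \<open>auto intro!: derivative_eq_intros\<close>)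
    have k1_0: "k1 t = 0" if "t \<notin> {t1..t1 + \<epsilon>}" for t
    proof -
      have "(t - t1) / \<epsilon> \<le> 0 \<or> 1 \<le> (t - t1) / \<epsilon>" using that \<epsilon> by (auto simp: field_simps)
      then show ?thesis unfolding k1_def by (simp only: step'_0)
    qed
    have k2_0: "k2 t = 0" if "t \<notin> {t2 - \<epsilon>..t2}" for t
    proof -
      have "(t2 - t) / \<epsilon> \<le> 0 \<or> 1 \<le> (t2 - t) / \<epsilon>" using that \<epsilon> by (auto simp: field_simps)
      then show ?thesis unfolding k2_def by (simp only: step'_0)
    qed
    have deriv: "deriv \<theta> t = k1 t - k2 t" for t
    proof (rule DERIV_imp_deriv)
      have "(\<theta> has_real_derivative k1 t * step ((t2 - t) / \<epsilon>) + (- k2 t) * step ((t - t1) / \<epsilon>)) (at t)"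
        unfolding \<theta>_def by (rule DERIV_mult[OF D1 D2])
      \<comment> \<open>Where one factor of \<open>\<theta>\<close> varies, the other is already
        1.\<close>
      moreover have "k1 t * step ((t2 - t) / \<epsilon>) = k1 t"
        using k1_0[of t] \<epsilon> by (cases "t \<in> {t1..t1 + \<epsilon>}") (auto simp: field_simps)
      moreover have "k2 t * step ((t - t1) / \<epsilon>) = k2 t"
        using k2_0[of t] \<epsilon> by (cases "t \<in> {t2 - \<epsilon>..t2}") (auto simp: field_simps)
      ultimately show "(\<theta> has_real_derivative k1 t - k2 t) (at t)" by simp
    qed
    have eq: "indicator {0<..<T} t * (deriv \<theta> t * m t) =
        indicator {t1..t1 + \<epsilon>} t * (k1 t * m t) - indicator {t2 - \<epsilon>..t2} t * (k2 t * m t)" for t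
      unfolding deriv using k1_0[of t] k2_0[of t] t \<epsilon>
      by (cases "t \<in> {t1..t1 + \<epsilon>}"; cases "t \<in> {t2 - \<epsilon>..t2}") auto
    have k_cont: "continuous_on UNIV k1" "continuous_on UNIV k2"
      unfolding k1_def k2_def using \<epsilon>
      by (auto intro!: continuous_intros continuous_on_compose2[OF continuous_step'[of UNIV]])
    have kp: "0 \<le> k1 t" "0 \<le> k2 t" for t using \<epsilon> by (auto simp: k1_def k2_def)
    have c1: "continuous_on {t1..t1 + \<epsilon>} m" and c2: "continuous_on {t2 - \<epsilon>..t2} m"
      using t \<epsilon> by (auto intro!: continuous_on_subset[OF cont])
    note w1 = weighted_average[of t1 "t1 + \<epsilon>", OF _ D1 k_cont(1) kp(1) _ c1]
    have D2': "((\<lambda>t. - step ((t2 - t) / \<epsilon>)) has_real_derivative k2 t) (at t)" for t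
      using DERIV_minus[OF D2[of t]] by simp
    note w2 = weighted_average[of "t2 - \<epsilon>" t2, OF _ D2' k_cont(2) kp(2) _ c2]
    have "- C \<le> (\<integral>t. indicator {0<..<T} t * (deriv \<theta> t * m t) \<partial>lborel)"
    proof (rule test)
      show "smooth \<theta>" unfolding \<theta>_def by (intro smooth_intros)
      show "0 \<le> \<theta> t \<and> \<theta> t \<le> 1" for t by (simp add: \<theta>_def mult_le_one)
      show "\<theta> t = 0" if "t \<notin> {t1..t2}" for t
        using that \<epsilon> by (auto simp: \<theta>_def divide_le_0_iff)
    qed (use t in auto)
    also have "\<dots> = (\<integral>t. indicator {t1..t1 + \<epsilon>} t * (k1 t * m t) \<partial>lborel) -
        (\<integral>t. indicator {t2 - \<epsilon>..t2} t * (k2 t * m t) \<partial>lborel)"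
      unfolding eq using \<epsilon> by (intro Bochner_Integration.integral_diff w1 w2) auto
    also have "\<dots> \<le> (m t1 + \<eta>) - (m t2 - \<eta>)"
    proof (rule diff_mono)
      show "(\<integral>t. indicator {t1..t1 + \<epsilon>} t * (k1 t * m t) \<partial>lborel) \<le> m t1 + \<eta>"
      proof (rule w1(2))
        fix x assume x: "x \<in> {t1..t1 + \<epsilon>}"
        then have "dist (m x) (m t1) < \<eta>" using t \<epsilon> by (intro d1) (auto simp: dist_real_def)
        then show "m x \<le> m t1 + \<eta>" by (auto simp: dist_real_def)
      qed (use \<epsilon> in auto)
      show "m t2 - \<eta> \<le> (\<integral>t. indicator {t2 - \<epsilon>..t2} t * (k2 t * m t) \<partial>lborel)"
      proof (rule w2(3))
        fix x assume x: "x \<in> {t2 - \<epsilon>..t2}"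
        then have "dist (m x) (m t2) < \<eta>" using t \<epsilon> by (intro d2) (auto simp: dist_real_def)
        then show "m t2 - \<eta> \<le> m x" by (auto simp: dist_real_def)
      qed (use \<epsilon> in auto)
    qed
    finally show "m t2 \<le> m t1 + C + e" by (simp add: \<eta>_def)
  qed
  show ?thesis
  proof (cases "t\<^sub>1 = t\<^sub>2")
    case False
    define d where "d = t\<^sub>2 - t\<^sub>1"
    have d: "d > 0" using False t by (simp add: d_def)
    \<comment> \<open>The divisor n + 3 gives 2 r(n) < d for all n, so the shrunken interval from t1
      + r(n) to t2 - r(n) is never degenerate.\<close>
    define r where "r n = d * inverse (real (Suc (Suc (Suc n))))" for n
    have r0: "r \<longlonglongrightarrow> 0"
      unfolding r_def using tendsto_mult_left[OF LIMSEQ_ignore_initial_segment[OF LIMSEQ_inverse_real_of_nat, of 2], of d]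
      by simp
    have r: "0 < r n" "2 * r n < d" for n
      using d mult_nonneg_nonneg[of d "real n"] by (auto simp: r_def field_simps intro: add_pos_nonneg)
    have lim: "(\<lambda>n. m (s n)) \<longlonglongrightarrow> m l" if "s \<longlonglongrightarrow> l" "\<And>n. s n \<in> {0..T}" "l \<in> {0..T}" for s l
      using continuous_on_tendsto_compose[OF cont that(1,3)] that(2) by auto
    show ?thesis
    proof (rule LIMSEQ_le)
      show "(\<lambda>n. m (t\<^sub>2 - r n)) \<longlonglongrightarrow> m t\<^sub>2"
      proof (rule lim)
        show "(\<lambda>n. t\<^sub>2 - r n) \<longlonglongrightarrow> t\<^sub>2" using tendsto_diff[OF tendsto_const r0, of t\<^sub>2] by simp
        show "t\<^sub>2 - r n \<in> {0..T}" for n using r[of n] t by (auto simp: d_def)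
      qed (use t in auto)
      have "(\<lambda>n. m (t\<^sub>1 + r n)) \<longlonglongrightarrow> m t\<^sub>1"
      proof (rule lim)
        show "(\<lambda>n. t\<^sub>1 + r n) \<longlonglongrightarrow> t\<^sub>1" using tendsto_add[OF tendsto_const r0, of t\<^sub>1] by simp
        show "t\<^sub>1 + r n \<in> {0..T}" for n using r[of n] t by (auto simp: d_def)
      qed (use t in auto)
      then show "(\<lambda>n. m (t\<^sub>1 + r n) + C) \<longlonglongrightarrow> m t\<^sub>1 + C" by (intro tendsto_intros)
      show "\<exists>N. \<forall>n\<ge>N. m (t\<^sub>2 - r n) \<le> m (t\<^sub>1 + r n) + C"
      proof (intro exI allI impI interior)
        fix n
        show "0 < t\<^sub>1 + r n" "t\<^sub>1 + r n < t\<^sub>2 - r n" "t\<^sub>2 - r n < T"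
          using r[of n] t by (auto simp: d_def)
      qed
    qed
  qed (use \<open>0 \<le> C\<close> in simp)
qed

text \<open>The increment is split in two. In \<open>g1\<close> only the function changes, and the
  bound on \<open>\<Phi>\<close> reduces it to convergence in L1; in \<open>g2\<close> only the
  weight changes, and uniform continuity of \<open>\<Phi>\<close> meets a fixed integrable
  function.\<close>

lemma continuous_on_pairing:
  assumes a: "C_L1loc T a" and \<Phi>: "continuous_on UNIV \<Phi>"
    and zero: "\<And>t x. t \<in> {0..T} \<Longrightarrow> x \<notin> {-B..B} \<Longrightarrow> \<Phi> (t, x) = 0"
  shows "continuous_on {0..T} (\<lambda>t. \<integral>x. a t x * \<Phi> (t, x) \<partial>lborel)"
  unfolding continuous_on_def
proof
  fix t0 assume t0: "t0 \<in> {0..T}"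
  define g1 where "g1 t = (LINT x:{-B..B}|lborel. (a t x - a t0 x) * \<Phi> (t, x))" for t
  define g2 where "g2 t = (LINT x:{-B..B}|lborel. a t0 x * (\<Phi> (t, x) - \<Phi> (t0, x)))" for t
  have cs: "continuous_on UNIV (\<lambda>x. \<Phi> (t, x))" for t
    by (intro continuous_on_compose2[OF \<Phi>] continuous_intros) auto
  have i: "set_integrable lborel {-B..B} (a t)" if "t \<in> {0..T}" for t
    using that by (rule C_L1loc_integrable[OF a])
  have i\<Phi>: "set_integrable lborel {-B..B} (\<lambda>x. a t x * \<Phi> (s, x))" if "t \<in> {0..T}" for t s
    by (rule set_integrable_times_continuous[OF i[OF that] _ cs]) simp
  have unif: "uniformly_continuous_on ({0..T} \<times> {-B..B}) \<Phi>"
    by (intro compact_uniformly_continuous compact_Times) (auto intro: continuous_on_subset[OF \<Phi>])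
  have "bounded (\<Phi> ` ({0..T} \<times> {-B..B}))"
    by (intro compact_imp_bounded compact_continuous_image compact_Times)
      (auto intro: continuous_on_subset[OF \<Phi>])
  then obtain M where M: "\<And>t x. t \<in> {0..T} \<Longrightarrow> x \<in> {-B..B} \<Longrightarrow> \<bar>\<Phi> (t, x)\<bar> \<le> M"
    unfolding bounded_real by blast
  have g1: "(g1 \<longlongrightarrow> 0) (at t0 within {0..T})"
  proof (rule Lim_null_comparison)
    show "((\<lambda>t. M * (LINT x:{-B..B}|lborel. \<bar>a t x - a t0 x\<bar>)) \<longlongrightarrow> 0) (at t0 within {0..T})"
      using tendsto_mult_left[OF C_L1loc_tendsto[OF a t0, of B], of M] by simp
    show "\<forall>\<^sub>F t in at t0 within {0..T}. norm (g1 t) \<le> M * (LINT x:{-B..B}|lborel. \<bar>a t x - a t0 x\<bar>)"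
      unfolding eventually_at_filter
    proof (intro always_eventually allI impI)
      fix t assume t: "t \<in> {0..T}"
      have d: "set_integrable lborel {-B..B} (\<lambda>x. a t x - a t0 x)"
        using i[OF t] i[OF t0] by simp
      have p: "set_integrable lborel {-B..B} (\<lambda>x. (a t x - a t0 x) * \<Phi> (t, x))"
        by (rule set_integrable_times_continuous[OF d _ cs]) simp
      have "norm (g1 t) \<le> (LINT x:{-B..B}|lborel. norm ((a t x - a t0 x) * \<Phi> (t, x)))"
        unfolding g1_def using p by (rule set_integral_norm_bound)
      also have "\<dots> \<le> (LINT x:{-B..B}|lborel. M * \<bar>a t x - a t0 x\<bar>)"
      proof (rule set_integral_mono)
        show "set_integrable lborel {-B..B} (\<lambda>x. norm ((a t x - a t0 x) * \<Phi> (t, x)))"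
          using p by (rule set_integrable_norm)
        show "set_integrable lborel {-B..B} (\<lambda>x. M * \<bar>a t x - a t0 x\<bar>)"
          using set_integrable_abs[OF d] by simp
        show "norm ((a t x - a t0 x) * \<Phi> (t, x)) \<le> M * \<bar>a t x - a t0 x\<bar>" if "x \<in> {-B..B}" for x
          using mult_right_mono[OF M[OF t that], of "\<bar>a t x - a t0 x\<bar>"] by (simp add: abs_mult mult.commute)
      qed
      finally show "norm (g1 t) \<le> M * (LINT x:{-B..B}|lborel. \<bar>a t x - a t0 x\<bar>)" by simp
    qed
  qed
  define N where "N = (LINT x:{-B..B}|lborel. \<bar>a t0 x\<bar>)"
  have N: "N \<ge> 0" by (simp add: N_def set_lebesgue_integral_def)
  have g2: "(g2 \<longlongrightarrow> 0) (at t0 within {0..T})"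
  proof (rule tendstoI)
    fix e :: real assume "e > 0"
    \<comment> \<open>The norm N may vanish, hence the divisor N + 1.\<close>
    define e' where "e' = e / (N + 1)"
    have "e' > 0" using \<open>e > 0\<close> N by (simp add: e'_def)
    then obtain d where d: "d > 0" "\<And>z z'. z \<in> {0..T} \<times> {-B..B} \<Longrightarrow> z' \<in> {0..T} \<times> {-B..B} \<Longrightarrow>
        dist z' z < d \<Longrightarrow> dist (\<Phi> z') (\<Phi> z) < e'"
      using unif unfolding uniformly_continuous_on_def by metis
    have "dist (g2 t) 0 < e" if t: "t \<in> {0..T}" "dist t t0 < d" for t
    proof -
      have p: "set_integrable lborel {-B..B} (\<lambda>x. a t0 x * (\<Phi> (t, x) - \<Phi> (t0, x)))"
        using i\<Phi>[OF t0, of t] i\<Phi>[OF t0, of t0] by (simp add: right_diff_distrib)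
      have "norm (g2 t) \<le> (LINT x:{-B..B}|lborel. norm (a t0 x * (\<Phi> (t, x) - \<Phi> (t0, x))))"
        unfolding g2_def using p by (rule set_integral_norm_bound)
      also have "\<dots> \<le> (LINT x:{-B..B}|lborel. e' * \<bar>a t0 x\<bar>)"
      proof (rule set_integral_mono)
        show "set_integrable lborel {-B..B} (\<lambda>x. norm (a t0 x * (\<Phi> (t, x) - \<Phi> (t0, x))))"
          using p by (rule set_integrable_norm)
        show "set_integrable lborel {-B..B} (\<lambda>x. e' * \<bar>a t0 x\<bar>)"
          using set_integrable_abs[OF i[OF t0]] by simp
        fix x assume x: "x \<in> {-B..B}"
        have "dist (\<Phi> (t, x)) (\<Phi> (t0, x)) < e'"
          using t t0 x by (intro d(2)) (auto simp: dist_Pair_Pair)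
        then have "\<bar>\<Phi> (t, x) - \<Phi> (t0, x)\<bar> \<le> e'" by (simp add: dist_real_def)
        from mult_right_mono[OF this, of "\<bar>a t0 x\<bar>"]
        show "norm (a t0 x * (\<Phi> (t, x) - \<Phi> (t0, x))) \<le> e' * \<bar>a t0 x\<bar>"
          by (simp add: abs_mult mult.commute)
      qed
      also have "\<dots> = e' * N" by (simp add: N_def)
      also have "\<dots> < e' * (N + 1)" using \<open>e' > 0\<close> by simp
      also have "\<dots> = e" using N by (simp add: e'_def)
      finally show ?thesis by (simp add: dist_real_def)
    qed
    then show "\<forall>\<^sub>F t in at t0 within {0..T}. dist (g2 t) 0 < e"
      unfolding eventually_at using d(1) by blast
  qed
  let ?m = "\<lambda>t. \<integral>x. a t x * \<Phi> (t, x) \<partial>lborel"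
  have set: "?m t = (LINT x:{-B..B}|lborel. a t x * \<Phi> (t, x))" if "t \<in> {0..T}" for t
    unfolding set_lebesgue_integral_def
    by (rule Bochner_Integration.integral_cong[OF refl]) (use zero[OF that] in \<open>auto simp: indicator_def\<close>)
  have eq: "?m t = ?m t0 + g1 t + g2 t" if t: "t \<in> {0..T}" for t
  proof -
    have "g1 t = (LINT x:{-B..B}|lborel. a t x * \<Phi> (t, x)) - (LINT x:{-B..B}|lborel. a t0 x * \<Phi> (t, x))"
      unfolding g1_def left_diff_distrib using i\<Phi>[OF t, of t] i\<Phi>[OF t0, of t] by (rule set_integral_diff(2))
    moreover have "g2 t = (LINT x:{-B..B}|lborel. a t0 x * \<Phi> (t, x)) - (LINT x:{-B..B}|lborel. a t0 x * \<Phi> (t0, x))"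
      unfolding g2_def right_diff_distrib using i\<Phi>[OF t0, of t] i\<Phi>[OF t0, of t0] by (rule set_integral_diff(2))
    ultimately show ?thesis using set[OF t] set[OF t0] by simp
  qed
  have "((\<lambda>t. ?m t0 + g1 t + g2 t) \<longlongrightarrow> ?m t0 + 0 + 0) (at t0 within {0..T})"
    by (intro tendsto_intros g1 g2)
  then have "((\<lambda>t. ?m t0 + g1 t + g2 t) \<longlongrightarrow> ?m t0) (at t0 within {0..T})" by simp
  then show "(?m \<longlongrightarrow> ?m t0) (at t0 within {0..T})"
    by (rule Lim_transform_eventually) (simp add: eventually_at_filter eq)
qed

section \<open>Conservation inequalities tested with a spatial weight\<close>

text \<open>This is all that is asked of a flux: unlike a density, it is never evaluated at a fixed
  time.\<close>

definition loc_integrable :: "real \<Rightarrow> (real \<Rightarrow> real \<Rightarrow> real) \<Rightarrow> bool" where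
  "loc_integrable T b \<longleftrightarrow> (\<forall>B. set_integrable lborel ({0<..<T} \<times> {-B..B}) (\<lambda>z. b (fst z) (snd z)))"

text \<open>A common form for the entropy inequalities, the weak equations and their negatives, so
  that one estimate for weighted masses serves them all.\<close>

definition conservation_ineq :: "real \<Rightarrow> (real \<Rightarrow> real \<Rightarrow> real) \<Rightarrow> (real \<Rightarrow> real \<Rightarrow> real) \<Rightarrow> bool" where
  "conservation_ineq T a b \<longleftrightarrow> C_L1loc T a \<and> loc_integrable T b \<and>
     (\<forall>\<phi>. test_function T \<phi> \<and> (\<forall>z. 0 \<le> \<phi> z) \<longrightarrow> distr_div T a b \<phi> \<le> 0)"

lemma C_L1loc_loc_integrable: "C_L1loc T a \<Longrightarrow> loc_integrable T a"
  unfolding loc_integrable_def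
  by (intro allI set_integrable_subset[OF C_L1loc_integrable_spacetime])
    (auto simp: borel_prod[symmetric])

lemma loc_integrable_pairing:
  assumes "loc_integrable T b" and "continuous_on UNIV g"
  shows "integrable lborel (\<lambda>z. indicator ({0<..<T} \<times> {-B..B}) z * (b (fst z) (snd z) * g z))"
proof -
  have "set_integrable lborel ({0<..<T} \<times> {-B..B}) (\<lambda>z. b (fst z) (snd z) * g z)"
    using assms by (intro set_integrable_times_continuous bounded_Times) (auto simp: loc_integrable_def)
  then show ?thesis by (simp add: set_integrable_def)
qed

lemma test_pairing_integrable:
  assumes "loc_integrable T b" and \<phi>: "test_function T \<phi>"
  shows "integrable lborel (\<lambda>z. b (fst z) (snd z) * dt \<phi> z)"
    and "integrable lborel (\<lambda>z. b (fst z) (snd z) * dx \<phi> z)"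
proof -
  have s: "smooth \<phi>" using \<phi> by (rule test_function_smooth)
  obtain B where B: "closure {z. \<phi> z \<noteq> 0} \<subseteq> {0<..<T} \<times> {-B..B}"
    using test_function_box[OF \<phi>] by metis
  have "indicator ({0<..<T} \<times> {-B..B}) z * (b (fst z) (snd z) * frechet_derivative \<phi> (at z) d) =
      b (fst z) (snd z) * frechet_derivative \<phi> (at z) d" for z d
  proof (cases "z \<in> {0<..<T} \<times> {-B..B}")
    case False
    then have "z \<notin> closure {z. \<phi> z \<noteq> 0}" using B by blast
    then show ?thesis using frechet_derivative_zero_outside_support[of z \<phi>] by simp
  qed simp
  then show "integrable lborel (\<lambda>z. b (fst z) (snd z) * dt \<phi> z)"
    and "integrable lborel (\<lambda>z. b (fst z) (snd z) * dx \<phi> z)"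
    using loc_integrable_pairing[OF assms(1) continuous_dt[OF s], of B]
      loc_integrable_pairing[OF assms(1) continuous_dx[OF s], of B] by (simp_all only:)
qed

lemma distr_div_add:
  assumes "loc_integrable T a" "loc_integrable T b" "loc_integrable T a'" "loc_integrable T b'"
    and "test_function T \<phi>"
  shows "distr_div T (\<lambda>t x. a t x + a' t x) (\<lambda>t x. b t x + b' t x) \<phi> =
    distr_div T a b \<phi> + distr_div T a' b' \<phi>"
proof -
  note i = test_pairing_integrable[OF assms(1,5)] test_pairing_integrable[OF assms(2,5)]
    test_pairing_integrable[OF assms(3,5)] test_pairing_integrable[OF assms(4,5)]
  have "(\<integral>z. (a (fst z) (snd z) + a' (fst z) (snd z)) * dt \<phi> z +
        (b (fst z) (snd z) + b' (fst z) (snd z)) * dx \<phi> z \<partial>lborel) =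
      (\<integral>z. (a (fst z) (snd z) * dt \<phi> z + b (fst z) (snd z) * dx \<phi> z) +
        (a' (fst z) (snd z) * dt \<phi> z + b' (fst z) (snd z) * dx \<phi> z) \<partial>lborel)"
    by (simp add: algebra_simps)
  also have "\<dots> = (\<integral>z. a (fst z) (snd z) * dt \<phi> z + b (fst z) (snd z) * dx \<phi> z \<partial>lborel) +
      (\<integral>z. a' (fst z) (snd z) * dt \<phi> z + b' (fst z) (snd z) * dx \<phi> z \<partial>lborel)"
    using i by (intro Bochner_Integration.integral_add Bochner_Integration.integrable_add)
  finally show ?thesis by (simp add: distr_div_eq[OF assms(5)])
qed

lemma distr_div_minus:
  assumes "test_function T \<phi>"
  shows "distr_div T (\<lambda>t x. - a t x) (\<lambda>t x. - b t x) \<phi> = - distr_div T a b \<phi>"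
proof -
  have "(\<integral>z. - a (fst z) (snd z) * dt \<phi> z + - b (fst z) (snd z) * dx \<phi> z \<partial>lborel) =
      (\<integral>z. - (a (fst z) (snd z) * dt \<phi> z + b (fst z) (snd z) * dx \<phi> z) \<partial>lborel)"
    by (rule Bochner_Integration.integral_cong[OF refl]) simp
  also have "\<dots> = - (\<integral>z. a (fst z) (snd z) * dt \<phi> z + b (fst z) (snd z) * dx \<phi> z \<partial>lborel)"
    by (rule Bochner_Integration.integral_minus)
  finally show ?thesis by (simp only: distr_div_eq[OF assms])
qed

lemma C_L1loc_add: "C_L1loc T a \<Longrightarrow> C_L1loc T b \<Longrightarrow> C_L1loc T (\<lambda>t x. a t x + b t x)"
  by (rule C_L1loc_compose[where G = "(+)" and M = 1]) auto

lemma C_L1loc_minus: "C_L1loc T a \<Longrightarrow> C_L1loc T (\<lambda>t x. - a t x)"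
  by (rule C_L1loc_compose[where G = "\<lambda>x y. - x" and M = 1 and b = a]) auto

lemma loc_integrable_add:
  "loc_integrable T a \<Longrightarrow> loc_integrable T b \<Longrightarrow> loc_integrable T (\<lambda>t x. a t x + b t x)"
  by (simp add: loc_integrable_def)

lemma loc_integrable_minus: "loc_integrable T a \<Longrightarrow> loc_integrable T (\<lambda>t x. - a t x)"
  by (simp add: loc_integrable_def set_integrable_def)

lemma conservation_ineq_add:
  assumes "conservation_ineq T a b" "conservation_ineq T a' b'"
  shows "conservation_ineq T (\<lambda>t x. a t x + a' t x) (\<lambda>t x. b t x + b' t x)"
proof -
  have i: "loc_integrable T a" "loc_integrable T b" "loc_integrable T a'" "loc_integrable T b'"
    using assms by (auto simp: conservation_ineq_def intro: C_L1loc_loc_integrable)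
  have "distr_div T (\<lambda>t x. a t x + a' t x) (\<lambda>t x. b t x + b' t x) \<phi> \<le> 0"
    if "test_function T \<phi>" "\<forall>z. 0 \<le> \<phi> z" for \<phi>
    using assms that unfolding distr_div_add[OF i that(1)]
    by (auto simp: conservation_ineq_def intro: add_nonpos_nonpos)
  then show ?thesis
    using assms by (auto simp: conservation_ineq_def intro: C_L1loc_add loc_integrable_add)
qed

text \<open>The weight \<open>\<Phi>\<close> is only localised in space; the test function is \<open>\<theta>(t) \<Phi>(t,x)\<close> with \<open>\<theta>\<close> close to
  the indicator function of \<open>[t\<^sub>1, t\<^sub>2]\<close>.\<close>

lemma weighted_mass_le:
  assumes c: "conservation_ineq T a b" and s: "smooth \<Phi>" and pos: "\<And>z. 0 \<le> \<Phi> z"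
    and zero: "\<And>t x. t \<in> {0..T} \<Longrightarrow> x \<notin> {-B..B} \<Longrightarrow> \<Phi> (t, x) = 0" and "0 \<le> C"
    and flux: "\<And>\<theta>. continuous_on UNIV \<theta> \<Longrightarrow> (\<And>t. 0 \<le> \<theta> t \<and> \<theta> t \<le> 1) \<Longrightarrow>
      (\<integral>z. indicator ({0<..<T} \<times> {-B..B}) z *
        (\<theta> (fst z) * (a (fst z) (snd z) * dt \<Phi> z + b (fst z) (snd z) * dx \<Phi> z)) \<partial>lborel) \<le> C"
    and t: "0 \<le> t\<^sub>1" "t\<^sub>1 \<le> t\<^sub>2" "t\<^sub>2 \<le> T"
  shows "(\<integral>x. a t\<^sub>2 x * \<Phi> (t\<^sub>2, x) \<partial>lborel) \<le> (\<integral>x. a t\<^sub>1 x * \<Phi> (t\<^sub>1, x) \<partial>lborel) + C"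
proof -
  have a: "C_L1loc T a" and b: "loc_integrable T b"
    and ineq: "\<And>\<phi>. test_function T \<phi> \<Longrightarrow> (\<And>z. 0 \<le> \<phi> z) \<Longrightarrow> distr_div T a b \<phi> \<le> 0"
    using c by (auto simp: conservation_ineq_def)
  let ?A = "{0<..<T} \<times> {-B..B}"
  let ?a = "\<lambda>z. a (fst z) (snd z)" and ?b = "\<lambda>z. b (fst z) (snd z)"
  define m where "m t = (\<integral>x. a t x * \<Phi> (t, x) \<partial>lborel)" for t
  have cont\<Phi>: "continuous_on UNIV \<Phi>" using s by (rule smooth_imp_continuous_on)
  have "m t\<^sub>2 \<le> m t\<^sub>1 + C"
  proof (rule time_slices_le[OF _ \<open>0 \<le> C\<close> _ t])
    show "continuous_on {0..T} m"
      unfolding m_def by (rule continuous_on_pairing[OF a cont\<Phi> zero])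
    fix \<theta> :: "real \<Rightarrow> real" and s1 s2
    assume \<theta>: "smooth \<theta>" "\<And>t. 0 \<le> \<theta> t \<and> \<theta> t \<le> 1" "0 < s1" "s2 < T" "\<And>t. t \<notin> {s1..s2} \<Longrightarrow> \<theta> t = 0"
    define \<phi> where "\<phi> z = \<theta> (fst z) * \<Phi> z" for z
    have s\<phi>: "smooth \<phi>"
      unfolding \<phi>_def by (intro smooth_mult smooth_compose[OF \<theta>(1)] smooth_fst s)
    have "\<phi> z = 0" if "z \<notin> {s1..s2} \<times> {-B..B}" for z
    proof (cases "fst z \<in> {s1..s2}")
      case True
      then have "snd z \<notin> {-B..B}" "fst z \<in> {0..T}" using that \<theta>(3,4) by (auto simp: mem_Times_iff)
      then show ?thesis using zero[of "fst z" "snd z"] by (simp add: \<phi>_def)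
    qed (simp add: \<phi>_def \<theta>(5))
    then have "{z. \<phi> z \<noteq> 0} \<subseteq> {s1..s2} \<times> {-B..B}" by blast
    then have supp: "closure {z. \<phi> z \<noteq> 0} \<subseteq> {s1..s2} \<times> {-B..B}"
      by (rule closure_minimal) (simp add: closed_Times)
    have "compact ({s1..s2} \<times> {-B..B})" by (simp add: compact_Times)
    then have "compact (closure {z. \<phi> z \<noteq> 0})"
      using supp by (metis closed_closure compact_Int_closed inf.absorb2)
    moreover have "{s1..s2} \<times> {-B..B} \<subseteq> {0<..<T} \<times> UNIV" using \<theta>(3,4) by auto
    ultimately have test: "test_function T \<phi>"
      using s\<phi> supp by (auto simp: test_function_def smooth_def)
    have D\<theta>: "(\<theta> has_real_derivative deriv \<theta> t) (at t)" for t using smooth_deriv[OF \<theta>(1)] by simp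
    have dt: "dt \<phi> z = deriv \<theta> (fst z) * \<Phi> z + \<theta> (fst z) * dt \<Phi> z" for z
    proof -
      obtain t x where z: "z = (t, x)" by (cases z)
      have "((\<lambda>\<tau>. \<theta> \<tau> * \<Phi> (\<tau>, x)) has_real_derivative deriv \<theta> t * \<Phi> (t, x) + dt \<Phi> (t, x) * \<theta> t) (at t)"
        by (rule DERIV_mult[OF D\<theta> smooth_deriv_dt[OF s]])
      moreover have "((\<lambda>\<tau>. \<theta> \<tau> * \<Phi> (\<tau>, x)) has_real_derivative dt \<phi> (t, x)) (at t)"
        using smooth_deriv_dt[OF s\<phi>, of x t] by (simp add: \<phi>_def)
      ultimately have "dt \<phi> (t, x) = deriv \<theta> t * \<Phi> (t, x) + dt \<Phi> (t, x) * \<theta> t"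
        using DERIV_unique by blast
      then show ?thesis by (simp add: z mult.commute)
    qed
    have dx: "dx \<phi> z = \<theta> (fst z) * dx \<Phi> z" for z
    proof -
      obtain t x where z: "z = (t, x)" by (cases z)
      have "((\<lambda>y. \<theta> t * \<Phi> (t, y)) has_real_derivative \<theta> t * dx \<Phi> (t, x)) (at x)"
        by (rule DERIV_cmult[OF smooth_deriv_dx[OF s]])
      moreover have "((\<lambda>y. \<theta> t * \<Phi> (t, y)) has_real_derivative dx \<phi> (t, x)) (at x)"
        using smooth_deriv_dx[OF s\<phi>, of t x] by (simp add: \<phi>_def)
      ultimately show ?thesis unfolding z using DERIV_unique by simp
    qed
    have c\<theta>: "continuous_on UNIV \<theta>" "continuous_on UNIV (deriv \<theta>)"
      using \<theta>(1) smooth_deriv(2)[OF \<theta>(1)] by (auto intro: smooth_imp_continuous_on)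
    then have c\<theta>': "continuous_on UNIV (\<lambda>z::real \<times> real. \<theta> (fst z))"
      "continuous_on UNIV (\<lambda>z::real \<times> real. deriv \<theta> (fst z))"
      by (auto intro!: continuous_on_compose2[of UNIV _ UNIV fst] continuous_intros)
    have la: "loc_integrable T a" using a by (rule C_L1loc_loc_integrable)
    have i1: "integrable lborel (\<lambda>z. indicator ?A z * (?a z * (deriv \<theta> (fst z) * \<Phi> z)))"
      by (intro loc_integrable_pairing la continuous_on_mult c\<theta>' cont\<Phi>)
    have i2: "integrable lborel (\<lambda>z. indicator ?A z * (?a z * (\<theta> (fst z) * dt \<Phi> z)))"
      by (intro loc_integrable_pairing la continuous_on_mult c\<theta>' continuous_dt s)
    have i3: "integrable lborel (\<lambda>z. indicator ?A z * (?b z * (\<theta> (fst z) * dx \<Phi> z)))"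
      by (intro loc_integrable_pairing b continuous_on_mult c\<theta>' continuous_dx s)
    \<comment> \<open>\<open>?F\<close> collects the terms in which \<open>\<theta>\<close> is not
      differentiated; the assumption on the flux bounds its integral by C. The remaining term
      integrates in x to the derivative of \<open>\<theta>\<close> times m.\<close>
    let ?F = "\<lambda>z. indicator ?A z * (\<theta> (fst z) * (?a z * dt \<Phi> z + ?b z * dx \<Phi> z))"
    have iF: "integrable lborel ?F"
      using Bochner_Integration.integrable_add[OF i2 i3] by (simp add: algebra_simps)
    have "?a z * dt \<phi> z + ?b z * dx \<phi> z = indicator ?A z * (?a z * (deriv \<theta> (fst z) * \<Phi> z)) + ?F z" for z
    proof (cases "z \<in> ?A")
      case False
      moreover have "{s1..s2} \<times> {-B..B} \<subseteq> ?A" using \<theta>(3,4) by auto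
      ultimately have "z \<notin> closure {z. \<phi> z \<noteq> 0}" using supp by blast
      then show ?thesis using frechet_derivative_zero_outside_support[of z \<phi>] False by simp
    qed (simp add: dt dx algebra_simps)
    then have "distr_div T a b \<phi> = - ((\<integral>z. indicator ?A z * (?a z * (deriv \<theta> (fst z) * \<Phi> z)) \<partial>lborel) +
        (\<integral>z. ?F z \<partial>lborel))"
      using Bochner_Integration.integral_add[OF i1 iF] by (simp add: distr_div_eq[OF test])
    moreover have "distr_div T a b \<phi> \<le> 0"
      by (rule ineq[OF test]) (use \<theta>(2) pos in \<open>simp add: \<phi>_def\<close>)
    moreover have "(\<integral>z. ?F z \<partial>lborel) \<le> C"
      by (rule flux[OF c\<theta>(1) \<theta>(2)])
    ultimately have "- C \<le> (\<integral>z. indicator ?A z * (?a z * (deriv \<theta> (fst z) * \<Phi> z)) \<partial>lborel)" by linarith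
    also have "\<dots> = (\<integral>t. \<integral>x. indicator ?A (t, x) * (a t x * (deriv \<theta> t * \<Phi> (t, x))) \<partial>lborel \<partial>lborel)"
      using integral_lborel_Pair[OF i1] by simp
    also have "\<dots> = (\<integral>t. indicator {0<..<T} t * (deriv \<theta> t * m t) \<partial>lborel)"
    proof (rule Bochner_Integration.integral_cong[OF refl])
      fix t
      have "indicator ?A (t, x) * (a t x * (deriv \<theta> t * \<Phi> (t, x))) =
          (indicator {0<..<T} t * deriv \<theta> t) * (a t x * \<Phi> (t, x))" for x
        using zero[of t x] by (cases "t \<in> {0<..<T}"; cases "x \<in> {-B..B}") auto
      then show "(\<integral>x. indicator ?A (t, x) * (a t x * (deriv \<theta> t * \<Phi> (t, x))) \<partial>lborel) =
          indicator {0<..<T} t * (deriv \<theta> t * m t)"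
        by (simp only: m_def integral_mult_right_zero mult.assoc)
    qed
    finally show "- C \<le> (\<integral>t. indicator {0<..<T} t * (deriv \<theta> t * m t) \<partial>lborel)" .
  qed
  then show ?thesis by (simp add: m_def)
qed

section \<open>The explicit solution of the scalar law\<close>

text \<open>Dominated convergence along sequences of times. The exceptional null set, which may
  depend on the time, is there for the sine profile, which has no limit at one moving point.\<close>

lemma C_L1loc_pointwise:
  assumes meas[measurable]: "(\<lambda>z. a (fst z) (snd z)) \<in> borel_measurable borel"
    and M: "\<And>t x. \<bar>a t x\<bar> \<le> M"
    and lim: "\<And>t\<^sub>0. t\<^sub>0 \<in> {0..T} \<Longrightarrow> AE x in lborel. ((\<lambda>t. a t x) \<longlongrightarrow> a t\<^sub>0 x) (at t\<^sub>0 within {0..T})"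
  shows "C_L1loc T a"
proof -
  have m[measurable]: "(\<lambda>x. a t x) \<in> borel_measurable borel" for t
  proof -
    have "(\<lambda>x. (t, x)) \<in> borel_measurable borel" by (intro borel_measurable_continuous_onI continuous_intros)
    from measurable_compose[OF this meas] show ?thesis by simp
  qed
  have i: "set_integrable lborel K g" if "compact K" "g \<in> borel_measurable borel" "\<And>x. \<bar>g x\<bar> \<le> C"
    for K :: "real set" and g and C :: real
    unfolding set_integrable_def
  proof (rule integrable_lborel_bounded[where A = K and C = "\<bar>C\<bar>"])
    show "(\<lambda>x. indicator K x *\<^sub>R g x) \<in> borel_measurable borel"
      using that by (auto simp: compact_imp_closed intro!: borel_measurable_indicator borel_measurable_scaleR borel_closed)
    show "\<bar>indicator K x *\<^sub>R g x\<bar> \<le> \<bar>C\<bar>" for x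
      using that(3)[of x] by (auto simp: indicator_def)
  qed (use that in \<open>auto simp: compact_imp_bounded\<close>)
  have "set_borel_measurable lborel ({0..T} \<times> UNIV) (\<lambda>(t, x). a t x)"
    unfolding set_borel_measurable_def case_prod_beta
    by (intro borel_measurable_scaleR borel_measurable_indicator) (auto simp: closed_Times borel_closed meas)
  moreover have "set_integrable lborel K (a t)" if "compact K" for K t
    using that m M by (rule i)
  moreover have "((\<lambda>t. LINT x:K|lborel. \<bar>a t x - a t0 x\<bar>) \<longlongrightarrow> 0) (at t0 within {0..T})"
    if K: "compact K" and t0: "t0 \<in> {0..T}" for K t0
    unfolding tendsto_at_iff_sequentially
  proof (intro allI impI)
    fix s assume s: "\<forall>n. s n \<in> {0..T} - {t0}" "s \<longlonglongrightarrow> t0"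
    have [measurable]: "K \<in> sets borel" using K by (simp add: compact_imp_closed borel_closed)
    have "(\<lambda>n. \<integral>x. indicator K x * \<bar>a (s n) x - a t0 x\<bar> \<partial>lborel) \<longlonglongrightarrow> (\<integral>x. 0 \<partial>(lborel :: real measure))"
    proof (rule integral_dominated_convergence[where w = "\<lambda>x. 2 * M * indicator K x"])
      show "integrable lborel (\<lambda>x. 2 * M * indicator K x)"
        using K by (intro integrable_mult_right integrable_real_indicator) (simp_all add: emeasure_compact_finite[simplified])
      show "AE x in lborel. (\<lambda>n. indicator K x * \<bar>a (s n) x - a t0 x\<bar>) \<longlonglongrightarrow> 0"
        using lim[OF t0]
      proof eventually_elim
        case (elim x)
        then have "((\<lambda>t. a t x) \<circ> s) \<longlonglongrightarrow> a t0 x"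
          using s unfolding tendsto_at_iff_sequentially by blast
        then have "(\<lambda>n. indicator K x * \<bar>a (s n) x - a t0 x\<bar>) \<longlonglongrightarrow> indicator K x * \<bar>a t0 x - a t0 x\<bar>"
          unfolding o_def by (intro tendsto_intros)
        then show ?case by simp
      qed
      show "AE x in lborel. norm (indicator K x * \<bar>a (s n) x - a t0 x\<bar>) \<le> 2 * M * indicator K x" for n
      proof (rule AE_I2)
        fix x
        have "\<bar>a (s n) x - a t0 x\<bar> \<le> 2 * M" using M[of "s n" x] M[of t0 x] by linarith
        then show "norm (indicator K x * \<bar>a (s n) x - a t0 x\<bar>) \<le> 2 * M * indicator K x"
          by (simp add: indicator_def)
      qed
    qed measurable
    then show "((\<lambda>t. LINT x:K|lborel. \<bar>a t x - a t0 x\<bar>) \<circ> s) \<longlonglongrightarrow> 0"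
      by (simp add: o_def set_lebesgue_integral_def)
  qed
  ultimately show ?thesis by (simp add: C_L1loc_def)
qed

section \<open>The wave speed as an implicit function\<close>

locale burgers_data =
  fixes T p lam A :: real and w\<^sub>0 :: "real \<Rightarrow> real"
  assumes T: "T > 0" and p: "p \<ge> 1" and lam: "lam \<ge> 0" and A: "A \<ge> 0" and small: "lam * T \<le> 1 / 8"
    and lip: "\<And>x y. \<bar>w\<^sub>0 x - w\<^sub>0 y\<bar> \<le> lam * \<bar>x - y\<bar>"
    and nonneg: "\<And>x. 0 \<le> w\<^sub>0 x"
    and supp: "\<And>x. x \<notin> {-A..A} \<Longrightarrow> w\<^sub>0 x = 0"
begin

text \<open>Freezing time outside [0,T] makes the implicit equation uniquely solvable at every time,
  so continuity can be stated on the whole plane.\<close>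

definition clamp :: "real \<Rightarrow> real" where "clamp t = max 0 (min T t)"

definition wsol :: "real \<Rightarrow> real \<Rightarrow> real" where
  "wsol t x = (THE k. w\<^sub>0 (x - k * clamp t) = k)"

definition usol :: "real \<Rightarrow> real \<Rightarrow> real" where
  "usol t x = wsol t x powr (1 / p)"

definition f :: "real \<Rightarrow> real" where "f u = \<bar>u\<bar> powr (p + 1) / (p + 1)"

text \<open>An upper bound for \<open>w\<^sub>0\<close>: the point A + 1 lies outside the support,
  at distance at most 2 A + 1 from every point of [-A,A].\<close>

definition W :: real where "W = lam * (2 * A + 1)"

lemma clamp_bounds: "0 \<le> clamp t" "clamp t \<le> T" and clamp_id [simp]: "t \<in> {0..T} \<Longrightarrow> clamp t = t"
  and clamp_lip: "\<bar>clamp t - clamp s\<bar> \<le> \<bar>t - s\<bar>"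
  using T by (auto simp: clamp_def max_def min_def)

lemma lam_clamp: "lam * clamp t \<le> 1 / 8" "0 \<le> lam * clamp t"
  using mult_left_mono[OF clamp_bounds(2) lam, of t] small lam clamp_bounds(1)[of t] by auto

lemma w0_shift_lip: "\<bar>w\<^sub>0 (x - k * clamp t) - w\<^sub>0 (x - k' * clamp t)\<bar> \<le> \<bar>k - k'\<bar> / 8"
proof -
  have "\<bar>w\<^sub>0 (x - k * clamp t) - w\<^sub>0 (x - k' * clamp t)\<bar> \<le> lam * \<bar>(x - k * clamp t) - (x - k' * clamp t)\<bar>"
    by (rule lip)
  also have "(x - k * clamp t) - (x - k' * clamp t) = clamp t * (k' - k)" by (simp add: algebra_simps)
  also have "lam * \<bar>clamp t * (k' - k)\<bar> = (lam * clamp t) * \<bar>k - k'\<bar>"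
    using clamp_bounds(1)[of t] by (simp add: abs_mult abs_minus_commute)
  also have "\<dots> \<le> 1 / 8 * \<bar>k - k'\<bar>" by (intro mult_right_mono lam_clamp) auto
  finally show ?thesis by simp
qed

lemma wsol_ex1: "\<exists>!k. w\<^sub>0 (x - k * clamp t) = k"
proof -
  have "\<forall>k k'. dist (w\<^sub>0 (x - k * clamp t)) (w\<^sub>0 (x - k' * clamp t)) \<le> 1 / 8 * dist k k'"
    using w0_shift_lip[of x _ t] by (simp add: dist_real_def)
  then show ?thesis
    by (intro banach_fix_type[where c = "1/8"]) auto
qed

lemma wsol_eq: "w\<^sub>0 (x - wsol t x * clamp t) = wsol t x"
  unfolding wsol_def by (rule theI'[OF wsol_ex1])

lemma wsol_unique: "w\<^sub>0 (x - k * clamp t) = k \<Longrightarrow> wsol t x = k"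
  using wsol_ex1[of x t] wsol_eq[of x t] by blast

lemma w0_le_W: "w\<^sub>0 x \<le> W"
proof (cases "x \<in> {-A..A}")
  case True
  have "w\<^sub>0 x \<le> \<bar>w\<^sub>0 x - w\<^sub>0 (A + 1)\<bar>" using supp[of "A + 1"] nonneg[of x] by simp
  also have "\<dots> \<le> lam * \<bar>x - (A + 1)\<bar>" by (rule lip)
  also have "\<dots> \<le> W" unfolding W_def using True by (intro mult_left_mono lam) auto
  finally show ?thesis .
next
  case False
  then show ?thesis using supp lam A by (simp add: W_def)
qed

lemma wsol_bounds: "0 \<le> wsol t x" "wsol t x \<le> W"
  using nonneg[of "x - wsol t x * clamp t"] w0_le_W[of "x - wsol t x * clamp t"]
  by (simp_all add: wsol_eq)

lemma W_ge_0: "W \<ge> 0"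
  using wsol_bounds order_trans by blast

text \<open>The implicit equation bounds the difference by an eighth of itself plus the data term,
  and the eighth is absorbed. The factor 2 is a convenient bound for 8/7.\<close>

lemma wsol_lip: "\<bar>wsol t x - wsol s y\<bar> \<le> 2 * lam * (\<bar>x - y\<bar> + W * \<bar>t - s\<bar>)"
proof -
  let ?w = "wsol t x" and ?v = "wsol s y"
  have "\<bar>?w - ?v\<bar> = \<bar>w\<^sub>0 (x - ?w * clamp t) - w\<^sub>0 (y - ?v * clamp s)\<bar>"
    by (simp add: wsol_eq)
  also have "\<dots> \<le> \<bar>w\<^sub>0 (x - ?w * clamp t) - w\<^sub>0 (x - ?v * clamp t)\<bar> +
      \<bar>w\<^sub>0 (x - ?v * clamp t) - w\<^sub>0 (y - ?v * clamp s)\<bar>" by linarith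
  also have "\<dots> \<le> \<bar>?w - ?v\<bar> / 8 + lam * \<bar>(x - ?v * clamp t) - (y - ?v * clamp s)\<bar>"
    by (intro add_mono w0_shift_lip lip)
  also have "\<bar>(x - ?v * clamp t) - (y - ?v * clamp s)\<bar> \<le> \<bar>x - y\<bar> + W * \<bar>t - s\<bar>"
  proof -
    have "(x - ?v * clamp t) - (y - ?v * clamp s) = (x - y) - ?v * (clamp t - clamp s)"
      by (simp add: algebra_simps)
    moreover have "\<bar>?v * (clamp t - clamp s)\<bar> \<le> W * \<bar>t - s\<bar>"
      using wsol_bounds[of s y] clamp_lip[of t s] by (simp add: abs_mult mult_mono)
    ultimately show ?thesis by linarith
  qed
  finally have "\<bar>?w - ?v\<bar> \<le> \<bar>?w - ?v\<bar> / 8 + lam * (\<bar>x - y\<bar> + W * \<bar>t - s\<bar>)"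
    using lam by (simp add: mult_left_mono)
  moreover have "0 \<le> lam * (\<bar>x - y\<bar> + W * \<bar>t - s\<bar>)"
    using lam W_ge_0 by simp
  moreover have "a \<le> a / 8 + Q \<Longrightarrow> 0 \<le> Q \<Longrightarrow> a \<le> 2 * Q" for a Q :: real by linarith
  ultimately have "\<bar>?w - ?v\<bar> \<le> 2 * (lam * (\<bar>x - y\<bar> + W * \<bar>t - s\<bar>))" by blast
  then show ?thesis by (simp only: mult.assoc)
qed

text \<open>As a function of k, the difference \<open>w\<^sub>0 (x - k * clamp t) - k\<close> is
  strictly decreasing, by the contraction bound, and vanishes at \<open>wsol t x\<close>; its sign
  tells on which side k lies. The right-hand side depends on x - k t only, which makes the level
  sets travel rigidly.\<close>

lemma less_wsol_iff: "k < wsol t x \<longleftrightarrow> k < w\<^sub>0 (x - k * clamp t)"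
  using w0_shift_lip[of x k t "wsol t x"] wsol_eq[of x t]
  by (auto simp: abs_le_iff abs_if split: if_splits)

lemma wsol_0 [simp]: "wsol 0 x = w\<^sub>0 x"
  using T by (intro wsol_unique) simp

lemma wsol_outside: "x \<notin> {-A..A} \<Longrightarrow> wsol t x = 0"
  by (intro wsol_unique) (simp add: supp)

lemma wsol_line: "t \<in> {0..T} \<Longrightarrow> wsol t (y + w\<^sub>0 y * t) = w\<^sub>0 y"
  by (intro wsol_unique) simp

lemma continuous_wsol: "continuous_on S (\<lambda>z. wsol (fst z) (snd z))"
proof -
  define C where "C = 2 * lam * (1 + W)"
  have "C-lipschitz_on UNIV (\<lambda>z. wsol (fst z) (snd z))"
  proof (rule lipschitz_onI)
    show "0 \<le> C" using lam W_ge_0 by (simp add: C_def)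
    fix z z' :: "real \<times> real"
    have "\<bar>fst z - fst z'\<bar> \<le> dist z z'" "\<bar>snd z - snd z'\<bar> \<le> dist z z'"
      using dist_fst_le[of z z'] dist_snd_le[of z z'] by (auto simp: dist_real_def)
    then have "\<bar>snd z - snd z'\<bar> + W * \<bar>fst z - fst z'\<bar> \<le> (1 + W) * dist z z'"
      using mult_left_mono[of "\<bar>fst z - fst z'\<bar>" "dist z z'" W] W_ge_0 by (simp add: distrib_right)
    then have "2 * lam * (\<bar>snd z - snd z'\<bar> + W * \<bar>fst z - fst z'\<bar>) \<le> 2 * lam * ((1 + W) * dist z z')"
      using lam by (intro mult_left_mono) auto
    then show "dist (wsol (fst z) (snd z)) (wsol (fst z') (snd z')) \<le> C * dist z z'"
      using wsol_lip[of "fst z" "snd z" "fst z'" "snd z'"] by (simp add: dist_real_def C_def mult.assoc)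
  qed
  then show ?thesis by (rule continuous_on_subset[OF lipschitz_on_continuous_on]) simp
qed

lemma continuous_usol: "continuous_on S (\<lambda>z. usol (fst z) (snd z))"
  unfolding usol_def using continuous_wsol[of S] p wsol_bounds
  by (intro continuous_on_powr' continuous_wsol continuous_on_const) auto

lemma usol_bounds: "0 \<le> usol t x" "usol t x \<le> W powr (1 / p)"
  using wsol_bounds[of t x] p by (auto simp: usol_def intro!: powr_mono2)

lemma usol_outside: "x \<notin> {-A..A} \<Longrightarrow> usol t x = 0"
  by (simp add: usol_def wsol_outside)

lemma wsol_eq_usol: "wsol t x = usol t x powr p"
  using wsol_bounds[of t x] p by (simp add: usol_def powr_powr)

lemma less_usol_iff:
  assumes "0 \<le> k" shows "k < usol t x \<longleftrightarrow> k powr p < w\<^sub>0 (x - k powr p * clamp t)"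
proof -
  have "k < usol t x \<longleftrightarrow> k powr p < usol t x powr p"
    using assms p usol_bounds(1)[of t x] by (meson linorder_not_less powr_less_mono2 powr_mono2 order_less_le_trans zero_le_one zero_less_one)
  then show ?thesis by (simp add: less_wsol_iff wsol_eq_usol[symmetric])
qed

lemma measurable_usol [measurable]: "(\<lambda>z. usol (fst z) (snd z)) \<in> borel_measurable borel"
  by (rule borel_measurable_continuous_onI[OF continuous_usol])

lemma C_L1loc_usol: "C_L1loc T usol"
proof (rule C_L1loc_pointwise[OF measurable_usol])
  show "\<bar>usol t x\<bar> \<le> W powr (1 / p)" for t x using usol_bounds[of t x] by simp
  have "continuous_on UNIV (\<lambda>t. usol t x)" for x
    using continuous_on_compose2[OF continuous_usol[of UNIV], of UNIV "\<lambda>t. (t, x)"] by (simp add: continuous_intros)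
  then have "((\<lambda>t. usol t x) \<longlongrightarrow> usol t0 x) (at t0 within S)" for t0 x S
    by (meson continuous_on_def continuous_on_subset tendsto_within_subset subset_UNIV UNIV_I)
  then show "AE x in lborel. ((\<lambda>t. usol t x) \<longlongrightarrow> usol t0 x) (at t0 within {0..T})" for t0 by simp
qed

end

text \<open>A layer-cake formula: sgn(u - k) (q(u) - q(k)) is resolved into contributions of the
  levels r < u. The choice q(r) = r gives |u - k|, the choice q = f the entropy flux; K provides a
  range of integration that does not depend on u.\<close>

lemma LBINT_sgn_deriv:
  fixes q d :: "real \<Rightarrow> real"
  assumes "0 \<le> u" and q: "\<And>r. 0 < r \<Longrightarrow> (q has_real_derivative d r) (at r)"
    and qc: "continuous_on UNIV q" and dc: "continuous_on {0..} d" and "u \<le> K"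
  shows "(\<integral>r. indicator {0..K} r * (sgn (r - k) * indicator {..<u} r * d r) \<partial>lborel) =
    sgn (u - k) * (q u - q k) - sgn (0 - k) * (q 0 - q k)"
proof -
  \<comment> \<open>The second factor vanishes where the sign jumps, so G is continuous and the
    fundamental theorem applies with k as the only exceptional point.\<close>
  define G where "G r = sgn (r - k) * (q r - q k)" for r
  have Gc: "continuous_on {0..u} G"
  proof -
    have "isCont G r" for r
    proof (cases "r = k")
      case True
      have "((\<lambda>r. q r - q k) \<longlongrightarrow> 0) (at k)"
        using qc by (auto simp: continuous_on_eq_continuous_at isCont_def intro: LIM_zero)
      then have "(G \<longlongrightarrow> 0) (at k)"
        by (rule Lim_null_comparison[rotated, OF tendsto_rabs_zero])
          (auto simp: G_def abs_mult sgn_if intro: always_eventually)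
      then show ?thesis using True by (simp add: isCont_def G_def)
    next
      case False
      have "isCont (\<lambda>r. sgn (r - k)) r" using False by (intro isCont_sgn continuous_intros) auto
      moreover have "isCont (\<lambda>r. q r - q k) r"
        using qc by (intro continuous_intros) (auto simp: continuous_on_eq_continuous_at)
      ultimately show ?thesis unfolding G_def by (rule isCont_mult)
    qed
    then show ?thesis by (simp add: continuous_at_imp_continuous_on)
  qed
  have hk: "((\<lambda>r. sgn (r - k) * d r) has_integral G u - G 0) {0..u}"
  proof (rule fundamental_theorem_of_calculus_interior_strong[of "{k}"])
    fix r assume r: "r \<in> {0<..<u} - {k}"
    have "\<forall>\<^sub>F y in nhds r. sgn (y - k) = sgn (r - k)"
    proof (cases "r < k")
      case True
      then show ?thesis using eventually_nhds_in_open[of "{..<k}" r] by (auto elim!: eventually_mono)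
    next
      case False
      then show ?thesis using r eventually_nhds_in_open[of "{k<..}" r] by (auto elim!: eventually_mono)
    qed
    then have ev: "\<forall>\<^sub>F y in nhds r. sgn (r - k) * (q y - q k) = G y"
      by eventually_elim (simp add: G_def)
    have "(q has_real_derivative d r) (at r)" using r by (intro q) auto
    then have "((\<lambda>y. sgn (r - k) * (q y - q k)) has_real_derivative sgn (r - k) * d r) (at r)"
      by (auto intro!: derivative_eq_intros)
    then have "(G has_real_derivative sgn (r - k) * d r) (at r)"
      using DERIV_cong_ev[OF refl ev refl] by blast
    then show "(G has_vector_derivative sgn (r - k) * d r) (at r)"
      by (simp add: has_real_derivative_iff_has_vector_derivative)
  qed (use \<open>0 \<le> u\<close> Gc in auto)
  have "bounded (d ` {0..u})"
    by (intro compact_imp_bounded compact_continuous_image continuous_on_subset[OF dc]) auto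
  then obtain M where M: "\<And>r. r \<in> {0..u} \<Longrightarrow> \<bar>d r\<bar> \<le> M" unfolding bounded_real by blast
  have dm: "(\<lambda>r. indicator {0..u} r * d r) \<in> borel_measurable borel"
    using borel_measurable_continuous_on_indicator[of "{0..u}" d] continuous_on_subset[OF dc, of "{0..u}"] by simp
  have int: "set_integrable lborel {0..u} (\<lambda>r. sgn (r - k) * d r)"
    unfolding set_integrable_def
  proof (rule integrable_lborel_bounded[where A = "{0..u}" and C = "\<bar>M\<bar>"])
    have "(\<lambda>r. indicator {0..u} r *\<^sub>R (sgn (r - k) * d r)) = (\<lambda>r. sgn (r - k) * (indicator {0..u} r * d r))"
      by (auto simp: fun_eq_iff)
    also have "\<dots> \<in> borel_measurable borel" using dm by measurable
    finally show "(\<lambda>r. indicator {0..u} r *\<^sub>R (sgn (r - k) * d r)) \<in> borel_measurable borel" .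
    show "\<bar>indicator {0..u} r *\<^sub>R (sgn (r - k) * d r)\<bar> \<le> \<bar>M\<bar>" for r
      using M[of r] by (auto simp: indicator_def abs_mult sgn_if)
  qed auto
  have "(\<integral>r. indicator {0..K} r * (sgn (r - k) * indicator {..<u} r * d r) \<partial>lborel) =
      (LINT r:{0..u}|lborel. sgn (r - k) * d r)"
    unfolding set_lebesgue_integral_def
  proof (rule integral_cong_AE)
    show "(\<lambda>r. indicator {0..u} r *\<^sub>R (sgn (r - k) * d r)) \<in> borel_measurable lborel"
      using int by (auto simp: set_integrable_def)
    have "(\<lambda>r. indicator {0..K} r * (sgn (r - k) * indicator {..<u} r * d r)) =
        (\<lambda>r. sgn (r - k) * indicator {..<u} r * (indicator {0..u} r * d r))"
      using \<open>u \<le> K\<close> by (auto simp: fun_eq_iff indicator_def)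
    also have "\<dots> \<in> borel_measurable lborel" using dm by measurable
    finally show "(\<lambda>r. indicator {0..K} r * (sgn (r - k) * indicator {..<u} r * d r)) \<in> borel_measurable lborel" .
    show "AE r in lborel. indicator {0..K} r * (sgn (r - k) * indicator {..<u} r * d r) =
        indicator {0..u} r *\<^sub>R (sgn (r - k) * d r)"
      using AE_lborel_singleton[of u] by eventually_elim (use \<open>u \<le> K\<close> in \<open>auto simp: indicator_def\<close>)
  qed
  also have "\<dots> = integral {0..u} (\<lambda>r. sgn (r - k) * d r)"
    using int by (rule set_borel_integral_eq_integral)
  also have "\<dots> = G u - G 0" using hk by (rule integral_unique)
  finally show ?thesis by (simp add: G_def)
qed

section \<open>The flux and the entropies of the explicit solution\<close>

context burgers_data
begin

lemma f_deriv: "(f has_real_derivative sgn u * \<bar>u\<bar> powr p) (at u)"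
proof (cases u "0::real" rule: linorder_cases)
  case equal
  have "((\<lambda>h::real. \<bar>h\<bar> powr p / (p + 1)) \<longlongrightarrow> 0) (at 0)"
  proof -
    have "((\<lambda>h::real. \<bar>h\<bar> powr p) \<longlongrightarrow> 0) (at 0)"
      using p by (intro tendsto_eq_intros tendsto_rabs_zero tendsto_ident_at tendsto_zero_powrI[where b = p]) auto
    then show ?thesis by (rule tendsto_divide_zero)
  qed
  then have "((\<lambda>h. f h / h) \<longlongrightarrow> 0) (at 0)"
  proof (rule Lim_null_comparison[rotated])
    show "\<forall>\<^sub>F h in at 0. norm (f h / h) \<le> \<bar>h\<bar> powr p / (p + 1)"
      using p by (intro always_eventually) (auto simp: f_def powr_add abs_mult divide_simps)
  qed
  then show ?thesis using equal p by (simp add: has_field_derivative_iff f_def)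
next
  case greater
  have "((\<lambda>y. y powr (p + 1) / (p + 1)) has_real_derivative (p + 1) * u powr (p + 1 - 1) / (p + 1)) (at u)"
    using greater by (intro DERIV_cdivide has_real_derivative_powr)
  moreover have "\<forall>\<^sub>F y in nhds u. y \<in> {0<..}"
    using greater by (intro eventually_nhds_in_open) auto
  then have "\<forall>\<^sub>F y in nhds u. y powr (p + 1) / (p + 1) = f y"
    by eventually_elim (simp add: f_def)
  note DERIV_cong_ev[OF refl this refl]
  ultimately have "(f has_real_derivative (p + 1) * u powr (p + 1 - 1) / (p + 1)) (at u)"
    by (simp only:)
  then show ?thesis using greater p by simp
next
  case less
  have "((\<lambda>y. (- y) powr (p + 1) / (p + 1)) has_real_derivative ((p + 1) * (- u) powr (p + 1 - 1) * (- 1)) / (p + 1)) (at u)"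
    using less by (intro DERIV_cdivide DERIV_chain2[OF has_real_derivative_powr]) (auto intro!: derivative_eq_intros)
  moreover have "\<forall>\<^sub>F y in nhds u. y \<in> {..<0}"
    using less by (intro eventually_nhds_in_open) auto
  then have "\<forall>\<^sub>F y in nhds u. (- y) powr (p + 1) / (p + 1) = f y"
    by eventually_elim (simp add: f_def)
  note DERIV_cong_ev[OF refl this refl]
  ultimately have "(f has_real_derivative ((p + 1) * (- u) powr (p + 1 - 1) * (- 1)) / (p + 1)) (at u)"
    by (simp only:)
  then show ?thesis using less p by simp
qed

lemma deriv_f_nonneg: "0 \<le> u \<Longrightarrow> deriv f u = u powr p"
  using DERIV_imp_deriv[OF f_deriv[of u]] by (cases "u = 0") auto

lemma continuous_f: "continuous_on S f"
  by (rule continuous_on_subset[OF DERIV_continuous_on[of UNIV, OF f_deriv]]) auto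

lemma measurable_f [measurable]: "f \<in> borel_measurable borel"
  by (rule borel_measurable_continuous_onI[OF continuous_f])

lemma f_0 [simp]: "f 0 = 0" using p by (simp add: f_def)

lemma f_above_tangent:
  assumes "0 \<le> v" shows "f v + v powr p * (u - v) \<le> f u"
proof -
  have mono: "sgn x * \<bar>x\<bar> powr p \<le> sgn y * \<bar>y\<bar> powr p" if "x \<le> y" for x y :: real
  proof -
    have "0 \<le> x \<Longrightarrow> x powr p \<le> y powr p" using that p by (intro powr_mono2) auto
    moreover have "y \<le> 0 \<Longrightarrow> (- y) powr p \<le> (- x) powr p" using that p by (intro powr_mono2) auto
    moreover have "- (a powr p) \<le> b powr p" for a b :: real
      using powr_ge_zero[of a p] powr_ge_zero[of b p] by linarith
    ultimately show ?thesis
      using that by (auto simp: sgn_if abs_if)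
  qed
  have "convex_on UNIV f"
    by (rule convex_on_realI[OF _ f_deriv mono]) auto
  then have "f u - f v \<ge> (sgn v * \<bar>v\<bar> powr p) * (u - v)"
    by (rule convex_on_imp_above_tangent) (auto simp: f_deriv)
  moreover have "sgn v * \<bar>v\<bar> powr p = v powr p" using assms by (cases "v = 0") auto
  ultimately show ?thesis by simp
qed

text \<open>Entropy and flux are superpositions over the levels r in [0,K] of the indicator of r <
  \<open>usol\<close>, with weights 1 and f'(r) = r^p. Fubini moves the level integral outside, and
  each level is annihilated by \<open>integral_translated_profile\<close> with speed r^p.\<close>

lemma entropy_equality:
  assumes \<phi>: "test_function T \<phi>"
  shows "distr_div T (\<lambda>t x. \<bar>usol t x - k\<bar>) (\<lambda>t x. sgn (usol t x - k) * (f (usol t x) - f k)) \<phi> = 0"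
proof -
  define K where "K = W powr (1 / p)"
  have s: "smooth \<phi>" by (rule test_function_smooth[OF \<phi>])
  obtain B where B: "closure {z. \<phi> z \<noteq> 0} \<subseteq> {0<..<T} \<times> {-B..B}"
    using test_function_box[OF \<phi>] by metis
  let ?u = "\<lambda>z. usol (fst z) (snd z)"
  define \<psi> where "\<psi> r z = dt \<phi> z + r powr p * dx \<phi> z" for r z
  have zero: "dt \<phi> z = 0" "dx \<phi> z = 0" if "z \<notin> {0<..<T} \<times> {-B..B}" for z
  proof -
    have "z \<notin> closure {z. \<phi> z \<noteq> 0}" using that B by blast
    then show "dt \<phi> z = 0" "dx \<phi> z = 0" using frechet_derivative_zero_outside_support[of z \<phi>] by simp_all
  qed
  have bdd: "bounded ({0<..<T} \<times> {-B..B})" by (intro bounded_Times) auto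
  obtain M1 where M1: "M1 \<ge> 0" "\<And>z. \<bar>dt \<phi> z\<bar> \<le> M1"
    using continuous_zero_outside_bounded[OF continuous_dt[OF s] bdd zero(1)] by metis
  obtain M2 where M2: "M2 \<ge> 0" "\<And>z. \<bar>dx \<phi> z\<bar> \<le> M2"
    using continuous_zero_outside_bounded[OF continuous_dx[OF s] bdd zero(2)] by metis
  have [measurable]: "dt \<phi> \<in> borel_measurable borel" "dx \<phi> \<in> borel_measurable borel"
    by (intro borel_measurable_continuous_onI continuous_dt continuous_dx s)+
  define H where "H = (\<lambda>(r, z). indicator {0..K} r * (sgn (r - k) * (if r < ?u z then \<psi> r z else 0)))"
  have Hm: "H \<in> borel_measurable borel"
    unfolding H_def \<psi>_def case_prod_beta by measurable
  have H0: "H y = 0" if "y \<notin> {0..K} \<times> ({0<..<T} \<times> {-B..B})" for y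
    using that zero[of "snd y"] by (cases "fst y \<in> {0..K}") (auto simp: H_def \<psi>_def case_prod_beta mem_Times_iff)
  have Hb: "\<bar>H y\<bar> \<le> M1 + K powr p * M2" for y
  proof -
    obtain r z where y: "y = (r, z)" by (cases y)
    show ?thesis
    proof (cases "r \<in> {0..K}")
      case True
      have "\<bar>r powr p * dx \<phi> z\<bar> \<le> K powr p * M2"
        using True p M2(2)[of z] by (simp add: abs_mult mult_mono powr_mono2)
      then have "\<bar>\<psi> r z\<bar> \<le> M1 + K powr p * M2" using M1(2)[of z] by (simp add: \<psi>_def)
      moreover have "0 \<le> M1 + K powr p * M2" using M1 M2 by simp
      ultimately show ?thesis using True by (auto simp: y H_def abs_mult sgn_if)
    next
      case False
      then show ?thesis using M1 M2 by (simp add: y H_def)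
    qed
  qed
  have Hint: "integrable lborel H"
    by (rule integrable_lborel_bounded[OF Hm Hb]) (erule H0, intro bounded_Times bdd, simp)
  then have Hint': "integrable (lborel \<Otimes>\<^sub>M lborel) (case_prod (\<lambda>r z. H (r, z)))" by (simp add: lborel_prod)
  have const: "(\<integral>z. dt \<phi> z \<partial>lborel) = 0" "(\<integral>z. dx \<phi> z \<partial>lborel) = 0"
    and ic: "integrable lborel (dt \<phi>)" "integrable lborel (dx \<phi>)"
  proof -
    show "integrable lborel (dt \<phi>)" by (rule integrable_lborel_bounded[OF _ M1(2) zero(1) bdd]) auto
    moreover show "integrable lborel (dx \<phi>)" by (rule integrable_lborel_bounded[OF _ M2(2) zero(2) bdd]) auto
    ultimately have i: "integrable lborel (dt \<phi>)" "integrable lborel (dx \<phi>)" by this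
    \<comment> \<open>The constant profile 1 with the speeds 0 and 1 yields the integrals of
      \<open>dt \<phi>\<close> and of \<open>dt \<phi> + dx \<phi>\<close>.\<close>
    show 1: "(\<integral>z. dt \<phi> z \<partial>lborel) = 0"
      using integral_translated_profile[OF \<phi>, of "\<lambda>_. 1" 1 0] by simp
    have "(\<integral>z. dt \<phi> z + dx \<phi> z \<partial>lborel) = 0"
      using integral_translated_profile[OF \<phi>, of "\<lambda>_. 1" 1 1] by simp
    then show "(\<integral>z. dx \<phi> z \<partial>lborel) = 0" using 1 i by simp
  qed
  have slice: "(\<integral>z. H (r, z) \<partial>lborel) = 0" for r
  proof (cases "0 \<le> r")
    case True
    have "H (r, z) = indicator {0..K} r * sgn (r - k) *
        (indicator {y. r powr p < w\<^sub>0 y} (snd z - r powr p * fst z) * \<psi> r z)" for z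
    \<comment> \<open>\<open>less_usol_iff\<close> speaks of the clamped time, which is the true
      time inside the strip; elsewhere both sides vanish with the derivatives of
      \<open>\<phi>\<close>.\<close>
    proof (cases "fst z \<in> {0<..<T}")
      case False
      then have "z \<notin> {0<..<T} \<times> {-B..B}" by (auto simp: mem_Times_iff)
      then have "dt \<phi> z = 0" "dx \<phi> z = 0" by (rule zero)+
      then show ?thesis by (simp add: H_def \<psi>_def)
    next
      case t: True
      have "r < ?u z \<longleftrightarrow> r powr p < w\<^sub>0 (snd z - r powr p * fst z)"
        using less_usol_iff[OF True, of "fst z" "snd z"] t by simp
      then show ?thesis by (simp add: H_def indicator_def)
    qed
    then have "(\<integral>z. H (r, z) \<partial>lborel) = indicator {0..K} r * sgn (r - k) *
        (\<integral>z. indicator {y. r powr p < w\<^sub>0 y} (snd z - r powr p * fst z) * \<psi> r z \<partial>lborel)"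
      by simp
    also have "(\<integral>z. indicator {y. r powr p < w\<^sub>0 y} (snd z - r powr p * fst z) * \<psi> r z \<partial>lborel) = 0"
      unfolding \<psi>_def
    proof (rule integral_translated_profile[OF \<phi>])
      have "continuous_on UNIV w\<^sub>0"
        by (rule lipschitz_on_continuous_on[of lam]) (auto intro!: lipschitz_onI lip lam simp: dist_real_def)
      then have [measurable]: "w\<^sub>0 \<in> borel_measurable borel" by (rule borel_measurable_continuous_onI)
      show "indicator {y. r powr p < w\<^sub>0 y} \<in> borel_measurable borel" by measurable
      show "\<bar>indicator {y. r powr p < w\<^sub>0 y} y\<bar> \<le> (1::real)" for y by (simp add: indicator_def)
    qed
    finally show ?thesis by simp
  qed (simp add: H_def)
  have repr: "\<bar>?u z - k\<bar> * dt \<phi> z + sgn (?u z - k) * (f (?u z) - f k) * dx \<phi> z =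
      (\<bar>k\<bar> * dt \<phi> z + sgn (- k) * (f 0 - f k) * dx \<phi> z) + (\<integral>r. H (r, z) \<partial>lborel)" for z
  proof -
    have u: "0 \<le> ?u z" "?u z \<le> K" using usol_bounds[of "fst z" "snd z"] by (auto simp: K_def)
    have pc: "continuous_on {0..} (\<lambda>r. r powr p)"
      using p by (intro continuous_on_powr' continuous_intros) auto
    have fd: "(f has_real_derivative r powr p) (at r)" if "0 < r" for r
      using f_deriv[of r] that by simp
    note 1 = LBINT_sgn_deriv[OF u(1), of "\<lambda>r. r" "\<lambda>_. 1" K k, OF _ _ _ u(2)]
    note 2 = LBINT_sgn_deriv[OF u(1) fd continuous_f pc u(2), of k]
    let ?h1 = "\<lambda>r. indicator {0..K} r * (sgn (r - k) * indicator {..<?u z} r * 1)"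
    let ?h2 = "\<lambda>r. indicator {0..K} r * (sgn (r - k) * indicator {..<?u z} r * (r powr p))"
    have i1: "integrable lborel ?h1"
      by (rule integrable_lborel_bounded[where A = "{0..K}" and C = 1])
        (auto simp: indicator_def sgn_if)
    have i2: "integrable lborel ?h2"
      by (rule integrable_lborel_bounded[where A = "{0..K}" and C = "K powr p"])
        (use p in \<open>auto simp: indicator_def sgn_if intro!: powr_mono2\<close>)
    have "(\<integral>r. H (r, z) \<partial>lborel) = (\<integral>r. ?h1 r * dt \<phi> z + ?h2 r * dx \<phi> z \<partial>lborel)"
      by (rule Bochner_Integration.integral_cong[OF refl]) (simp add: H_def \<psi>_def algebra_simps)
    also have "\<dots> = (\<integral>r. ?h1 r \<partial>lborel) * dt \<phi> z + (\<integral>r. ?h2 r \<partial>lborel) * dx \<phi> z"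
      using i1 i2 by (subst Bochner_Integration.integral_add) (simp_all del: mult_1_right)
    also have "(\<integral>r. ?h1 r \<partial>lborel) = sgn (?u z - k) * (?u z - k) - sgn (0 - k) * (0 - k)"
      by (rule 1) (auto intro: continuous_intros)
    also have "(\<integral>r. ?h2 r \<partial>lborel) = sgn (?u z - k) * (f (?u z) - f k) - sgn (0 - k) * (f 0 - f k)"
      by (rule 2)
    finally show ?thesis
      by (simp add: algebra_simps abs_sgn)
  qed
  have "(\<integral>z. \<bar>?u z - k\<bar> * dt \<phi> z + sgn (?u z - k) * (f (?u z) - f k) * dx \<phi> z \<partial>lborel) =
      (\<integral>z. (\<bar>k\<bar> * dt \<phi> z + sgn (- k) * (f 0 - f k) * dx \<phi> z) + (\<integral>r. H (r, z) \<partial>lborel) \<partial>lborel)"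
    by (simp only: repr)
  also have "\<dots> = (\<integral>z. \<bar>k\<bar> * dt \<phi> z + sgn (- k) * (f 0 - f k) * dx \<phi> z \<partial>lborel) +
      (\<integral>z. \<integral>r. H (r, z) \<partial>lborel \<partial>lborel)"
    using lborel_pair.integrable_snd[OF Hint'] ic
    by (intro Bochner_Integration.integral_add Bochner_Integration.integrable_add integrable_mult_right) auto
  also have "(\<integral>z. \<bar>k\<bar> * dt \<phi> z + sgn (- k) * (f 0 - f k) * dx \<phi> z \<partial>lborel) = 0"
    using ic const by (subst Bochner_Integration.integral_add) auto
  also have "(\<integral>z. \<integral>r. H (r, z) \<partial>lborel \<partial>lborel) = (\<integral>r. \<integral>z. H (r, z) \<partial>lborel \<partial>lborel)"
    by (rule lborel_pair.Fubini_integral[OF Hint'])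
  also have "\<dots> = 0" by (simp add: slice)
  finally show ?thesis by (simp add: distr_div_eq[OF \<phi>])
qed

lemma in_Linf_usol: "in_Linf ({0..T} \<times> UNIV) (\<lambda>(t, x). usol t x)"
  unfolding in_Linf_def
proof
  show "set_borel_measurable lborel ({0..T} \<times> UNIV) (\<lambda>(t, x). usol t x)"
    using C_L1loc_usol by (simp add: C_L1loc_def)
  show "\<exists>C. AE z in lborel. z \<in> {0..T} \<times> UNIV \<longrightarrow> \<bar>case z of (t, x) \<Rightarrow> usol t x\<bar> \<le> C"
    using usol_bounds by (intro exI[of _ "W powr (1 / p)"] AE_I2) auto
qed

lemma kruzhkov_usol: "kruzhkov_solution T f (usol 0) usol"
  unfolding kruzhkov_solution_def using in_Linf_usol C_L1loc_usol entropy_equality by simp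

end

section \<open>Uniqueness for the scalar law\<close>

text \<open>The positive and negative parts of g are densities of finite measures that agree on all
  half-lines, hence are equal.\<close>

lemma AE_zero_of_tail_integrals:
  fixes g :: "real \<Rightarrow> real"
  assumes g: "integrable lborel g" and zero: "\<And>x. (\<integral>y. indicator {x<..} y * g y \<partial>lborel) = 0"
  shows "AE y in lborel. g y = 0"
proof -
  have [measurable]: "g \<in> borel_measurable borel" using g by (simp add: borel_measurable_integrable[of lborel, simplified])
  let ?P = "\<lambda>y. ennreal (g y)" and ?N = "\<lambda>y. ennreal (- g y)"
  have fin: "(\<integral>\<^sup>+y. ?P y \<partial>lborel) < \<infinity>" "(\<integral>\<^sup>+y. ?N y \<partial>lborel) < \<infinity>"
    using integrableD(2)[OF g] integrableD(2)[OF integrable_minus[OF g]] by (auto simp: less_top)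
  have eq: "emeasure (density lborel ?P) {x<..} = emeasure (density lborel ?N) {x<..}" for x
  proof -
    have i: "integrable lborel (\<lambda>y. indicator {x<..} y * g y)"
      using integrable_mult_indicator[of "{x<..}" lborel g] g by simp
    have fin': "(\<integral>\<^sup>+y. ennreal (indicator {x<..} y * g y) \<partial>lborel) < \<infinity>"
      "(\<integral>\<^sup>+y. ennreal (- (indicator {x<..} y * g y)) \<partial>lborel) < \<infinity>"
      using integrableD(2)[OF i] integrableD(2)[OF integrable_minus[OF i]] by (auto simp: less_top)
    have "0 = enn2real (\<integral>\<^sup>+y. ennreal (indicator {x<..} y * g y) \<partial>lborel) -
        enn2real (\<integral>\<^sup>+y. ennreal (- (indicator {x<..} y * g y)) \<partial>lborel)"
      using real_lebesgue_integral_def[OF i] zero[of x] by simp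
    then have "(\<integral>\<^sup>+y. ennreal (indicator {x<..} y * g y) \<partial>lborel) =
        (\<integral>\<^sup>+y. ennreal (- (indicator {x<..} y * g y)) \<partial>lborel)"
      using fin' by (metis ennreal_enn2real eq_iff_diff_eq_0 infinity_ennreal_def)
    moreover have "(\<integral>\<^sup>+y. ennreal (indicator {x<..} y * g y) \<partial>lborel) = (\<integral>\<^sup>+y. ?P y * indicator {x<..} y \<partial>lborel)"
      by (rule nn_integral_cong) (auto simp: indicator_def)
    moreover have "(\<integral>\<^sup>+y. ennreal (- (indicator {x<..} y * g y)) \<partial>lborel) = (\<integral>\<^sup>+y. ?N y * indicator {x<..} y \<partial>lborel)"
      by (rule nn_integral_cong) (auto simp: indicator_def)
    ultimately show ?thesis by (simp add: emeasure_density)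
  qed
  have "density lborel ?P = density lborel ?N"
  proof (rule measure_eqI_lessThan)
    fix x
    have "emeasure (density lborel ?P) {x<..} \<le> emeasure (density lborel ?P) UNIV"
      by (rule emeasure_mono) auto
    also have "\<dots> < \<infinity>" using fin by (simp add: emeasure_density)
    finally show "emeasure (density lborel ?P) {x<..} < \<infinity>" .
  qed (auto simp: eq)
  then have "AE y in lborel. ?P y = ?N y"
    by (intro sigma_finite_measure.density_unique[OF sigma_finite_lborel]) auto
  then show ?thesis
  proof eventually_elim
    case (elim y)
    then show ?case by (cases "g y \<ge> 0") (auto simp: ennreal_neg ennreal_eq_0_iff)
  qed
qed

text \<open>Uniqueness is obtained time by time, whereas the weak formulations see only classes in
  space-time. Fubini for null sets passes from one to the other, provided the predicate is jointly
  measurable.\<close>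

lemma AE_strip_of_slices:
  fixes T :: real
  assumes [measurable]: "Measurable.pred borel P"
    and "\<And>t. t \<in> {0..T} \<Longrightarrow> AE x in lborel. P (t, x)"
  shows "AE z in lborel. z \<in> {0..T} \<times> (UNIV :: real set) \<longrightarrow> P z"
proof -
  have "AE z in lborel \<Otimes>\<^sub>M lborel. z \<in> {0..T} \<times> (UNIV :: real set) \<longrightarrow> P z"
  proof (rule lborel_pair.AE_pair_measure)
    have [measurable]: "{0..T} \<times> (UNIV :: real set) \<in> sets borel" by (simp add: closed_Times borel_closed)
    have "Measurable.pred borel (\<lambda>z. z \<in> {0..T} \<times> (UNIV :: real set) \<longrightarrow> P z)" by measurable
    then show "{z \<in> space (lborel \<Otimes>\<^sub>M lborel). z \<in> {0..T} \<times> (UNIV :: real set) \<longrightarrow> P z} \<in> sets (lborel \<Otimes>\<^sub>M lborel)"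
      unfolding lborel_prod by (simp add: pred_def)
    show "AE t in lborel. AE x in lborel. (t, x) \<in> {0..T} \<times> (UNIV :: real set) \<longrightarrow> P (t, x)"
    proof (rule AE_I2)
      fix t show "AE x in lborel. (t, x) \<in> {0..T} \<times> (UNIV :: real set) \<longrightarrow> P (t, x)"
        using assms(2)[of t] by (cases "t \<in> {0..T}") auto
    qed
  qed
  then show ?thesis unfolding lborel_prod .
qed

lemma loc_integrable_compose:
  assumes a: "C_L1loc T a" and K: "AE z in lborel. z \<in> {0..T} \<times> (UNIV :: real set) \<longrightarrow> \<bar>a (fst z) (snd z)\<bar> \<le> K"
    and G[measurable]: "G \<in> borel_measurable borel" and M: "\<And>v. \<bar>v\<bar> \<le> K \<Longrightarrow> \<bar>G v\<bar> \<le> M"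
  shows "loc_integrable T (\<lambda>t x. G (a t x))"
  unfolding loc_integrable_def set_integrable_def
proof (intro allI)
  fix B :: real
  let ?A = "{0<..<T} \<times> {-B..B}"
  have A[measurable]: "?A \<in> sets borel" by (auto simp: borel_prod[symmetric])
  show "integrable lborel (\<lambda>z. indicator ?A z *\<^sub>R G (a (fst z) (snd z)))"
  proof (rule Bochner_Integration.integrable_bound)
    have "emeasure lborel ?A \<le> emeasure lborel (cbox (0, -B) (T, B))"
      by (rule emeasure_mono) (auto simp: mem_Times_iff)
    also have "\<dots> < \<infinity>" by (rule emeasure_lborel_cbox_finite)
    finally show "integrable lborel (\<lambda>z. M * indicator ?A z)"
      by (intro integrable_mult_right integrable_real_indicator) auto
    have "(\<lambda>z. indicator ?A z *\<^sub>R G (a (fst z) (snd z))) =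
        (\<lambda>z. indicator ?A z * G (indicator ({0..T} \<times> UNIV) z * a (fst z) (snd z)))"
      by (auto simp: indicator_def fun_eq_iff)
    also have "\<dots> \<in> borel_measurable borel"
      using C_L1loc_measurable[OF a] A by measurable
    finally show "(\<lambda>z. indicator ?A z *\<^sub>R G (a (fst z) (snd z))) \<in> borel_measurable lborel" by simp
    show "AE z in lborel. norm (indicator ?A z *\<^sub>R G (a (fst z) (snd z))) \<le> norm (M * indicator ?A z)"
      using K
    proof eventually_elim
      case (elim z)
      then show ?case using M[of "a (fst z) (snd z)"]
        by (cases "z \<in> ?A") (auto simp: mem_Times_iff)
    qed
  qed
qed

lemma distr_div_cong_AE:
  assumes "loc_integrable T a" "loc_integrable T b" "loc_integrable T a'" "loc_integrable T b'"
    and \<phi>: "test_function T \<phi>"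
    and "AE z in lborel. z \<in> {0..T} \<times> UNIV \<longrightarrow> a (fst z) (snd z) = a' (fst z) (snd z)"
    and "AE z in lborel. z \<in> {0..T} \<times> UNIV \<longrightarrow> b (fst z) (snd z) = b' (fst z) (snd z)"
  shows "distr_div T a b \<phi> = distr_div T a' b' \<phi>"
proof -
  note i = test_pairing_integrable[OF assms(1) \<phi>] test_pairing_integrable[OF assms(2) \<phi>]
    test_pairing_integrable[OF assms(3) \<phi>] test_pairing_integrable[OF assms(4) \<phi>]
  obtain B where B: "closure {z. \<phi> z \<noteq> 0} \<subseteq> {0<..<T} \<times> {-B..B}"
    using test_function_box[OF \<phi>] by metis
  have "(\<integral>z. a (fst z) (snd z) * dt \<phi> z + b (fst z) (snd z) * dx \<phi> z \<partial>lborel) =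
      (\<integral>z. a' (fst z) (snd z) * dt \<phi> z + b' (fst z) (snd z) * dx \<phi> z \<partial>lborel)"
  proof (rule integral_cong_AE)
    show "AE z in lborel. a (fst z) (snd z) * dt \<phi> z + b (fst z) (snd z) * dx \<phi> z =
        a' (fst z) (snd z) * dt \<phi> z + b' (fst z) (snd z) * dx \<phi> z"
      using assms(6,7)
    proof eventually_elim
      case (elim z)
      show ?case
      proof (cases "z \<in> {0..T} \<times> UNIV")
        case False
        then have "z \<notin> closure {z. \<phi> z \<noteq> 0}" using B by (auto simp: mem_Times_iff)
        then show ?thesis using frechet_derivative_zero_outside_support[of z \<phi>] by simp
      qed (use elim in simp)
    qed
  qed (intro borel_measurable_add borel_measurable_integrable i)+
  then show ?thesis by (simp add: distr_div_eq[OF \<phi>])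
qed

lemma loc_integrable_const: "loc_integrable T (\<lambda>t x. c)"
proof -
  have "C_L1loc T (\<lambda>t x. c)" by (rule C_L1loc_pointwise[of _ "\<bar>c\<bar>"]) auto
  then show ?thesis by (rule C_L1loc_loc_integrable)
qed

lemma distr_div_const:
  assumes \<phi>: "test_function T \<phi>"
  shows "distr_div T (\<lambda>t x. c) (\<lambda>t x. d) \<phi> = 0"
proof -
  have i: "integrable lborel (\<lambda>z. 1 * dt \<phi> z)" "integrable lborel (\<lambda>z. 1 * dx \<phi> z)"
    by (rule test_pairing_integrable[OF loc_integrable_const \<phi>])+
  have 1: "(\<integral>z. dt \<phi> z \<partial>lborel) = 0"
    using integral_translated_profile[OF \<phi>, of "\<lambda>_. 1" 1 0] by simp
  have "(\<integral>z. dt \<phi> z + dx \<phi> z \<partial>lborel) = 0"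
    using integral_translated_profile[OF \<phi>, of "\<lambda>_. 1" 1 1] by simp
  then have "(\<integral>z. dx \<phi> z \<partial>lborel) = 0" using 1 i by simp
  then show ?thesis using 1 i by (simp add: distr_div_eq[OF \<phi>])
qed

section \<open>Bounds and weak form of an arbitrary entropy solution\<close>

locale burgers_solution = burgers_data +
  fixes u :: "real \<Rightarrow> real \<Rightarrow> real"
  assumes kr: "kruzhkov_solution T f (usol 0) u"
begin

lemma C_L1loc_u: "C_L1loc T u"
  using kr by (simp add: kruzhkov_solution_def)

text \<open>One bound for both solutions, since \<open>W powr (1 / p)\<close> bounds
  \<open>usol\<close>; averages over k in [-K,K] then reach the values of either.\<close>

definition K :: real where
  "K = (SOME K. W powr (1 / p) \<le> K \<and> 0 < K \<and> (AE z in lborel. z \<in> {0..T} \<times> UNIV \<longrightarrow> \<bar>u (fst z) (snd z)\<bar> \<le> K))"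

lemma K: "W powr (1 / p) \<le> K" "0 < K" "AE z in lborel. z \<in> {0..T} \<times> UNIV \<longrightarrow> \<bar>u (fst z) (snd z)\<bar> \<le> K"
proof -
  obtain C where C: "AE z in lborel. z \<in> {0..T} \<times> UNIV \<longrightarrow> \<bar>u (fst z) (snd z)\<bar> \<le> C"
    using kr by (auto simp: kruzhkov_solution_def in_Linf_def case_prod_beta)
  let ?K = "max (max 1 (W powr (1 / p))) C"
  have "AE z in lborel. z \<in> {0..T} \<times> UNIV \<longrightarrow> \<bar>u (fst z) (snd z)\<bar> \<le> ?K"
    using C by eventually_elim auto
  then have "\<exists>K. W powr (1 / p) \<le> K \<and> 0 < K \<and> (AE z in lborel. z \<in> {0..T} \<times> UNIV \<longrightarrow> \<bar>u (fst z) (snd z)\<bar> \<le> K)"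
    by (intro exI[of _ ?K]) auto
  from someI_ex[OF this]
  show "W powr (1 / p) \<le> K" "0 < K" "AE z in lborel. z \<in> {0..T} \<times> UNIV \<longrightarrow> \<bar>u (fst z) (snd z)\<bar> \<le> K"
    by (auto simp: K_def[symmetric])
qed

text \<open>The constant \<open>K powr p\<close> bounds |f(v)/v|, the speed at which |v| is
  transported; it becomes the slope of the sides of the trapezium.\<close>

lemma f_bound: "\<bar>v\<bar> \<le> K \<Longrightarrow> \<bar>f v\<bar> \<le> K powr p * \<bar>v\<bar>"
proof -
  assume v: "\<bar>v\<bar> \<le> K"
  have "\<bar>f v\<bar> = \<bar>v\<bar> powr p * \<bar>v\<bar> / (p + 1)"
    using p by (cases "v = 0") (auto simp: f_def powr_add)
  also have "\<dots> \<le> \<bar>v\<bar> powr p * \<bar>v\<bar>" 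
  proof -
    have "x / (p + 1) \<le> x" if "0 \<le> x" for x using that p by (simp add: divide_le_eq mult_le_cancel_left1)
    then show ?thesis by simp
  qed
  also have "\<dots> \<le> K powr p * \<bar>v\<bar>" using v p by (intro mult_right_mono powr_mono2) auto
  finally show ?thesis .
qed

lemma loc_integrable_entropy_flux: "loc_integrable T (\<lambda>t x. sgn (u t x - k) * (f (u t x) - f k))"
proof (rule loc_integrable_compose[OF C_L1loc_u K(3), of "\<lambda>v. sgn (v - k) * (f v - f k)" "K powr p * K + \<bar>f k\<bar>"])
  fix v assume v: "\<bar>v\<bar> \<le> K"
  have "\<bar>sgn (v - k) * (f v - f k)\<bar> \<le> \<bar>f v - f k\<bar>" by (auto simp: abs_mult sgn_if)
  also have "\<dots> \<le> \<bar>f v\<bar> + \<bar>f k\<bar>" by linarith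
  also have "\<dots> \<le> K powr p * \<bar>v\<bar> + \<bar>f k\<bar>" using f_bound[OF v] by simp
  also have "\<dots> \<le> K powr p * K + \<bar>f k\<bar>" using v by (simp add: mult_left_mono)
  finally show "\<bar>sgn (v - k) * (f v - f k)\<bar> \<le> K powr p * K + \<bar>f k\<bar>" .
qed measurable

lemma loc_integrable_f: "loc_integrable T (\<lambda>t x. f (u t x))"
proof (rule loc_integrable_compose[OF C_L1loc_u K(3), of f "K powr p * K"])
  fix v assume v: "\<bar>v\<bar> \<le> K"
  show "\<bar>f v\<bar> \<le> K powr p * K"
    using f_bound[OF v] v mult_left_mono[OF v, of "K powr p"] by simp
qed measurable

lemma C_L1loc_entropy: "C_L1loc T (\<lambda>t x. \<bar>u t x - k\<bar>)"
  by (rule C_L1loc_compose[OF C_L1loc_u C_L1loc_u, of "\<lambda>x y. \<bar>x - k\<bar>" 1]) auto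

lemma entropy_ineq: "conservation_ineq T (\<lambda>t x. \<bar>u t x - k\<bar>) (\<lambda>t x. sgn (u t x - k) * (f (u t x) - f k))"
  unfolding conservation_ineq_def
  using kr C_L1loc_entropy loc_integrable_entropy_flux by (auto simp: kruzhkov_solution_def)

text \<open>For k = -K and k = K the sign of u - k is constant almost everywhere, so the entropy
  inequality becomes linear in u and f(u), once with each sign. The constants drop out.\<close>

lemma weak_equation:
  assumes \<phi>: "test_function T \<phi>" and pos: "\<And>z. 0 \<le> \<phi> z"
  shows "distr_div T u (\<lambda>t x. f (u t x)) \<phi> = 0"
proof (rule antisym)
  have lu: "loc_integrable T u" by (rule C_L1loc_loc_integrable[OF C_L1loc_u])
  have kin: "distr_div T (\<lambda>t x. \<bar>u t x - k\<bar>) (\<lambda>t x. sgn (u t x - k) * (f (u t x) - f k)) \<phi> \<le> 0" for k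
    using kr \<phi> pos by (auto simp: kruzhkov_solution_def)
  have "distr_div T (\<lambda>t x. \<bar>u t x - (-K)\<bar>) (\<lambda>t x. sgn (u t x - (-K)) * (f (u t x) - f (-K))) \<phi> =
      distr_div T (\<lambda>t x. u t x + K) (\<lambda>t x. f (u t x) + - f (-K)) \<phi>"
  proof (rule distr_div_cong_AE[OF C_L1loc_loc_integrable[OF C_L1loc_entropy] loc_integrable_entropy_flux _ _ \<phi>])
    show "AE z in lborel. z \<in> {0..T} \<times> UNIV \<longrightarrow> \<bar>u (fst z) (snd z) - (-K)\<bar> = u (fst z) (snd z) + K"
      using K(3) by eventually_elim auto
    show "AE z in lborel. z \<in> {0..T} \<times> UNIV \<longrightarrow>
        sgn (u (fst z) (snd z) - (-K)) * (f (u (fst z) (snd z)) - f (-K)) = f (u (fst z) (snd z)) + - f (-K)"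
      using K(3) by eventually_elim (auto simp: sgn_if add_eq_0_iff2)
  qed (intro loc_integrable_add lu loc_integrable_f loc_integrable_const)+
  also have "\<dots> = distr_div T u (\<lambda>t x. f (u t x)) \<phi>"
    by (simp only: distr_div_add[OF lu loc_integrable_f loc_integrable_const loc_integrable_const \<phi>]
        distr_div_const[OF \<phi>] add_0_right)
  finally show "distr_div T u (\<lambda>t x. f (u t x)) \<phi> \<le> 0" using kin[of "-K"] by simp
  have "distr_div T (\<lambda>t x. \<bar>u t x - K\<bar>) (\<lambda>t x. sgn (u t x - K) * (f (u t x) - f K)) \<phi> =
      distr_div T (\<lambda>t x. - u t x + K) (\<lambda>t x. - f (u t x) + f K) \<phi>"
  proof (rule distr_div_cong_AE[OF C_L1loc_loc_integrable[OF C_L1loc_entropy] loc_integrable_entropy_flux _ _ \<phi>])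
    show "AE z in lborel. z \<in> {0..T} \<times> UNIV \<longrightarrow> \<bar>u (fst z) (snd z) - K\<bar> = - u (fst z) (snd z) + K"
      using K(3) by eventually_elim auto
    show "AE z in lborel. z \<in> {0..T} \<times> UNIV \<longrightarrow>
        sgn (u (fst z) (snd z) - K) * (f (u (fst z) (snd z)) - f K) = - f (u (fst z) (snd z)) + f K"
      using K(3) by eventually_elim (auto simp: sgn_if)
  qed (intro loc_integrable_add loc_integrable_minus lu loc_integrable_f loc_integrable_const)+
  also have "\<dots> = distr_div T (\<lambda>t x. - u t x) (\<lambda>t x. - f (u t x)) \<phi>"
    by (simp only: distr_div_add[OF loc_integrable_minus[OF lu] loc_integrable_minus[OF loc_integrable_f] loc_integrable_const loc_integrable_const \<phi>]
        distr_div_const[OF \<phi>] add_0_right)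
  also have "\<dots> = - distr_div T u (\<lambda>t x. f (u t x)) \<phi>" by (rule distr_div_minus[OF \<phi>])
  finally show "0 \<le> distr_div T u (\<lambda>t x. f (u t x)) \<phi>" using kin[of K] by simp
qed

lemma weak_ineq: "conservation_ineq T u (\<lambda>t x. f (u t x))"
  unfolding conservation_ineq_def
  using C_L1loc_u loc_integrable_f weak_equation by (auto intro: order.eq_iff[THEN iffD1, THEN conjunct1])

lemma weak_ineq_minus: "conservation_ineq T (\<lambda>t x. - u t x) (\<lambda>t x. - f (u t x))"
  unfolding conservation_ineq_def
  using C_L1loc_minus[OF C_L1loc_u] loc_integrable_minus[OF loc_integrable_f] weak_equation
  by (auto simp: distr_div_minus)

end

text \<open>A non-integrable F has integral 0 by convention, and nonnegativity of G covers this
  case. Flux terms can thus be estimated without first proving them integrable.\<close>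

lemma integral_le_of_AE_le:
  fixes F G :: "'a \<Rightarrow> real"
  assumes "integrable M G" "AE z in M. F z \<le> G z" "AE z in M. 0 \<le> G z"
  shows "integral\<^sup>L M F \<le> integral\<^sup>L M G"
proof (cases "integrable M F")
  case True
  then show ?thesis using assms by (intro integral_mono_AE) auto
next
  case False
  then show ?thesis using integral_nonneg_AE[OF assms(3)] by (simp add: not_integrable_integral_eq)
qed

lemma C_L1loc_slice_pairing:
  assumes a: "C_L1loc T a" "t \<in> {0..T}" and g: "continuous_on UNIV g" "\<And>x. x \<notin> {-B..B} \<Longrightarrow> g x = 0"
  shows "integrable lborel (\<lambda>x. a t x * g x)"
proof -
  have "set_integrable lborel {-B..B} (\<lambda>x. a t x * g x)"
    by (rule set_integrable_times_continuous[OF C_L1loc_integrable[OF a] _ g(1)]) simp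
  moreover have "indicator {-B..B} x *\<^sub>R (a t x * g x) = a t x * g x" for x
    using g(2)[of x] by (cases "x \<in> {-B..B}") auto
  ultimately show ?thesis by (simp only: set_integrable_def)
qed

lemma dt_eqI: "smooth \<Phi> \<Longrightarrow> ((\<lambda>\<tau>. \<Phi> (\<tau>, x)) has_real_derivative D) (at t) \<Longrightarrow> dt \<Phi> (t, x) = D"
  using DERIV_unique[OF smooth_deriv_dt] by blast

lemma dx_eqI: "smooth \<Phi> \<Longrightarrow> ((\<lambda>y. \<Phi> (t, y)) has_real_derivative D) (at x) \<Longrightarrow> dx \<Phi> (t, x) = D"
  using DERIV_unique[OF smooth_deriv_dx] by blast

lemma step_affine_deriv: "((\<lambda>x. step (a + b * x)) has_real_derivative step' (a + b * x) * b) (at x)"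
  by (rule DERIV_chain2[OF step_deriv]) (auto intro!: derivative_eq_intros)

section \<open>Finite speed of propagation\<close>

context burgers_solution
begin

definition M :: real where "M = K powr p"

text \<open>A radius beyond which u vanishes up to time T: the radius A of the data, one unit for
  the transition layer of \<open>step\<close>, and the distance M T travelled at maximal
  speed.\<close>

definition R :: real where "R = A + 1 + M * T"

lemma M_ge_0: "0 \<le> M" by (simp add: M_def)

lemma R_bounds: "A + 1 \<le> R" "0 \<le> R" using M_ge_0 T A by (auto simp: R_def)

lemma u_initial: "AE x in lborel. u 0 x = usol 0 x"
  using kr by (simp add: kruzhkov_solution_def)

text \<open>The test function is supported in a trapezium whose sides move inwards with the maximal
  speed \<open>M\<close>, so that no mass of \<open>\<bar>u\<bar>\<close> can enter.\<close>

lemma u_zero_in_trapezium: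
  assumes t: "t \<in> {0..T}" and \<sigma>: "\<bar>\<sigma>\<bar> = 1"
  shows "AE x in lborel. A + 1 + M * t \<le> \<sigma> * x \<and> \<sigma> * x \<le> N - 1 - M * t \<longrightarrow> u t x = 0"
proof -
  \<comment> \<open>The sign \<open>\<sigma>\<close> selects the right or the left half-line; N
    bounds the region on the far side and is sent to infinity in \<open>u_outside\<close>.\<close>
  define \<Phi> where "\<Phi> z = step (\<sigma> * snd z - A - M * fst z) * step (N - M * fst z - \<sigma> * snd z)" for z :: "real \<times> real"
  have s: "smooth \<Phi>" unfolding \<Phi>_def by (intro smooth_intros)
  let ?S1 = "\<lambda>t x. step (\<sigma> * x - A - M * t)" and ?S1' = "\<lambda>t x. step' (\<sigma> * x - A - M * t)"
  let ?S2 = "\<lambda>t x. step (N - M * t - \<sigma> * x)" and ?S2' = "\<lambda>t x. step' (N - M * t - \<sigma> * x)"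
  have dt: "dt \<Phi> (t, x) = - M * (?S1' t x * ?S2 t x + ?S1 t x * ?S2' t x)" for t x
  proof (rule dt_eqI[OF s])
    have "((\<lambda>t. ?S1 t x) has_real_derivative ?S1' t x * (- M)) (at t)"
      using step_affine_deriv[of "\<sigma> * x - A" "- M" t] by (simp add: algebra_simps)
    moreover have "((\<lambda>t. ?S2 t x) has_real_derivative ?S2' t x * (- M)) (at t)"
      using step_affine_deriv[of "N - \<sigma> * x" "- M" t] by (simp add: algebra_simps)
    ultimately show "((\<lambda>t. \<Phi> (t, x)) has_real_derivative - M * (?S1' t x * ?S2 t x + ?S1 t x * ?S2' t x)) (at t)"
      unfolding \<Phi>_def fst_conv snd_conv by (rule DERIV_cong[OF DERIV_mult]) (simp add: algebra_simps)
  qed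
  have dx: "dx \<Phi> (t, x) = \<sigma> * (?S1' t x * ?S2 t x - ?S1 t x * ?S2' t x)" for t x
  proof (rule dx_eqI[OF s])
    have "((\<lambda>x. ?S1 t x) has_real_derivative ?S1' t x * \<sigma>) (at x)"
      using step_affine_deriv[of "- A - M * t" \<sigma> x] by (simp add: algebra_simps)
    moreover have "((\<lambda>x. ?S2 t x) has_real_derivative ?S2' t x * (- \<sigma>)) (at x)"
      using step_affine_deriv[of "N - M * t" "- \<sigma>" x] by (simp add: algebra_simps)
    ultimately show "((\<lambda>x. \<Phi> (t, x)) has_real_derivative \<sigma> * (?S1' t x * ?S2 t x - ?S1 t x * ?S2' t x)) (at x)"
      unfolding \<Phi>_def fst_conv snd_conv by (rule DERIV_cong[OF DERIV_mult]) (simp add: algebra_simps)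
  qed
  have \<sigma>x: "\<bar>\<sigma> * x\<bar> = \<bar>x\<bar>" for x using \<sigma> by (simp add: abs_mult)
  have zero: "\<Phi> (t, x) = 0" if "t \<in> {0..T}" "x \<notin> {-\<bar>N\<bar>..\<bar>N\<bar>}" for t x
  proof -
    have "M * t \<ge> 0" using that M_ge_0 by simp
    moreover have "\<bar>N\<bar> < \<bar>\<sigma> * x\<bar>" 
      using that(2) unfolding atLeastAtMost_iff \<sigma>x by linarith
    ultimately have "\<sigma> * x - A - M * t \<le> 0 \<or> N - M * t - \<sigma> * x \<le> 0"
      using A by linarith
    then show ?thesis by (auto simp: \<Phi>_def)
  qed
  have m: "(\<integral>x. \<bar>u t x - 0\<bar> * \<Phi> (t, x) \<partial>lborel) \<le> (\<integral>x. \<bar>u 0 x - 0\<bar> * \<Phi> (0, x) \<partial>lborel) + 0"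
  proof (rule weighted_mass_le[OF entropy_ineq s])
    show "0 \<le> \<Phi> z" for z by (simp add: \<Phi>_def)
    show "\<Phi> (t, x) = 0" if "t \<in> {0..T}" "x \<notin> {-\<bar>N\<bar>..\<bar>N\<bar>}" for t x using that by (rule zero)
    fix \<theta> :: "real \<Rightarrow> real" assume \<theta>: "\<And>t. 0 \<le> \<theta> t \<and> \<theta> t \<le> 1"
    let ?F = "\<lambda>z. indicator ({0<..<T} \<times> {-\<bar>N\<bar>..\<bar>N\<bar>}) z * (\<theta> (fst z) * (\<bar>u (fst z) (snd z) - 0\<bar> * dt \<Phi> z +
        sgn (u (fst z) (snd z) - 0) * (f (u (fst z) (snd z)) - f 0) * dx \<Phi> z))"
    have "AE z in lborel. ?F z \<le> 0"
      using K(3)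
    proof eventually_elim
      case (elim z)
      show ?case
      proof (cases "z \<in> {0<..<T} \<times> {-\<bar>N\<bar>..\<bar>N\<bar>}")
        case True
        obtain t x where z: "z = (t, x)" by (cases z)
        have v: "\<bar>u t x\<bar> \<le> K" using elim True by (auto simp: z)
        define P Q where "P = ?S1' t x * ?S2 t x" and "Q = ?S1 t x * ?S2' t x"
        have PQ: "P \<ge> 0" "Q \<ge> 0" by (simp_all add: P_def Q_def)
        define b where "b = sgn (u t x) * f (u t x)"
        have "\<bar>b\<bar> \<le> M * \<bar>u t x\<bar>"
          using f_bound[OF v] by (auto simp: b_def M_def abs_mult sgn_if)
        \<comment> \<open>P and Q come from the two sides. Both carry the factor - M in the time
          derivative but opposite signs in the space derivative, so the flux is at most M |u| (P +
          Q), which the time term compensates.\<close>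
        have "b * (\<sigma> * (P - Q)) \<le> \<bar>b\<bar> * \<bar>P - Q\<bar>"
          using abs_ge_self[of "b * (\<sigma> * (P - Q))"] \<sigma> by (simp add: abs_mult)
        also have "\<dots> \<le> (M * \<bar>u t x\<bar>) * (P + Q)"
          using \<open>\<bar>b\<bar> \<le> M * \<bar>u t x\<bar>\<close> PQ by (intro mult_mono) auto
        finally have "\<bar>u t x\<bar> * (- M * (P + Q)) + b * (\<sigma> * (P - Q)) \<le> 0"
          by (simp add: algebra_simps)
        then have "\<theta> t * (\<bar>u t x\<bar> * (- M * (P + Q)) + b * (\<sigma> * (P - Q))) \<le> 0"
          using \<theta>[of t] by (simp add: mult_nonneg_nonpos)
        then show ?thesis
          using True by (simp add: z dt dx P_def Q_def b_def)
      qed simp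
    qed
    then show "(\<integral>z. ?F z \<partial>lborel) \<le> 0"
      using integral_le_of_AE_le[of lborel "\<lambda>_. 0" ?F] by simp
  qed (use t in auto)
  have "(\<integral>x. \<bar>u 0 x - 0\<bar> * \<Phi> (0, x) \<partial>lborel) = 0"
  proof (rule integral_eq_zero_AE)
    show "AE x in lborel. \<bar>u 0 x - 0\<bar> * \<Phi> (0, x) = 0"
      using u_initial
    proof eventually_elim
      case (elim x)
      show ?case
      proof (cases "\<sigma> * x \<le> A")
        case False
        then have "x \<notin> {-A..A}" using \<sigma>x[of x] unfolding atLeastAtMost_iff by linarith
        then show ?thesis using elim usol_outside[of x 0] by simp
      qed (simp add: \<Phi>_def)
    qed
  qed
  with m have le: "(\<integral>x. \<bar>u t x - 0\<bar> * \<Phi> (t, x) \<partial>lborel) \<le> 0" by simp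
  have "continuous_on UNIV (\<lambda>x. \<Phi> (t, x))"
    by (intro continuous_on_compose2[OF smooth_imp_continuous_on[OF s]] continuous_intros) auto
  then have int: "integrable lborel (\<lambda>x. \<bar>u t x - 0\<bar> * \<Phi> (t, x))"
    by (intro C_L1loc_slice_pairing[OF C_L1loc_entropy t, where g = "\<lambda>x. \<Phi> (t, x)" and B = "\<bar>N\<bar>"] zero[OF t])
  have pos: "AE x in lborel. 0 \<le> \<bar>u t x - 0\<bar> * \<Phi> (t, x)" by (simp add: \<Phi>_def)
  have "(\<integral>x. \<bar>u t x - 0\<bar> * \<Phi> (t, x) \<partial>lborel) = 0"
    using le integral_nonneg_AE[OF pos] by simp
  then have "AE x in lborel. \<bar>u t x - 0\<bar> * \<Phi> (t, x) = 0"
    using integral_nonneg_eq_0_iff_AE[OF int pos] by blast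
  then show ?thesis
    by eventually_elim (auto simp: \<Phi>_def)
qed

lemma u_outside:
  assumes t: "t \<in> {0..T}" shows "AE x in lborel. R \<le> \<bar>x\<bar> \<longrightarrow> u t x = 0"
proof -
  have "AE x in lborel. \<forall>n::nat. A + 1 + M * t \<le> 1 * x \<and> 1 * x \<le> n - 1 - M * t \<longrightarrow> u t x = 0"
    unfolding AE_all_countable by (intro allI u_zero_in_trapezium[OF t]) simp
  moreover have "AE x in lborel. \<forall>n::nat. A + 1 + M * t \<le> (- 1) * x \<and> (- 1) * x \<le> n - 1 - M * t \<longrightarrow> u t x = 0"
    unfolding AE_all_countable by (intro allI u_zero_in_trapezium[OF t]) simp
  ultimately show ?thesis
  proof eventually_elim
    case (elim x)
    show ?case
    proof
      assume x: "R \<le> \<bar>x\<bar>"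
      have Mt: "M * t \<le> M * T" using t M_ge_0 by (intro mult_left_mono) auto
      obtain n :: nat where "\<bar>x\<bar> + 1 + M * t \<le> n" using real_arch_simple by blast
      then show "u t x = 0"
        using elim(1)[rule_format, of n] elim(2)[rule_format, of n] x Mt by (cases "x \<ge> 0") (auto simp: R_def)
    qed
  qed
qed

lemma u_outside_strip:
  "AE z in lborel. z \<in> {0..T} \<times> UNIV \<longrightarrow> R \<le> \<bar>snd z\<bar> \<longrightarrow> u (fst z) (snd z) = 0 \<and> usol (fst z) (snd z) = 0"
proof -
  note [measurable] = C_L1loc_measurable[OF C_L1loc_u]
  \<comment> \<open>Measurability of u is known only on the strip, so its indicator is inserted to
    obtain a Borel predicate on the plane.\<close>
  have "AE z in lborel. z \<in> {0..T} \<times> (UNIV :: real set) \<longrightarrow>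
      (R \<le> \<bar>snd z\<bar> \<longrightarrow> indicator ({0..T} \<times> UNIV) z * u (fst z) (snd z) = 0)"
  proof (rule AE_strip_of_slices)
    show "Measurable.pred borel (\<lambda>z. R \<le> \<bar>snd z\<bar> \<longrightarrow> indicator ({0..T} \<times> UNIV) z * u (fst z) (snd z) = 0)"
      by measurable
    show "AE x in lborel. R \<le> \<bar>snd (t, x)\<bar> \<longrightarrow> indicator ({0..T} \<times> UNIV) (t, x) * u (fst (t, x)) (snd (t, x)) = 0"
      if "t \<in> {0..T}" for t
      using u_outside[OF that] by eventually_elim auto
  qed
  then show ?thesis
  proof eventually_elim
    case (elim z)
    have "usol (fst z) (snd z) = 0" if "R \<le> \<bar>snd z\<bar>"
      using that R_bounds by (intro usol_outside) auto
    then show ?case using elim by auto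
  qed
qed

text \<open>Makes weights compactly supported in space. Its slope lives on R <= |x| <= R + 1, where
  u and \<open>usol\<close> vanish almost everywhere, so it contributes no flux.\<close>

definition cut :: "real \<Rightarrow> real" where "cut x = step (x + R + 1) * step (R + 1 - x)"

definition cut' :: "real \<Rightarrow> real" where
  "cut' x = step' (x + R + 1) * step (R + 1 - x) - step (x + R + 1) * step' (R + 1 - x)"

lemma cut_deriv: "(cut has_real_derivative cut' x) (at x)"
proof -
  have "((\<lambda>x. step (x + R + 1)) has_real_derivative step' (x + R + 1) * 1) (at x)"
    using step_affine_deriv[of "R + 1" 1 x] by (simp add: algebra_simps)
  moreover have "((\<lambda>x. step (R + 1 - x)) has_real_derivative step' (R + 1 - x) * (- 1)) (at x)"
    using step_affine_deriv[of "R + 1" "- 1" x] by simp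
  ultimately show ?thesis
    unfolding cut_def[abs_def] cut'_def by (rule DERIV_cong[OF DERIV_mult]) (simp add: algebra_simps)
qed

lemma cut_bounds [simp]: "0 \<le> cut x" "cut x \<le> 1"
  by (simp_all add: cut_def mult_le_one)

lemma cut_1: "\<bar>x\<bar> \<le> R \<Longrightarrow> cut x = 1" and cut_0: "x \<notin> {-(R+1)..R+1} \<Longrightarrow> cut x = 0"
  and cut'_0: "\<bar>x\<bar> < R \<Longrightarrow> cut' x = 0"
  by (auto simp: cut_def cut'_def abs_if split: if_splits)

lemma smooth_cut: "smooth (\<lambda>z. cut (snd z))"
  unfolding cut_def by (intro smooth_intros)

lemma continuous_cut: "continuous_on S cut"
  unfolding cut_def by (intro continuous_intros continuous_on_compose2[OF continuous_step[of UNIV]]) auto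

lemma measurable_cut [measurable]: "cut \<in> borel_measurable borel"
  by (rule borel_measurable_continuous_onI[OF continuous_cut])

end

text \<open>Fubini identifies the first moment with the integral over [-c,c] of the primitive D,
  since the x in (y,c] form an interval of length c - y. A continuous nonpositive D with nonnegative
  integral vanishes on [-c,c], and then everywhere.\<close>

lemma AE_zero_of_primitive:
  fixes g :: "real \<Rightarrow> real"
  assumes int: "integrable lborel g" and supp: "\<And>y. y \<notin> {-c..c} \<Longrightarrow> g y = 0" and "0 < c"
    and neg: "\<And>x. (\<integral>y. indicator {..<x} y * g y \<partial>lborel) \<le> 0"
    and mom: "0 \<le> (\<integral>y. (c - y) * g y \<partial>lborel)"
  shows "AE y in lborel. g y = 0"
proof -
  have [measurable]: "g \<in> borel_measurable borel" using int by (simp add: borel_measurable_integrable[of lborel, simplified])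
  define D where "D x = (\<integral>y. indicator {..<x} y * g y \<partial>lborel)" for x
  have ig: "integrable lborel (\<lambda>y. indicator {..<x} y * g y)" for x
    using integrable_mult_indicator[of "{..<x}" lborel g] int by simp
  have cont: "continuous_on UNIV D"
    unfolding continuous_on_sequentially
  proof (intro allI ballI impI)
    fix s :: "nat \<Rightarrow> real" and a assume s: "(\<forall>n. s n \<in> UNIV) \<and> s \<longlonglongrightarrow> a"
    have "(\<lambda>n. \<integral>y. indicator {..<s n} y * g y \<partial>lborel) \<longlonglongrightarrow> (\<integral>y. indicator {..<a} y * g y \<partial>lborel)"
    proof (rule integral_dominated_convergence[where w = "\<lambda>y. \<bar>g y\<bar>"])
      show "AE y in lborel. (\<lambda>n. indicator {..<s n} y * g y) \<longlonglongrightarrow> indicator {..<a} y * g y"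
        using AE_lborel_singleton[of a]
      proof eventually_elim
        case (elim y)
        have "\<forall>\<^sub>F n in sequentially. indicator {..<s n} y * g y = indicator {..<a} y * g y"
        proof (cases "y < a")
          case True
          then have "\<forall>\<^sub>F n in sequentially. y < s n" using s order_tendstoD(1) by blast
          then show ?thesis by eventually_elim (use True in simp)
        next
          case False
          then have "\<forall>\<^sub>F n in sequentially. s n < y" using s elim order_tendstoD(2)[of s a sequentially y] by auto
          then show ?thesis by eventually_elim (use False in simp)
        qed
        then show ?case by (rule tendsto_eventually)
      qed
      show "integrable lborel (\<lambda>y. \<bar>g y\<bar>)" using int by simp
    qed (auto simp: indicator_def)
    then show "(D \<circ> s) \<longlonglongrightarrow> D a" by (simp add: D_def o_def)
  qed
  define H where "H = (\<lambda>(x, y). indicator {-c..c} x * (indicator {..<x} y * g y))"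
  have "Measurable.pred borel (\<lambda>z::real \<times> real. snd z < fst z)" by measurable
  have Hm: "H \<in> borel_measurable borel"
  proof -
    have "H = (\<lambda>z. indicator {-c..c} (fst z) * ((if snd z < fst z then 1 else 0) * g (snd z)))"
      by (auto simp: H_def indicator_def fun_eq_iff)
    also have "\<dots> \<in> borel_measurable borel" by measurable
    finally show ?thesis .
  qed
  have norm: "(\<integral>y. norm (H (x, y)) \<partial>lborel) = indicator {-c..c} x * (\<integral>y. indicator {..<x} y * \<bar>g y\<bar> \<partial>lborel)" for x
    by (cases "x \<in> {-c..c}") (simp_all add: H_def abs_mult)
  have ia: "integrable lborel (\<lambda>y. indicator {..<x} y * \<bar>g y\<bar>)" for x
    using integrable_mult_indicator[of "{..<x}" lborel "\<lambda>y. \<bar>g y\<bar>"] int by simp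
  have "integrable (lborel \<Otimes>\<^sub>M lborel) H"
  proof (rule lborel_pair.Fubini_integrable)
    show m: "H \<in> borel_measurable (lborel \<Otimes>\<^sub>M lborel)" using Hm by (simp add: lborel_prod)
    show "integrable lborel (\<lambda>x. \<integral>y. norm (H (x, y)) \<partial>lborel)"
    proof (rule integrable_lborel_bounded[where A = "{-c..c}" and C = "\<integral>y. \<bar>g y\<bar> \<partial>lborel"])
      show "(\<lambda>x. \<integral>y. norm (H (x, y)) \<partial>lborel) \<in> borel_measurable borel"
        using m by measurable
      show "\<bar>\<integral>y. norm (H (x, y)) \<partial>lborel\<bar> \<le> (\<integral>y. \<bar>g y\<bar> \<partial>lborel)" for x
      proof -
        have "(\<integral>y. indicator {..<x} y * \<bar>g y\<bar> \<partial>lborel) \<le> (\<integral>y. \<bar>g y\<bar> \<partial>lborel)"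
          by (rule integral_mono[OF ia]) (use int in \<open>auto simp: indicator_def\<close>)
        moreover have "0 \<le> (\<integral>y. indicator {..<x} y * \<bar>g y\<bar> \<partial>lborel)" by simp
        ultimately show ?thesis unfolding norm by (auto simp: indicator_def)
      qed
      show "(\<integral>y. norm (H (x, y)) \<partial>lborel) = 0" if "x \<notin> {-c..c}" for x unfolding norm using that by simp
    qed simp
    show "AE x in lborel. integrable lborel (\<lambda>y. H (x, y))" using ig by (simp add: H_def)
  qed
  then have HI: "integrable (lborel \<Otimes>\<^sub>M lborel) (case_prod (\<lambda>x y. H (x, y)))" by simp
  have 1: "(\<integral>y. H (x, y) \<partial>lborel) = indicator {-c..c} x * D x" for x by (simp add: H_def D_def)
  have 2: "(\<integral>x. H (x, y) \<partial>lborel) = (c - y) * g y" for y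
  proof (cases "y \<in> {-c..c}")
    case True
    have "(\<integral>x. H (x, y) \<partial>lborel) = (\<integral>x. indicator {y<..c} x * g y \<partial>lborel)"
      using True by (intro Bochner_Integration.integral_cong) (auto simp: H_def indicator_def)
    also have "\<dots> = (c - y) * g y" using True by simp
    finally show ?thesis .
  qed (use supp in \<open>simp add: H_def\<close>)
  have "0 \<le> (\<integral>x. indicator {-c..c} x * D x \<partial>lborel)"
    using mom lborel_pair.Fubini_integral[OF HI] by (simp only: 1 2)
  also have "\<dots> = (LINT x:{-c..c}|lborel. D x)" by (simp add: set_lebesgue_integral_def)
  also have "\<dots> = integral {-c..c} D"
    by (intro set_borel_integral_eq_integral borel_integrable_atLeastAtMost' continuous_on_subset[OF cont]) auto
  finally have "integral {-c..c} (\<lambda>x. - D x) \<le> 0" by simp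
  moreover have Dn: "- D x \<ge> 0" for x using neg by (simp add: D_def)
  moreover have "integral {-c..c} (\<lambda>x. - D x) \<ge> 0" using Dn by (intro integral_nonneg integrable_continuous_real
      continuous_on_minus continuous_on_subset[OF cont]) auto
  ultimately have "integral {-c..c} (\<lambda>x. - D x) = 0" by simp
  then have D0: "D x = 0" if "x \<in> {-c..c}" for x
    using integral_eq_0_iff[of "-c" c "\<lambda>x. - D x"] \<open>0 < c\<close> Dn that
      continuous_on_minus[OF continuous_on_subset[OF cont, of "{-c..c}"]] by auto
  have Dc: "D x = D c" if "x > c" for x
    unfolding D_def
  proof (rule integral_cong_AE)
    show "AE y in lborel. indicator {..<x} y * g y = indicator {..<c} y * g y"
      using AE_lborel_singleton[of c] by eventually_elim (use that supp in \<open>auto simp: indicator_def\<close>)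
  qed (use that in measurable)
  have D_all: "D x = 0" for x
  proof (cases "x \<in> {-c..c}")
    case False
    then consider "x < -c" | "x > c" by fastforce
    then show ?thesis
    proof cases
      case 1
      then have "(\<lambda>y. indicator {..<x} y * g y) = (\<lambda>_. 0)" using supp by (auto simp: indicator_def fun_eq_iff)
      then show ?thesis unfolding D_def by (simp only:) simp
    next
      case 2
      then show ?thesis using Dc D0[of c] \<open>0 < c\<close> by simp
    qed
  qed (use D0 in auto)
  have total: "(\<integral>y. g y \<partial>lborel) = D (c + 1)"
    unfolding D_def using supp by (intro Bochner_Integration.integral_cong) (auto simp: indicator_def)
  show ?thesis
  proof (rule AE_zero_of_tail_integrals[OF int])
    fix x
    have "(\<integral>y. indicator {x<..} y * g y \<partial>lborel) = (\<integral>y. g y - indicator {..<x} y * g y \<partial>lborel)"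
    proof (rule integral_cong_AE)
      show "AE y in lborel. indicator {x<..} y * g y = g y - indicator {..<x} y * g y"
        using AE_lborel_singleton[of x] by eventually_elim (auto simp: indicator_def)
    qed measurable
    also have "\<dots> = (\<integral>y. g y \<partial>lborel) - D x"
      unfolding D_def by (rule Bochner_Integration.integral_diff[OF int ig])
    finally show "(\<integral>y. indicator {x<..} y * g y \<partial>lborel) = 0" by (simp add: total D_all)
  qed
qed

section \<open>The flux as an average of entropies\<close>

context burgers_data
begin

text \<open>An average of Kruzhkov entropies with weight \<open>f''\<close> is \<open>f\<close> itself, up to a constant.\<close>

lemma f_as_entropy_average:
  assumes "0 < K"
  obtains c where "\<And>v. \<bar>v\<bar> \<le> K \<Longrightarrow>
    (\<integral>k. indicator {-K..K} k * (p * \<bar>k\<bar> powr (p - 1) * \<bar>v - k\<bar>) \<partial>lborel) = 2 * f v + c"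
proof -
  \<comment> \<open>\<open>a\<close> is f', and p |k|^(p-1) is its derivative away from 0.\<close>
  define a where "a k = sgn k * \<bar>k\<bar> powr p" for k :: real
  have a_cont: "isCont a k" for k
  proof (cases "k = 0")
    case True
    have "((\<lambda>h::real. \<bar>h\<bar> powr p) \<longlongrightarrow> 0) (at 0)"
      using p by (intro tendsto_eq_intros tendsto_rabs_zero tendsto_ident_at tendsto_zero_powrI[where b = p]) auto
    then have "(a \<longlongrightarrow> 0) (at 0)"
      by (rule Lim_null_comparison[rotated]) (auto simp: a_def abs_mult sgn_if intro: always_eventually)
    then show ?thesis using True by (simp add: isCont_def a_def)
  next
    case False
    then show ?thesis unfolding a_def by (intro continuous_intros isCont_sgn) auto
  qed
  have a_deriv: "(a has_real_derivative p * \<bar>k\<bar> powr (p - 1)) (at k)" if "k \<noteq> 0" for k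
  proof (cases "k > 0")
    case True
    have "((\<lambda>k. k powr p) has_real_derivative p * k powr (p - 1)) (at k)"
      using True by (rule has_real_derivative_powr)
    moreover have "\<forall>\<^sub>F y in nhds k. y \<in> {0<..}" using True by (intro eventually_nhds_in_open) auto
    then have "\<forall>\<^sub>F y in nhds k. y powr p = a y" by eventually_elim (simp add: a_def)
    note DERIV_cong_ev[OF refl this refl]
    ultimately show ?thesis using True by simp
  next
    case False
    then have k: "k < 0" using that by simp
    have "((\<lambda>k. - ((- k) powr p)) has_real_derivative - (p * (- k) powr (p - 1) * (- 1))) (at k)"
      using k by (intro DERIV_minus DERIV_chain2[OF has_real_derivative_powr]) (auto intro!: derivative_eq_intros)
    moreover have "\<forall>\<^sub>F y in nhds k. y \<in> {..<0}" using k by (intro eventually_nhds_in_open) auto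
    then have "\<forall>\<^sub>F y in nhds k. - ((- y) powr p) = a y" by eventually_elim (simp add: a_def)
    note DERIV_cong_ev[OF refl this refl]
    ultimately show ?thesis using k by simp
  qed
  have main: "(\<integral>k. indicator {-K..K} k * (p * \<bar>k\<bar> powr (p - 1) * \<bar>v - k\<bar>) \<partial>lborel) =
      2 * f v + (2 * K * a K - f K - f (-K))" if v: "\<bar>v\<bar> \<le> K" for v
  proof -
    \<comment> \<open>Integration by parts of f''(k) |v - k|: the terms f'(k) sgn(v - k) cancel on
      differentiation. G is continuous at v because the factor f(k) - f(v) vanishes where the sign
      jumps.\<close>
    define G where "G k = a k * \<bar>v - k\<bar> + sgn (v - k) * (f k - f v)" for k
    have Gc: "isCont G k" for k
    proof -
      have "isCont (\<lambda>k. sgn (v - k) * (f k - f v)) k"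
      proof (cases "k = v")
        case True
        have "((\<lambda>k. f k - f v) \<longlongrightarrow> 0) (at v)"
          using continuous_f[of UNIV] by (auto simp: continuous_on_eq_continuous_at isCont_def intro: LIM_zero)
        then have "((\<lambda>k. sgn (v - k) * (f k - f v)) \<longlongrightarrow> 0) (at v)"
          by (rule Lim_null_comparison[rotated, OF tendsto_rabs_zero])
            (auto simp: abs_mult sgn_if intro: always_eventually)
        then show ?thesis using True by (simp add: isCont_def)
      next
        case False
        have "isCont (\<lambda>k. sgn (v - k)) k" using False by (intro isCont_sgn continuous_intros) auto
        moreover have "isCont (\<lambda>k. f k - f v) k"
          using continuous_f[of UNIV] by (intro continuous_intros) (auto simp: continuous_on_eq_continuous_at)
        ultimately show ?thesis by (rule isCont_mult)
      qed
      moreover have "isCont (\<lambda>k. a k * \<bar>v - k\<bar>) k" by (intro continuous_intros a_cont)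
      ultimately show ?thesis unfolding G_def by (rule isCont_add[rotated])
    qed
    have "((\<lambda>k. p * \<bar>k\<bar> powr (p - 1) * \<bar>v - k\<bar>) has_integral G K - G (-K)) {-K..K}"
    \<comment> \<open>The point 0 is exceptional even for p = 1: there \<open>0 powr 0\<close> is 0
      by convention, whereas \<open>a\<close> has derivative 1.\<close>
    proof (rule fundamental_theorem_of_calculus_interior_strong[of "{0, v}"])
      fix k assume k: "k \<in> {-K<..<K} - {0, v}"
      define e where "e = sgn (v - k)"
      have "\<forall>\<^sub>F y in nhds k. sgn (v - y) = e"
      proof (cases "k < v")
        case True
        then have "\<forall>\<^sub>F y in nhds k. y \<in> {..<v}" by (intro eventually_nhds_in_open) auto
        then show ?thesis by eventually_elim (use True in \<open>simp add: e_def\<close>)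
      next
        case False
        then have "\<forall>\<^sub>F y in nhds k. y \<in> {v<..}" using k by (intro eventually_nhds_in_open) auto
        then show ?thesis by eventually_elim (use False k in \<open>simp add: e_def\<close>)
      qed
      then have ev: "\<forall>\<^sub>F y in nhds k. a y * (e * (v - y)) + e * (f y - f v) = G y"
      proof eventually_elim
        case (elim y)
        then show ?case unfolding G_def by (metis sgn_mult_abs abs_sgn mult.commute)
      qed
      have "((\<lambda>y. a y * (e * (v - y)) + e * (f y - f v)) has_real_derivative
          (a k * (e * (- 1)) + p * \<bar>k\<bar> powr (p - 1) * (e * (v - k))) + e * a k) (at k)"
        using k f_deriv[of k] a_deriv[of k]
        by (auto intro!: derivative_eq_intros simp: a_def[symmetric])
      then have "(G has_real_derivative (a k * (e * (- 1)) + p * \<bar>k\<bar> powr (p - 1) * (e * (v - k))) + e * a k) (at k)"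
        using DERIV_cong_ev[OF refl ev refl] by (simp only:)
      moreover have "e * (v - k) = \<bar>v - k\<bar>" by (simp add: e_def abs_sgn mult.commute)
      ultimately show "(G has_vector_derivative p * \<bar>k\<bar> powr (p - 1) * \<bar>v - k\<bar>) (at k)"
        by (simp add: has_real_derivative_iff_has_vector_derivative[symmetric])
    qed (use \<open>0 < K\<close> Gc in \<open>auto intro: continuous_at_imp_continuous_on\<close>)
    moreover have "set_integrable lborel {-K..K} (\<lambda>k. p * \<bar>k\<bar> powr (p - 1) * \<bar>v - k\<bar>)"
      unfolding set_integrable_def
    proof (rule integrable_lborel_bounded[where A = "{-K..K}" and C = "p * K powr (p - 1) * (2 * K)"])
      show "\<bar>indicator {-K..K} k *\<^sub>R (p * \<bar>k\<bar> powr (p - 1) * \<bar>v - k\<bar>)\<bar> \<le> p * K powr (p - 1) * (2 * K)" for k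
      proof (cases "k \<in> {-K..K}")
        case True
        then have "\<bar>k\<bar> powr (p - 1) \<le> K powr (p - 1)" "\<bar>v - k\<bar> \<le> 2 * K"
          using p v by (auto intro!: powr_mono2)
        then have "p * \<bar>k\<bar> powr (p - 1) * \<bar>v - k\<bar> \<le> p * K powr (p - 1) * (2 * K)"
          using p \<open>0 < K\<close> by (intro mult_mono) auto
        then show ?thesis using True p by (simp add: abs_mult)
      qed (use p \<open>0 < K\<close> in auto)
    qed auto
    ultimately have "(LINT k:{-K..K}|lborel. p * \<bar>k\<bar> powr (p - 1) * \<bar>v - k\<bar>) = G K - G (-K)"
      using set_borel_integral_eq_integral(2) integral_unique by metis
    moreover have "G K = a K * (K - v) - (f K - f v)" using v by (cases "v = K") (auto simp: G_def sgn_if)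
    moreover have "G (-K) = - (a K * (v + K)) + (f (-K) - f v)"
      using v \<open>0 < K\<close> by (cases "v = -K") (auto simp: G_def a_def sgn_if)
    ultimately show ?thesis by (simp add: set_lebesgue_integral_def algebra_simps)
  qed
  then show ?thesis by (rule that)
qed

end

text \<open>The area of a layer to the left of a curve, inside the box: every time slice has length
  at most \<open>\<delta>\<close>. It measures where the derivative of a steep step is
  nonzero.\<close>

lemma strip_integral_le:
  fixes \<gamma> :: "real \<Rightarrow> real" and B :: real
  assumes \<gamma>: "continuous_on UNIV \<gamma>" and "0 \<le> T" "0 \<le> \<delta>"
  defines "G \<equiv> \<lambda>z. indicator ({0<..<T} \<times> {-B..B}) z * indicator {0..\<delta>} (\<gamma> (fst z) - snd z)"
  shows "integrable lborel G" and "(\<integral>z. G z \<partial>lborel) \<le> T * \<delta>"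
proof -
  have [measurable]: "\<gamma> \<in> borel_measurable borel" by (rule borel_measurable_continuous_onI[OF \<gamma>])
  have [measurable]: "{0<..<T} \<times> {-B..B} \<in> sets borel" by (auto simp: borel_prod[symmetric])
  show int: "integrable lborel G"
  proof (rule integrable_lborel_bounded[where A = "{0<..<T} \<times> {-B..B}" and C = 1])
    show "G \<in> borel_measurable borel" unfolding G_def by measurable
  qed (auto simp: G_def indicator_def bounded_Times)
  have "(\<integral>x. G (t, x) \<partial>lborel) \<le> \<delta> * indicator {0..T} t" for t
  proof (cases "t \<in> {0<..<T}")
    case True
    have "(\<integral>x. G (t, x) \<partial>lborel) \<le> (\<integral>x. indicator {\<gamma> t - \<delta>..\<gamma> t} x \<partial>lborel)"
    proof (rule integral_le_of_AE_le)
      show "integrable lborel (indicator {\<gamma> t - \<delta>..\<gamma> t} :: real \<Rightarrow> real)"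
        by (rule integrable_real_indicator) (auto simp: emeasure_lborel_Icc_eq)
    qed (auto simp: G_def indicator_def)
    also have "\<dots> = \<delta>" using \<open>0 \<le> \<delta>\<close> by simp
    finally show ?thesis using True by simp
  next
    case False
    then have "(\<lambda>x. G (t, x)) = (\<lambda>_. 0)" by (auto simp: G_def indicator_def)
    then show ?thesis using \<open>0 \<le> \<delta>\<close> by (simp only:) simp
  qed
  then have "(\<integral>t. \<integral>x. G (t, x) \<partial>lborel \<partial>lborel) \<le> (\<integral>t. \<delta> * indicator {0..T} t \<partial>lborel)"
  proof (intro integral_le_of_AE_le)
    show "integrable lborel (\<lambda>t. \<delta> * indicator {0..T} t)"
      by (intro integrable_mult_right integrable_real_indicator) (auto simp: emeasure_lborel_Icc_eq)
  qed (use \<open>0 \<le> \<delta>\<close> in auto)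
  also have "\<dots> = T * \<delta>" using \<open>0 \<le> T\<close> by simp
  finally show "(\<integral>z. G z \<partial>lborel) \<le> T * \<delta>" using integral_lborel_Pair[OF int] by simp
qed

lemma step_limit:
  "(\<lambda>n. step (real (Suc n) * c)) \<longlonglongrightarrow> (if c > 0 then 1 else 0)"
proof (cases "c > 0")
  case True
  obtain N :: nat where N: "1 / c \<le> N" using real_arch_simple by blast
  have "step (real (Suc n) * c) = 1" if "n \<ge> N" for n
  proof (rule step_1)
    have "1 / c \<le> real (Suc n)" using N that by linarith
    then show "1 \<le> real (Suc n) * c" using True by (simp add: field_simps)
  qed
  then show ?thesis using True by (intro tendsto_eventually) (auto simp: eventually_sequentially)
next
  case False
  then have "step (real (Suc n) * c) = 0" for n by (intro step_0) (simp add: mult_nonneg_nonpos)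
  then show ?thesis using False by simp
qed

section \<open>Comparison of entropies with the explicit solution\<close>

context burgers_solution
begin

lemma zero_initial: "AE x in lborel. u 0 x + - usol 0 x = 0"
  using u_initial by eventually_elim simp

text \<open>The bound on u holds almost everywhere in space-time, hence on almost every slice only.
  This suffices because \<open>f_comparison\<close> is used under an integral over time.\<close>

lemma slice_bound_AE: "AE t in lborel. t \<in> {0..T} \<longrightarrow> (AE x in lborel. \<bar>u t x\<bar> \<le> K)"
proof -
  have "AE z in lborel \<Otimes>\<^sub>M lborel. z \<in> {0..T} \<times> UNIV \<longrightarrow> \<bar>u (fst z) (snd z)\<bar> \<le> K"
    unfolding lborel_prod by (rule K(3))
  from lborel_pair.AE_pair[OF this]
  show ?thesis by eventually_elim auto
qed

lemma difference_cut_initial: "(\<integral>x. (u 0 x + - usol 0 x) * g x \<partial>lborel) = 0"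
  by (rule integral_eq_zero_AE) (use zero_initial in \<open>eventually_elim, simp\<close>)

text \<open>The entropy of \<open>usol\<close> may be subtracted because its relation is an
  equality. The two solutions agree initially, and the slope of \<open>cut\<close> lies where both
  vanish, so neither an initial term nor a flux term remains.\<close>

lemma entropy_comparison:
  assumes t: "t \<in> {0..T}"
  shows "(\<integral>x. (\<bar>u t x - k\<bar> + - \<bar>usol t x - k\<bar>) * cut x \<partial>lborel) \<le> 0"
proof -
  \<comment> \<open>\<open>usol\<close> is itself an entropy solution with these data, so everything
    proved for u holds for it.\<close>
  interpret U: burgers_solution T p lam A w\<^sub>0 usol by unfold_locales (rule kruzhkov_usol)
  define b where "b = (\<lambda>t x. sgn (u t x - k) * (f (u t x) - f k) + - (sgn (usol t x - k) * (f (usol t x) - f k)))"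
  have "conservation_ineq T (\<lambda>t x. - \<bar>usol t x - k\<bar>) (\<lambda>t x. - (sgn (usol t x - k) * (f (usol t x) - f k)))"
    unfolding conservation_ineq_def
    using C_L1loc_minus[OF U.C_L1loc_entropy] loc_integrable_minus[OF U.loc_integrable_entropy_flux]
    by (auto simp: distr_div_minus entropy_equality)
  from conservation_ineq_add[OF entropy_ineq this]
  have c: "conservation_ineq T (\<lambda>t x. \<bar>u t x - k\<bar> + - \<bar>usol t x - k\<bar>) b" by (simp add: b_def)
  let ?\<Phi> = "\<lambda>z::real \<times> real. cut (snd z)"
  have dt: "dt ?\<Phi> (t, x) = 0" for t x
    by (rule dt_eqI[OF smooth_cut]) simp
  have dx: "dx ?\<Phi> (t, x) = cut' x" for t x
    by (rule dx_eqI[OF smooth_cut]) (simp add: cut_deriv)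
  have "(\<integral>x. (\<bar>u t x - k\<bar> + - \<bar>usol t x - k\<bar>) * ?\<Phi> (t, x) \<partial>lborel) \<le>
      (\<integral>x. (\<bar>u 0 x - k\<bar> + - \<bar>usol 0 x - k\<bar>) * ?\<Phi> (0, x) \<partial>lborel) + 0"
  proof (rule weighted_mass_le[OF c smooth_cut, where B = "R + 1"])
    fix \<theta> :: "real \<Rightarrow> real"
    show "(\<integral>z. indicator ({0<..<T} \<times> {-(R+1)..R+1}) z * (\<theta> (fst z) *
        ((\<bar>u (fst z) (snd z) - k\<bar> + - \<bar>usol (fst z) (snd z) - k\<bar>) * dt ?\<Phi> z + b (fst z) (snd z) * dx ?\<Phi> z)) \<partial>lborel) \<le> 0"
    proof (rule order.eq_iff[THEN iffD1, THEN conjunct1], rule integral_eq_zero_AE)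
      show "AE z in lborel. indicator ({0<..<T} \<times> {-(R+1)..R+1}) z * (\<theta> (fst z) *
        ((\<bar>u (fst z) (snd z) - k\<bar> + - \<bar>usol (fst z) (snd z) - k\<bar>) * dt ?\<Phi> z + b (fst z) (snd z) * dx ?\<Phi> z)) = 0"
        using u_outside_strip
      proof eventually_elim
        case (elim z)
        obtain t x where z: "z = (t, x)" by (cases z)
        show ?case
        proof (cases "t \<in> {0<..<T} \<and> R \<le> \<bar>x\<bar>")
          case True
          then have "b t x = 0" using elim by (simp add: z b_def)
          then show ?thesis by (simp add: z dt)
        next
          case False
          then have "t \<notin> {0<..<T} \<or> cut' x = 0" using cut'_0[of x] by fastforce
          then show ?thesis by (auto simp: z dt dx)
        qed
      qed
    qed
  qed (use t cut_0 in auto)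
  also have "(\<integral>x. (\<bar>u 0 x - k\<bar> + - \<bar>usol 0 x - k\<bar>) * ?\<Phi> (0, x) \<partial>lborel) = 0"
  proof (rule integral_eq_zero_AE)
    show "AE x in lborel. (\<bar>u 0 x - k\<bar> + - \<bar>usol 0 x - k\<bar>) * ?\<Phi> (0, x) = 0"
      using u_initial by eventually_elim simp
  qed
  finally show ?thesis by simp
qed

lemma f_comparison:
  assumes t: "t \<in> {0..T}" and bd: "AE x in lborel. \<bar>u t x\<bar> \<le> K"
  shows "(\<integral>x. (f (u t x) + - f (usol t x)) * cut x \<partial>lborel) \<le> 0"
proof -
  let ?I = "{-(R+1)..R+1}"
  \<comment> \<open>A Borel modification of the slice, bounded by K at every point and equal to u
    almost everywhere where \<open>cut\<close> can be nonzero. The averaging formula and Fubini need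
    this pointwise control.\<close>
  define v where "v x = max (-K) (min K (indicator ?I x * u t x))" for x
  have iu: "(\<lambda>x. indicator ?I x * u t x) \<in> borel_measurable borel"
  proof -
    have "integrable lborel (\<lambda>x. indicator ?I x * u t x)"
      using C_L1loc_integrable[OF C_L1loc_u t, of "R + 1"] by (simp add: set_integrable_def)
    from borel_measurable_integrable[OF this] show ?thesis by simp
  qed
  then have [measurable]: "v \<in> borel_measurable borel" unfolding v_def by measurable
  have [measurable]: "(\<lambda>x. usol t x) \<in> borel_measurable borel"
  proof -
    have "(\<lambda>x. (t, x)) \<in> borel_measurable borel" by (intro borel_measurable_continuous_onI continuous_intros)
    from measurable_compose[OF this measurable_usol] show ?thesis by simp
  qed
  have vK: "\<bar>v x\<bar> \<le> K" for x using K(2) by (auto simp: v_def)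
  have uK: "\<bar>usol t x\<bar> \<le> K" for x using usol_bounds[of t x] K(1) by auto
  have veq: "AE x in lborel. x \<in> ?I \<longrightarrow> v x = u t x"
    using bd by eventually_elim (auto simp: v_def)
  obtain c where c: "\<And>v. \<bar>v\<bar> \<le> K \<Longrightarrow>
      (\<integral>k. indicator {-K..K} k * (p * \<bar>k\<bar> powr (p - 1) * \<bar>v - k\<bar>) \<partial>lborel) = 2 * f v + c"
    by (rule f_as_entropy_average[OF K(2)]) (rule that, simp)
  define H where "H = (\<lambda>(k, x). indicator {-K..K} k * (p * \<bar>k\<bar> powr (p - 1) * (\<bar>v x - k\<bar> - \<bar>usol t x - k\<bar>)) * cut x)"
  have Hb: "\<bar>H z\<bar> \<le> p * K powr (p - 1) * (2 * K)" for z
  proof -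
    obtain k x where z: "z = (k, x)" by (cases z)
    show ?thesis
    proof (cases "k \<in> {-K..K}")
      case True
      have "\<bar>k\<bar> powr (p - 1) \<le> K powr (p - 1)" using True p by (intro powr_mono2) auto
      moreover have "\<bar>\<bar>v x - k\<bar> - \<bar>usol t x - k\<bar>\<bar> \<le> 2 * K" using vK[of x] uK[of x] by linarith
      ultimately have "p * \<bar>k\<bar> powr (p - 1) * \<bar>\<bar>v x - k\<bar> - \<bar>usol t x - k\<bar>\<bar> * cut x \<le> p * K powr (p - 1) * (2 * K) * 1"
        using p K(2) by (intro mult_mono) auto
      then show ?thesis using True p by (simp add: z H_def abs_mult)
    qed (use p K(2) in \<open>simp add: z H_def\<close>)
  qed
  have "H \<in> borel_measurable borel" unfolding H_def case_prod_beta by measurable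
  then have "integrable lborel H"
  proof (rule integrable_lborel_bounded[OF _ Hb])
    fix z assume z: "z \<notin> {-K..K} \<times> ?I"
    then show "H z = 0"
      using cut_0[of "snd z"] by (cases "fst z \<in> {-K..K}") (simp_all add: H_def case_prod_beta mem_Times_iff)
  qed (intro bounded_Times, auto)
  then have HI: "integrable (lborel \<Otimes>\<^sub>M lborel) (case_prod (\<lambda>k x. H (k, x)))" by (simp add: lborel_prod)
  have 1: "(\<integral>k. H (k, x) \<partial>lborel) = 2 * ((f (v x) + - f (usol t x)) * cut x)" for x
  proof -
    let ?h = "\<lambda>v k. indicator {-K..K} k * (p * \<bar>k\<bar> powr (p - 1) * \<bar>v - k\<bar>)"
    have i: "integrable lborel (?h v)" if "\<bar>v\<bar> \<le> K" for v
    proof (rule integrable_lborel_bounded[where A = "{-K..K}" and C = "p * K powr (p - 1) * (2 * K)"])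
      show "\<bar>?h v k\<bar> \<le> p * K powr (p - 1) * (2 * K)" for k
      proof (cases "k \<in> {-K..K}")
        case True
        then have "\<bar>k\<bar> powr (p - 1) \<le> K powr (p - 1)" "\<bar>v - k\<bar> \<le> 2 * K"
          using p that by (auto intro!: powr_mono2)
        then have "p * \<bar>k\<bar> powr (p - 1) * \<bar>v - k\<bar> \<le> p * K powr (p - 1) * (2 * K)"
          using p K(2) by (intro mult_mono) auto
        then show ?thesis using True p by (simp add: abs_mult)
      qed (use p K(2) in auto)
    qed auto
    have "(\<integral>k. H (k, x) \<partial>lborel) = (\<integral>k. (?h (v x) k - ?h (usol t x) k) * cut x \<partial>lborel)"
      by (rule Bochner_Integration.integral_cong[OF refl]) (simp add: H_def algebra_simps)
    also have "\<dots> = (\<integral>k. ?h (v x) k - ?h (usol t x) k \<partial>lborel) * cut x" by simp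
    also have "(\<integral>k. ?h (v x) k - ?h (usol t x) k \<partial>lborel) = (2 * f (v x) + c) - (2 * f (usol t x) + c)"
      using Bochner_Integration.integral_diff[OF i[OF vK] i[OF uK], of x x] c[OF vK[of x]] c[OF uK[of x]] by simp
    finally show ?thesis by (simp add: algebra_simps)
  qed
  have 2: "(\<integral>x. H (k, x) \<partial>lborel) \<le> 0" for k
  proof -
    have "(\<integral>x. H (k, x) \<partial>lborel) = indicator {-K..K} k * (p * \<bar>k\<bar> powr (p - 1)) *
        (\<integral>x. (\<bar>v x - k\<bar> + - \<bar>usol t x - k\<bar>) * cut x \<partial>lborel)"
      by (simp add: H_def mult.assoc)
    also have "(\<integral>x. (\<bar>v x - k\<bar> + - \<bar>usol t x - k\<bar>) * cut x \<partial>lborel) =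
        (\<integral>x. (\<bar>u t x - k\<bar> + - \<bar>usol t x - k\<bar>) * cut x \<partial>lborel)"
    proof (rule integral_cong_AE)
      show "AE x in lborel. (\<bar>v x - k\<bar> + - \<bar>usol t x - k\<bar>) * cut x = (\<bar>u t x - k\<bar> + - \<bar>usol t x - k\<bar>) * cut x"
        using veq
      proof eventually_elim
        case (elim x)
        then show ?case using cut_0[of x] by (cases "x \<in> ?I") simp_all
      qed
      have "(\<lambda>x. (\<bar>u t x - k\<bar> + - \<bar>usol t x - k\<bar>) * cut x) =
          (\<lambda>x. (\<bar>indicator ?I x * u t x - k\<bar> + - \<bar>usol t x - k\<bar>) * cut x)"
      proof
        fix x show "(\<bar>u t x - k\<bar> + - \<bar>usol t x - k\<bar>) * cut x = (\<bar>indicator ?I x * u t x - k\<bar> + - \<bar>usol t x - k\<bar>) * cut x"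
          using cut_0[of x] by (cases "x \<in> ?I") simp_all
      qed
      also have "\<dots> \<in> borel_measurable lborel" using iu by measurable
      finally show "(\<lambda>x. (\<bar>u t x - k\<bar> + - \<bar>usol t x - k\<bar>) * cut x) \<in> borel_measurable lborel" .
    qed measurable
    also have "indicator {-K..K} k * (p * \<bar>k\<bar> powr (p - 1)) * \<dots> \<le> 0"
      using entropy_comparison[OF t, of k] p by (intro mult_nonneg_nonpos) auto
    finally show ?thesis .
  qed
  have "(\<integral>x. (f (u t x) + - f (usol t x)) * cut x \<partial>lborel) = (\<integral>x. (f (v x) + - f (usol t x)) * cut x \<partial>lborel)"
  proof (rule integral_cong_AE)
    show "AE x in lborel. (f (u t x) + - f (usol t x)) * cut x = (f (v x) + - f (usol t x)) * cut x"
      using veq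
    proof eventually_elim
      case (elim x)
      then show ?case using cut_0[of x] by (cases "x \<in> ?I") simp_all
    qed
    have "(\<lambda>x. (f (u t x) + - f (usol t x)) * cut x) = (\<lambda>x. (f (indicator ?I x * u t x) + - f (usol t x)) * cut x)"
    proof
      fix x show "(f (u t x) + - f (usol t x)) * cut x = (f (indicator ?I x * u t x) + - f (usol t x)) * cut x"
        using cut_0[of x] by (cases "x \<in> ?I") simp_all
    qed
    also have "\<dots> \<in> borel_measurable lborel" using iu by measurable
    finally show "(\<lambda>x. (f (u t x) + - f (usol t x)) * cut x) \<in> borel_measurable lborel" .
  qed measurable
  also have "2 * \<dots> = (\<integral>x. \<integral>k. H (k, x) \<partial>lborel \<partial>lborel)" by (simp add: 1)
  also have "\<dots> = (\<integral>k. \<integral>x. H (k, x) \<partial>lborel \<partial>lborel)" by (rule lborel_pair.Fubini_integral[OF HI])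
  also have "\<dots> \<le> 0" using integral_le_of_AE_le[of lborel "\<lambda>_. 0" "\<lambda>k. \<integral>x. H (k, x) \<partial>lborel"] 2 by simp
  finally show ?thesis by simp
qed

end

section \<open>The primitive and the first moment of the difference\<close>

context burgers_solution
begin

text \<open>Along a characteristic line of \<open>usol\<close> the flux of \<open>u - usol\<close> has a sign because \<open>f\<close> lies above
  its tangents; this half of the comparison does not use entropy inequalities.\<close>

lemma primitive_nonpos:
  assumes t1: "t\<^sub>1 \<in> {0..T}"
  shows "(\<integral>x. indicator {..<x\<^sub>1} x * ((u t\<^sub>1 x + - usol t\<^sub>1 x) * cut x) \<partial>lborel) \<le> 0"
proof -
  interpret U: burgers_solution T p lam A w\<^sub>0 usol by unfold_locales (rule kruzhkov_usol)
  \<comment> \<open>k is the constant wave speed along the characteristic line of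
    \<open>usol\<close> through the given point, and y is the foot of that line at time 0.\<close>
  define k where "k = wsol t\<^sub>1 x\<^sub>1"
  define y where "y = x\<^sub>1 - k * t\<^sub>1"
  define \<gamma> where "\<gamma> t = y + k * t" for t
  have w0y: "w\<^sub>0 y = k" using wsol_eq[of x\<^sub>1 t\<^sub>1] t1 by (simp add: y_def k_def)
  have w\<gamma>: "wsol t (\<gamma> t) = k" if "t \<in> {0..T}" for t
    using wsol_line[OF that, of y] by (simp add: w0y \<gamma>_def)
  have c: "conservation_ineq T (\<lambda>t x. u t x + - usol t x) (\<lambda>t x. f (u t x) + - f (usol t x))"
    by (rule conservation_ineq_add[OF weak_ineq U.weak_ineq_minus])
  obtain Ms where Ms: "Ms \<ge> 0" "\<And>x. step' x \<le> Ms" using step'_bounded by blast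
  \<comment> \<open>The defect in \<open>key\<close> below is at most 4 lam K times the distance to
    the line. In a layer of width 1/m this distance cancels the factor m from differentiating the
    step, so the flux density is bounded by C there, while the layer has area at most T/m.\<close>
  define C where "C = Ms * (4 * lam * K)"
  have C: "C \<ge> 0" using Ms lam K(2) by (simp add: C_def)
  have bound: "(\<integral>x. (u t\<^sub>1 x + - usol t\<^sub>1 x) * (step (real (Suc n) * (x\<^sub>1 - x)) * cut x) \<partial>lborel) \<le>
      C * (T * (1 / real (Suc n)))" for n
  proof -
    define m where "m = real (Suc n)"
    have m: "m > 0" by (simp add: m_def)
    define \<Phi> where "\<Phi> z = step (m * (y + k * fst z - snd z)) * cut (snd z)" for z :: "real \<times> real"
    have s: "smooth \<Phi>" unfolding \<Phi>_def
      by (intro smooth_mult[OF _ smooth_cut] smooth_intros)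
    let ?S = "\<lambda>t x. step (m * (\<gamma> t - x))" and ?S' = "\<lambda>t x. step' (m * (\<gamma> t - x))"
    have dt: "dt \<Phi> (t, x) = m * k * ?S' t x * cut x" for t x
    proof (rule dt_eqI[OF s])
      have "((\<lambda>t. ?S t x) has_real_derivative ?S' t x * (m * k)) (at t)"
        using step_affine_deriv[of "m * (y - x)" "m * k" t] by (simp add: \<gamma>_def algebra_simps)
      from DERIV_cmult_right[OF this, of "cut x"]
      show "((\<lambda>t. \<Phi> (t, x)) has_real_derivative m * k * ?S' t x * cut x) (at t)"
        by (simp add: \<Phi>_def \<gamma>_def mult_ac)
    qed
    have dx: "dx \<Phi> (t, x) = - m * ?S' t x * cut x + ?S t x * cut' x" for t x
    proof (rule dx_eqI[OF s])
      have "((\<lambda>x. ?S t x) has_real_derivative ?S' t x * (- m)) (at x)"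
        using step_affine_deriv[of "m * \<gamma> t" "- m" x] by (simp add: algebra_simps)
      from DERIV_mult[OF this cut_deriv]
      show "((\<lambda>x. \<Phi> (t, x)) has_real_derivative - m * ?S' t x * cut x + ?S t x * cut' x) (at x)"
        by (simp add: \<Phi>_def \<gamma>_def mult_ac)
    qed
    have \<gamma>c: "continuous_on UNIV \<gamma>" unfolding \<gamma>_def by (intro continuous_intros)
    let ?A = "{0<..<T} \<times> {-(R+1)..R+1}"
    let ?G = "\<lambda>z. indicator ?A z * indicator {0..1 / m} (\<gamma> (fst z) - snd z) :: real"
    have G: "integrable lborel ?G" "(\<integral>z. ?G z \<partial>lborel) \<le> T * (1 / m)"
      using strip_integral_le[OF \<gamma>c, of T "1 / m" "R + 1"] T m by auto
    have "(\<integral>x. (u t\<^sub>1 x + - usol t\<^sub>1 x) * \<Phi> (t\<^sub>1, x) \<partial>lborel) \<le>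
        (\<integral>x. (u 0 x + - usol 0 x) * \<Phi> (0, x) \<partial>lborel) + C * (T * (1 / m))"
    proof (rule weighted_mass_le[OF c s, where B = "R + 1"])
      show "0 \<le> \<Phi> z" for z by (simp add: \<Phi>_def)
      show "\<Phi> (t, x) = 0" if "x \<notin> {-(R+1)..R+1}" for t x using cut_0[OF that] by (simp add: \<Phi>_def)
      show "0 \<le> C * (T * (1 / m))" using C T m by simp
      fix \<theta> :: "real \<Rightarrow> real" assume \<theta>: "\<And>t. 0 \<le> \<theta> t \<and> \<theta> t \<le> 1"
      let ?F = "\<lambda>z. indicator ?A z * (\<theta> (fst z) * ((u (fst z) (snd z) + - usol (fst z) (snd z)) * dt \<Phi> z +
        (f (u (fst z) (snd z)) + - f (usol (fst z) (snd z))) * dx \<Phi> z))"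
      have "(\<integral>z. ?F z \<partial>lborel) \<le> (\<integral>z. C * ?G z \<partial>lborel)"
      proof (rule integral_le_of_AE_le)
        show "integrable lborel (\<lambda>z. C * ?G z)" using G(1) by (rule integrable_mult_right)
        show "AE z in lborel. 0 \<le> C * ?G z" using C by simp
        show "AE z in lborel. ?F z \<le> C * ?G z"
          using K(3) u_outside_strip
        proof eventually_elim
          case (elim z)
          show ?case
          proof (cases "z \<in> ?A")
            case True
            obtain t x where z: "z = (t, x)" by (cases z)
            have t: "t \<in> {0..T}" using True by (simp add: z)
            have v: "\<bar>u t x\<bar> \<le> K" using elim(1) t by (simp add: z)
            define e where "e = u t x + - usol t x"
            define b where "b = f (u t x) + - f (usol t x)"
            have b0: "b * cut' x = 0"
            proof (cases "\<bar>x\<bar> < R")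
              case False
              then have "u t x = 0 \<and> usol t x = 0" using elim(2) t by (auto simp: z)
              then show ?thesis by (simp add: b_def)
            qed (simp add: cut'_0)
            have "e \<le> 2 * K" "- (2 * K) \<le> e" using v usol_bounds[of t x] K(1) by (auto simp: e_def)
            then have eK: "\<bar>e\<bar> \<le> 2 * K" by linarith
            \<comment> \<open>The tangent at \<open>usol t x\<close> bounds the difference of the
              fluxes from below by its linear part. What is left is the discrepancy between k and
              the local speed, which vanishes on the line.\<close>
            have "f (usol t x) + usol t x powr p * (u t x - usol t x) \<le> f (u t x)"
              by (rule f_above_tangent[OF usol_bounds(1)])
            then have "k * e - b \<le> (k - wsol t x) * e"
              by (simp add: b_def e_def wsol_eq_usol algebra_simps)
            also have "\<dots> \<le> \<bar>k - wsol t x\<bar> * \<bar>e\<bar>" by (simp add: abs_mult[symmetric])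
            also have "\<dots> \<le> (2 * lam * \<bar>\<gamma> t - x\<bar>) * (2 * K)"
              using wsol_lip[of t "\<gamma> t" t x] eK lam by (intro mult_mono) (auto simp: w\<gamma>[OF t])
            finally have key: "k * e - b \<le> 4 * lam * K * \<bar>\<gamma> t - x\<bar>" by (simp add: mult_ac)
            have Feq: "?F z = \<theta> t * cut x * (m * ?S' t x * (k * e - b))"
            proof -
              have "?F z = \<theta> t * (e * dt \<Phi> (t, x) + b * dx \<Phi> (t, x))"
                using True by (simp add: z e_def b_def)
              also have "\<dots> = \<theta> t * cut x * (m * ?S' t x * (k * e - b)) + \<theta> t * ?S t x * (b * cut' x)"
                unfolding dt dx by (simp add: algebra_simps)
              finally have "?F z = \<theta> t * cut x * (m * ?S' t x * (k * e - b)) + \<theta> t * ?S t x * (b * cut' x)" .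
              then show ?thesis by (simp add: b0)
            qed
            show ?thesis
            proof (cases "\<gamma> t - x \<in> {0..1 / m}")
              case strip: True
              have "m * \<bar>\<gamma> t - x\<bar> \<le> 1" using strip m by (simp add: field_simps)
              then have "4 * lam * K * (m * \<bar>\<gamma> t - x\<bar>) \<le> 4 * lam * K * 1"
                using lam K(2) by (intro mult_left_mono) auto
              moreover have "m * (k * e - b) \<le> m * (4 * lam * K * \<bar>\<gamma> t - x\<bar>)"
                using mult_left_mono[OF key, of m] m by simp
              moreover have "m * (4 * lam * K * \<bar>\<gamma> t - x\<bar>) = 4 * lam * K * (m * \<bar>\<gamma> t - x\<bar>)" by simp
              ultimately have "m * (k * e - b) \<le> 4 * lam * K" by linarith
              then have "?S' t x * (m * (k * e - b)) \<le> ?S' t x * (4 * lam * K)"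
                by (intro mult_left_mono) auto
              also have "\<dots> \<le> C" unfolding C_def using Ms(2) lam K(2) by (intro mult_right_mono) auto
              finally have X: "m * ?S' t x * (k * e - b) \<le> C" by (simp add: mult_ac)
              have "0 \<le> \<theta> t * cut x" "\<theta> t * cut x \<le> 1" using \<theta>[of t] by (auto simp: mult_le_one)
              then have "\<theta> t * cut x * (m * ?S' t x * (k * e - b)) \<le> C"
                using mult_left_mono[OF X, of "\<theta> t * cut x"] mult_right_mono[of "\<theta> t * cut x" 1 C] C by linarith
              moreover have "C * ?G z = C" using True strip by (simp add: z)
              ultimately show ?thesis unfolding Feq by linarith
            next
              case False
              then have "m * (\<gamma> t - x) \<le> 0 \<or> 1 \<le> m * (\<gamma> t - x)"
                using m by (auto simp: field_simps mult_le_0_iff)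
              then have "?S' t x = 0" by (rule step'_0)
              then show ?thesis unfolding Feq using C by simp
            qed
          qed simp
        qed
      qed
      also have "\<dots> \<le> C * (T * (1 / m))"
        using mult_left_mono[OF G(2) C] by simp
      finally show "(\<integral>z. ?F z \<partial>lborel) \<le> C * (T * (1 / m))" .
    qed (use t1 in auto)
    moreover have "m * (y + k * t\<^sub>1 - x) = m * (x\<^sub>1 - x)" for x by (simp add: y_def)
    ultimately show ?thesis using difference_cut_initial by (simp add: \<Phi>_def m_def)
  qed
  let ?g = "\<lambda>x. (u t\<^sub>1 x + - usol t\<^sub>1 x) * cut x"
  have ig: "integrable lborel ?g"
    by (rule C_L1loc_slice_pairing[OF C_L1loc_add[OF C_L1loc_u C_L1loc_minus[OF C_L1loc_usol]] t1 continuous_cut cut_0])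
  have [measurable]: "?g \<in> borel_measurable borel" using borel_measurable_integrable[OF ig] by simp
  have L1: "(\<lambda>n. \<integral>x. step (real (Suc n) * (x\<^sub>1 - x)) * ?g x \<partial>lborel) \<longlonglongrightarrow> (\<integral>x. indicator {..<x\<^sub>1} x * ?g x \<partial>lborel)"
  proof (rule integral_dominated_convergence[where w = "\<lambda>x. \<bar>?g x\<bar>"])
    show "AE x in lborel. (\<lambda>n. step (real (Suc n) * (x\<^sub>1 - x)) * ?g x) \<longlonglongrightarrow> indicator {..<x\<^sub>1} x * ?g x"
    proof (rule AE_I2)
      fix x
      have "(if x\<^sub>1 - x > 0 then 1 else 0) = (indicator {..<x\<^sub>1} x :: real)" by (simp add: indicator_def)
      then show "(\<lambda>n. step (real (Suc n) * (x\<^sub>1 - x)) * ?g x) \<longlonglongrightarrow> indicator {..<x\<^sub>1} x * ?g x"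
        using step_limit[of "x\<^sub>1 - x"] by (intro tendsto_mult tendsto_const) simp
    qed
    show "integrable lborel (\<lambda>x. \<bar>?g x\<bar>)" using ig by simp
    show "AE x in lborel. norm (step (real (Suc n) * (x\<^sub>1 - x)) * ?g x) \<le> \<bar>?g x\<bar>" for n
      by (rule AE_I2) (simp add: abs_mult mult_left_le_one_le)
  qed measurable
  have L2: "(\<lambda>n. C * (T * (1 / real (Suc n)))) \<longlonglongrightarrow> C * (T * 0)"
    by (intro tendsto_mult tendsto_const LIMSEQ_Suc lim_1_over_n)
  have "\<exists>N. \<forall>n\<ge>N. (\<integral>x. step (real (Suc n) * (x\<^sub>1 - x)) * ?g x \<partial>lborel) \<le> C * (T * (1 / real (Suc n)))"
  proof (intro exI allI impI)
    fix n
    have "step (real (Suc n) * (x\<^sub>1 - x)) * ?g x = (u t\<^sub>1 x + - usol t\<^sub>1 x) * (step (real (Suc n) * (x\<^sub>1 - x)) * cut x)" for x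
      by (rule mult.left_commute)
    then show "(\<integral>x. step (real (Suc n) * (x\<^sub>1 - x)) * ?g x \<partial>lborel) \<le> C * (T * (1 / real (Suc n)))"
      using bound[of n] by (simp only:)
  qed
  from LIMSEQ_le[OF L1 L2 this]
  have "(\<integral>x. indicator {..<x\<^sub>1} x * ?g x \<partial>lborel) \<le> C * (T * 0)" .
  then show ?thesis by simp
qed

text \<open>The inequality for \<open>usol\<close> - u is tested with (R + 1 - x) times
  \<open>cut\<close>, nonnegative because \<open>cut\<close> vanishes beyond R + 1. Where the
  solutions live the weight has slope -1, so the flux term is the time integral of the quantity in
  \<open>f_comparison\<close>.\<close>

lemma moment_nonneg:
  assumes t1: "t\<^sub>1 \<in> {0..T}"
  shows "0 \<le> (\<integral>x. (R + 1 - x) * ((u t\<^sub>1 x + - usol t\<^sub>1 x) * cut x) \<partial>lborel)"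
proof -
  interpret U: burgers_solution T p lam A w\<^sub>0 usol by unfold_locales (rule kruzhkov_usol)
  have c: "conservation_ineq T (\<lambda>t x. - u t x + usol t x) (\<lambda>t x. - f (u t x) + f (usol t x))"
    by (rule conservation_ineq_add[OF weak_ineq_minus U.weak_ineq])
  define \<Phi> where "\<Phi> z = (R + 1 - snd z) * cut (snd z)" for z :: "real \<times> real"
  have s: "smooth \<Phi>" unfolding \<Phi>_def by (intro smooth_mult[OF _ smooth_cut] smooth_intros)
  have dt: "dt \<Phi> (t, x) = 0" for t x by (rule dt_eqI[OF s]) (simp add: \<Phi>_def)
  have dx: "dx \<Phi> (t, x) = - cut x + (R + 1 - x) * cut' x" for t x
  proof (rule dx_eqI[OF s])
    have "((\<lambda>x. R + 1 - x) has_real_derivative - 1) (at x)" by (auto intro!: derivative_eq_intros)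
    from DERIV_mult[OF this cut_deriv]
    show "((\<lambda>x. \<Phi> (t, x)) has_real_derivative - cut x + (R + 1 - x) * cut' x) (at x)"
      by (simp add: \<Phi>_def mult_ac)
  qed
  let ?A = "{0<..<T} \<times> {-(R+1)..R+1}"
  let ?b = "\<lambda>t x. f (u t x) + - f (usol t x)"
  have lb: "loc_integrable T ?b"
    by (intro loc_integrable_add loc_integrable_minus loc_integrable_f U.loc_integrable_f)
  have "(\<integral>x. (- u t\<^sub>1 x + usol t\<^sub>1 x) * \<Phi> (t\<^sub>1, x) \<partial>lborel) \<le>
      (\<integral>x. (- u 0 x + usol 0 x) * \<Phi> (0, x) \<partial>lborel) + 0"
  proof (rule weighted_mass_le[OF c s, where B = "R + 1"])
    show "0 \<le> \<Phi> z" for z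
      using cut_0[of "snd z"] by (cases "snd z \<in> {-(R+1)..R+1}") (auto simp: \<Phi>_def)
    show "\<Phi> (t, x) = 0" if "x \<notin> {-(R+1)..R+1}" for t x using cut_0[OF that] by (simp add: \<Phi>_def)
    fix \<theta> :: "real \<Rightarrow> real" assume \<theta>c: "continuous_on UNIV \<theta>" and \<theta>: "\<And>t. 0 \<le> \<theta> t \<and> \<theta> t \<le> 1"
    let ?F = "\<lambda>z. indicator ?A z * (\<theta> (fst z) * ((- u (fst z) (snd z) + usol (fst z) (snd z)) * dt \<Phi> z +
        (- f (u (fst z) (snd z)) + f (usol (fst z) (snd z))) * dx \<Phi> z))"
    let ?H = "\<lambda>z. indicator ?A z * (?b (fst z) (snd z) * (\<theta> (fst z) * cut (snd z)))"
    have "continuous_on UNIV (\<lambda>z::real \<times> real. \<theta> (fst z) * cut (snd z))"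
      by (intro continuous_on_mult continuous_on_compose2[OF \<theta>c, of UNIV fst] continuous_on_compose2[OF continuous_cut[of UNIV], of UNIV snd]
          continuous_on_fst continuous_on_snd continuous_on_id) auto
    then have iH: "integrable lborel ?H" by (rule loc_integrable_pairing[OF lb])
    have FH: "?F z = ?H z" if "z \<in> {0..T} \<times> UNIV \<longrightarrow> R \<le> \<bar>snd z\<bar> \<longrightarrow>
        u (fst z) (snd z) = 0 \<and> usol (fst z) (snd z) = 0" for z
    proof (cases "z \<in> ?A")
      case True
      obtain t x where z: "z = (t, x)" by (cases z)
      have "?b t x * cut' x = 0"
      proof (cases "\<bar>x\<bar> < R")
        case False
        then have "u t x = 0 \<and> usol t x = 0" using that True by (auto simp: z)
        then show ?thesis by simp
      qed (simp add: cut'_0)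
      moreover have "?F z = ?H z - \<theta> t * (R + 1 - x) * (?b t x * cut' x)"
        using True by (simp add: z dt dx algebra_simps)
      ultimately show ?thesis by simp
    qed simp
    have eq: "AE z in lborel. ?F z = ?H z"
      using u_outside_strip by eventually_elim (rule FH)
    have "(\<integral>z. ?H z \<partial>lborel) \<le> 0"
    proof -
      have "(\<integral>z. ?H z \<partial>lborel) = (\<integral>t. \<integral>x. ?H (t, x) \<partial>lborel \<partial>lborel)" by (rule integral_lborel_Pair[OF iH])
      also have "\<dots> \<le> (\<integral>t. 0 \<partial>(lborel :: real measure))"
      proof (rule integral_le_of_AE_le)
        show "AE t in lborel. (\<integral>x. ?H (t, x) \<partial>lborel) \<le> 0"
          using slice_bound_AE
        proof eventually_elim
          case (elim t)
          show ?case
          proof (cases "t \<in> {0<..<T}")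
            case True
            have "?H (t, x) = \<theta> t * (?b t x * cut x)" for x
              using True cut_0[of x] by (cases "x \<in> {-(R+1)..R+1}") auto
            then have "(\<integral>x. ?H (t, x) \<partial>lborel) = \<theta> t * (\<integral>x. ?b t x * cut x \<partial>lborel)"
              by (simp only: integral_mult_right_zero)
            also have "\<dots> \<le> 0"
              using f_comparison[of t] elim True \<theta>[of t] by (intro mult_nonneg_nonpos) auto
            finally show ?thesis .
          next
            case False
            then have "(\<lambda>x. ?H (t, x)) = (\<lambda>_. 0)" by (auto simp: indicator_def)
            then show ?thesis by (simp only:) simp
          qed
        qed
      qed auto
      finally show ?thesis by simp
    qed
    \<comment> \<open>If \<open>?F\<close> were not integrable its integral would be 0 by
      convention; the maximum covers that case.\<close>
    moreover have "(\<integral>z. ?F z \<partial>lborel) \<le> max 0 (\<integral>z. ?H z \<partial>lborel)"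
    proof (cases "integrable lborel ?F")
      case True
      then have "(\<integral>z. ?F z \<partial>lborel) = (\<integral>z. ?H z \<partial>lborel)" using iH eq by (intro integral_cong_AE) auto
      then show ?thesis by simp
    qed (simp add: not_integrable_integral_eq)
    ultimately show "(\<integral>z. ?F z \<partial>lborel) \<le> 0" by linarith
  qed (use t1 in auto)
  also have "(\<integral>x. (- u 0 x + usol 0 x) * \<Phi> (0, x) \<partial>lborel) = 0"
  proof (rule integral_eq_zero_AE)
    show "AE x in lborel. (- u 0 x + usol 0 x) * \<Phi> (0, x) = 0"
      using u_initial by eventually_elim simp
  qed
  finally have "(\<integral>x. (- u t\<^sub>1 x + usol t\<^sub>1 x) * \<Phi> (t\<^sub>1, x) \<partial>lborel) \<le> 0" by simp
  moreover have "(\<integral>x. (- u t\<^sub>1 x + usol t\<^sub>1 x) * \<Phi> (t\<^sub>1, x) \<partial>lborel) =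
      (\<integral>x. - ((R + 1 - x) * ((u t\<^sub>1 x + - usol t\<^sub>1 x) * cut x)) \<partial>lborel)"
    by (rule Bochner_Integration.integral_cong[OF refl]) (simp add: \<Phi>_def algebra_simps)
  ultimately show ?thesis
    using Bochner_Integration.integral_minus[of lborel "\<lambda>x. (R + 1 - x) * ((u t\<^sub>1 x + - usol t\<^sub>1 x) * cut x)"] by linarith
qed

theorem u_unique:
  assumes t: "t \<in> {0..T}"
  shows "AE x in lborel. u t x = usol t x"
proof -
  have "AE x in lborel. (u t x + - usol t x) * cut x = 0"
  proof (rule AE_zero_of_primitive[where c = "R + 1"])
    show "integrable lborel (\<lambda>x. (u t x + - usol t x) * cut x)"
      by (rule C_L1loc_slice_pairing[OF C_L1loc_add[OF C_L1loc_u C_L1loc_minus[OF C_L1loc_usol]] t continuous_cut cut_0])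
  qed (use cut_0 R_bounds primitive_nonpos[OF t] moment_nonneg[OF t] in auto)
  then show ?thesis using u_outside[OF t]
  proof eventually_elim
    case (elim x)
    show ?case
    proof (cases "R \<le> \<bar>x\<bar>")
      case True
      then have "x \<notin> {-A..A}" using R_bounds unfolding atLeastAtMost_iff by linarith
      then show ?thesis using elim(2) usol_outside[of x t] True by simp
    next
      case False
      then show ?thesis using elim(1) cut_1[of x] by simp
    qed
  qed
qed

end

section \<open>Uniqueness for the transport equation\<close>

text \<open>The bound on 2 T Lc comes from Picard iteration with an arbitrary base time: the
  integral from the base time is written as a difference of two integrals from 0, each with
  Lipschitz constant at most Lc T, so the map contracts by 1/2 on the whole interval.\<close>

locale transport =
  fixes T Lc :: real and c :: "real \<Rightarrow> real \<Rightarrow> real"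
  assumes T: "T > 0" and Lc: "0 \<le> Lc" "2 * T * Lc \<le> 1 / 2"
    and cont: "continuous_on UNIV (\<lambda>z. c (fst z) (snd z))"
    and lip: "\<And>t x y. \<bar>c t x - c t y\<bar> \<le> Lc * \<bar>x - y\<bar>"
begin

lemma continuous_c_along: "continuous_on S \<gamma> \<Longrightarrow> continuous_on S (\<lambda>t. c t (\<gamma> t))"
  using continuous_on_compose2[OF cont, of S "\<lambda>t. (t, \<gamma> t)"] by (simp add: continuous_on_Pair)

text \<open>Picard iteration in the complete space of bounded continuous functions on the line.
  Clamping the time makes each iterate bounded and defined everywhere.\<close>

lemma characteristic:
  assumes t1: "t\<^sub>1 \<in> {0..T}"
  obtains \<gamma> where "continuous_on UNIV \<gamma>" "\<gamma> t\<^sub>1 = x\<^sub>1"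
    "\<And>t. t \<in> {0..T} \<Longrightarrow> (\<gamma> has_real_derivative c t (\<gamma> t)) (at t within {0..T})"
proof -
  define cl where "cl t = max 0 (min T t)" for t :: real
  have cl: "cl t \<in> {0..T}" "t \<in> {0..T} \<Longrightarrow> cl t = t" for t using T by (auto simp: cl_def)
  define I where "I \<gamma> t = integral {0..t} (\<lambda>s. c s (\<gamma> s))" for \<gamma> :: "real \<Rightarrow> real" and t
  have D: "(I \<gamma> has_real_derivative c t (\<gamma> t)) (at t within {0..T})"
    if "continuous_on UNIV \<gamma>" "t \<in> {0..T}" for \<gamma> t
    unfolding I_def
    by (rule integral_has_real_derivative[OF continuous_c_along[OF continuous_on_subset[OF that(1)]] that(2)]) simp
  define F where "F \<gamma> t = x\<^sub>1 + I \<gamma> (cl t) - I \<gamma> t\<^sub>1" for \<gamma> :: "real \<Rightarrow> real" and t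
  have F: "F \<gamma> \<in> bcontfun" if \<gamma>: "continuous_on UNIV \<gamma>" for \<gamma>
  proof -
    have Ic: "continuous_on {0..T} (I \<gamma>)"
      using D[OF \<gamma>] by (rule DERIV_continuous_on)
    have "continuous_on UNIV (\<lambda>t. I \<gamma> (cl t))"
      by (rule continuous_on_compose2[OF Ic]) (use cl in \<open>auto simp: cl_def intro!: continuous_intros\<close>)
    then have 1: "continuous_on UNIV (F \<gamma>)" unfolding F_def by (intro continuous_intros)
    have "F \<gamma> ` UNIV \<subseteq> (\<lambda>t. x\<^sub>1 + I \<gamma> t - I \<gamma> t\<^sub>1) ` {0..T}" using cl by (auto simp: F_def)
    moreover have "bounded ((\<lambda>t. x\<^sub>1 + I \<gamma> t - I \<gamma> t\<^sub>1) ` {0..T})"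
      by (intro compact_imp_bounded compact_continuous_image continuous_intros Ic) auto
    ultimately show ?thesis using 1 bounded_subset by (auto simp: bcontfun_def)
  qed
  define P where "P \<gamma> = Bcontfun (F (apply_bcontfun \<gamma>))" for \<gamma> :: "real \<Rightarrow>\<^sub>C real"
  have cb: "continuous_on UNIV (apply_bcontfun \<gamma>)" for \<gamma> :: "real \<Rightarrow>\<^sub>C real"
    using apply_bcontfun[of \<gamma>] by (simp add: bcontfun_def)
  have P: "apply_bcontfun (P \<gamma>) = F (apply_bcontfun \<gamma>)" for \<gamma>
    unfolding P_def by (rule Bcontfun_inverse[OF F[OF cb]])
  have Idiff: "\<bar>I (apply_bcontfun \<gamma>) t - I (apply_bcontfun \<eta>) t\<bar> \<le> Lc * dist \<gamma> \<eta> * T"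
    if t: "t \<in> {0..T}" for \<gamma> \<eta> :: "real \<Rightarrow>\<^sub>C real" and t
  proof -
    have cs: "continuous_on {0..t} (\<lambda>s. c s (apply_bcontfun \<gamma> s))" "continuous_on {0..t} (\<lambda>s. c s (apply_bcontfun \<eta> s))"
      by (intro continuous_c_along continuous_on_subset[OF cb] subset_UNIV)+
    have "I (apply_bcontfun \<gamma>) t - I (apply_bcontfun \<eta>) t =
        integral {0..t} (\<lambda>s. c s (apply_bcontfun \<gamma> s) - c s (apply_bcontfun \<eta> s))"
      unfolding I_def using cs by (intro Henstock_Kurzweil_Integration.integral_diff[symmetric] integrable_continuous_real)
    also have "norm \<dots> \<le> Lc * dist \<gamma> \<eta> * (t - 0)"
    proof (rule integral_bound)
      fix s
      have "\<bar>apply_bcontfun \<gamma> s - apply_bcontfun \<eta> s\<bar> \<le> dist \<gamma> \<eta>"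
        using dist_bounded[of \<gamma> s \<eta>] by (simp add: dist_real_def)
      from mult_left_mono[OF this Lc(1)]
      show "norm (c s (apply_bcontfun \<gamma> s) - c s (apply_bcontfun \<eta> s)) \<le> Lc * dist \<gamma> \<eta>"
        using lip[of s "apply_bcontfun \<gamma> s" "apply_bcontfun \<eta> s"] by simp
    next
      show "continuous_on {0..t} (\<lambda>s. c s (apply_bcontfun \<gamma> s) - c s (apply_bcontfun \<eta> s))"
        using cs by (rule continuous_on_diff)
    qed (use t in auto)
    also have "\<dots> \<le> Lc * dist \<gamma> \<eta> * T" using t Lc(1) by (intro mult_left_mono) auto
    finally show ?thesis by simp
  qed
  have "\<exists>!\<gamma>. P \<gamma> = \<gamma>"
  proof (rule banach_fix_type[where c = "1 / 2"])
    show "\<forall>\<gamma> \<eta>. dist (P \<gamma>) (P \<eta>) \<le> 1 / 2 * dist \<gamma> \<eta>"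
    proof (intro allI dist_bound)
      fix \<gamma> \<eta> t
      have "\<bar>F (apply_bcontfun \<gamma>) t - F (apply_bcontfun \<eta>) t\<bar> \<le> 2 * (Lc * dist \<gamma> \<eta> * T)"
        using Idiff[OF cl(1)[of t], of \<gamma> \<eta>] Idiff[OF t1, of \<gamma> \<eta>] unfolding F_def by linarith
      also have "\<dots> = (2 * T * Lc) * dist \<gamma> \<eta>" by simp
      also have "\<dots> \<le> 1 / 2 * dist \<gamma> \<eta>" by (rule mult_right_mono[OF Lc(2)]) simp
      finally show "dist (apply_bcontfun (P \<gamma>) t) (apply_bcontfun (P \<eta>) t) \<le> 1 / 2 * dist \<gamma> \<eta>"
        by (simp add: P dist_real_def)
    qed
  qed auto
  then obtain \<gamma> where "P \<gamma> = \<gamma>" by auto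
  then have fix_eq: "apply_bcontfun \<gamma> = F (apply_bcontfun \<gamma>)" using P[of \<gamma>] by simp
  let ?g = "apply_bcontfun \<gamma>"
  show ?thesis
  proof (rule that[of ?g])
    show "continuous_on UNIV ?g" by (rule cb)
    show "?g t\<^sub>1 = x\<^sub>1" by (subst fix_eq) (simp add: F_def cl(2)[OF t1])
    fix t assume t: "t \<in> {0..T}"
    have "((\<lambda>t. x\<^sub>1 + I ?g t - I ?g t\<^sub>1) has_real_derivative c t (?g t)) (at t within {0..T})"
      using D[OF cb t, of \<gamma>] by (auto intro!: derivative_eq_intros)
    then show "(?g has_real_derivative c t (?g t)) (at t within {0..T})"
    proof (rule has_field_derivative_transform_within[OF _ zero_less_one t])
      fix s assume "s \<in> {0..T}"
      then show "x\<^sub>1 + I ?g s - I ?g t\<^sub>1 = ?g s" by (subst (3) fix_eq) (simp add: F_def cl)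
    qed
  qed
qed

text \<open>The coefficient is merely continuous in time, so characteristics need not be smooth, but
  the sides of a test region must be. A polynomial close to the speed has a smooth primitive; an
  error e in the speed moves the curve by at most e T, which explains the minimum of
  \<open>\<eta>\<close> and \<open>\<eta>\<close> / T.\<close>

lemma smooth_approximate_characteristic:
  assumes \<gamma>c: "continuous_on UNIV \<gamma>"
    and \<gamma>: "\<And>t. t \<in> {0..T} \<Longrightarrow> (\<gamma> has_real_derivative c t (\<gamma> t)) (at t within {0..T})"
    and "0 < \<eta>"
  obtains g g' where "smooth g" "\<And>t. (g has_real_derivative g' t) (at t)"
    "\<And>t. t \<in> {0..T} \<Longrightarrow> \<bar>g t - \<gamma> t\<bar> \<le> \<eta>" "\<And>t. t \<in> {0..T} \<Longrightarrow> \<bar>g' t - c t (\<gamma> t)\<bar> \<le> \<eta>"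
proof -
  define e where "e = min \<eta> (\<eta> / T)"
  have e: "e > 0" "e \<le> \<eta>" "e * T \<le> \<eta>" using \<open>0 < \<eta>\<close> T by (auto simp: e_def min_def field_simps)
  have "continuous_on {0..T} (\<lambda>t. c t (\<gamma> t))"
    by (intro continuous_c_along continuous_on_subset[OF \<gamma>c]) simp
  then obtain q where q: "real_polynomial_function q" "\<And>t. t \<in> {0..T} \<Longrightarrow> \<bar>c t (\<gamma> t) - q t\<bar> < e"
    using Stone_Weierstrass_real_polynomial_function[of "{0..T}" "\<lambda>t. c t (\<gamma> t)" e] e by auto
  have sq: "smooth q" using q(1) by (rule smooth_real_polynomial_function)
  have "isCont q x" for x
    using smooth_imp_continuous_on[OF sq, of UNIV] by (simp add: continuous_on_eq_continuous_at)
  then obtain G where "\<And>x. (G has_vector_derivative q x) (at x)"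
    using einterval_antiderivative[of "-\<infinity>" "\<infinity>" q] by auto
  then have G: "(G has_real_derivative q x) (at x)" for x
    by (simp add: has_real_derivative_iff_has_vector_derivative)
  define g where "g t = G t + (\<gamma> 0 - G 0)" for t
  have g: "(g has_real_derivative q t) (at t)" for t
    unfolding g_def using DERIV_add[OF G[of t] DERIV_const[of "\<gamma> 0 - G 0"]] by simp
  show ?thesis
  proof (rule that[of g q])
    show "smooth g" by (rule smooth_antiderivative[OF g sq])
    show "(g has_real_derivative q t) (at t)" for t by (rule g)
    show "\<bar>q t - c t (\<gamma> t)\<bar> \<le> \<eta>" if "t \<in> {0..T}" for t using q(2)[OF that] e by linarith
    fix t assume t: "t \<in> {0..T}"
    have "norm ((g t - \<gamma> t) - (g 0 - \<gamma> 0)) \<le> e * norm (t - 0)"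
    proof (rule field_differentiable_bound[where S = "{0..T}" and f = "\<lambda>t. g t - \<gamma> t"])
      fix s assume s: "s \<in> {0..T}"
      show "((\<lambda>t. g t - \<gamma> t) has_real_derivative q s - c s (\<gamma> s)) (at s within {0..T})"
        by (intro DERIV_diff \<gamma>[OF s] has_field_derivative_at_within[OF g])
      show "norm (q s - c s (\<gamma> s)) \<le> e" using q(2)[OF s] by simp
    qed (use t T in auto)
    also have "\<dots> \<le> e * T" using t e by (intro mult_left_mono) auto
    finally show "\<bar>g t - \<gamma> t\<bar> \<le> \<eta>" using e by (simp add: g_def)
  qed
qed

end

text \<open>Approximate endpoints are off by at most 1/(n+1); after scaling by n + 1 the error is at
  most 1, which is harmless once the unperturbed argument has size 2. At c = 0 the perturbation
  would decide, so that point is left out.\<close>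

lemma step_limit_perturbed:
  assumes s: "\<And>n. \<bar>s n - real (Suc n) * c\<bar> \<le> 1" and "c \<noteq> 0"
  shows "(\<lambda>n. step (s n)) \<longlonglongrightarrow> (if c > 0 then 1 else 0)"
proof -
  obtain N :: nat where N: "2 / \<bar>c\<bar> \<le> N" using real_arch_simple by blast
  have big: "2 \<le> real (Suc n) * \<bar>c\<bar>" if "n \<ge> N" for n
  proof -
    have "2 / \<bar>c\<bar> \<le> real (Suc n)" using N that by linarith
    then show ?thesis using \<open>c \<noteq> 0\<close> by (simp add: field_simps)
  qed
  have "step (s n) = (if c > 0 then 1 else 0)" if n: "n \<ge> N" for n
  proof (cases "c > 0")
    case True
    then have "1 \<le> s n" using big[OF n] s[of n] by simp
    then show ?thesis using True by simp
  next
    case False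
    then have "real (Suc n) * c = - (real (Suc n) * \<bar>c\<bar>)" by simp
    then have "s n \<le> 0" using big[OF n] s[of n] by linarith
    then show ?thesis using False by simp
  qed
  then have "\<forall>\<^sub>F n in sequentially. step (s n) = (if c > 0 then 1 else 0)"
    unfolding eventually_sequentially by (intro exI[of _ N]) simp
  then show ?thesis by (rule tendsto_eventually)
qed

section \<open>Conservation of mass between characteristics\<close>

context transport
begin

lemma loc_integrable_flux:
  assumes "C_L1loc T v"
  shows "loc_integrable T (\<lambda>t x. c t x * v t x)"
  unfolding loc_integrable_def
proof
  fix B :: real
  have "set_integrable lborel ({0<..<T} \<times> {-B..B}) (\<lambda>z. v (fst z) (snd z) * c (fst z) (snd z))"
    using C_L1loc_loc_integrable[OF assms]
    by (intro set_integrable_times_continuous[OF _ _ cont] bounded_Times) (auto simp: loc_integrable_def)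
  then show "set_integrable lborel ({0<..<T} \<times> {-B..B}) (\<lambda>z. c (fst z) (snd z) * v (fst z) (snd z))"
    by (simp only: mult.commute)
qed

text \<open>The two sides of the region follow characteristics up to an error that is small compared with
  the width of the layer on which the test function varies, so the flux through the layer is
  controlled by the mass of \<open>v\<close> inside it.\<close>

lemma mass_between_characteristics:
  assumes v: "conservation_ineq T v (\<lambda>t x. c t x * v t x)" and init: "AE x in lborel. v 0 x = 0"
    and t1: "t\<^sub>1 \<in> {0..T}"
  shows "(\<integral>x. indicator {a<..<b} x * v t\<^sub>1 x \<partial>lborel) \<le> 0"
proof -
  have C1: "C_L1loc T v" using v by (simp add: conservation_ineq_def)
  obtain \<gamma>1 where \<gamma>1: "continuous_on UNIV \<gamma>1" "\<gamma>1 t\<^sub>1 = a"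
    "\<And>t. t \<in> {0..T} \<Longrightarrow> (\<gamma>1 has_real_derivative c t (\<gamma>1 t)) (at t within {0..T})"
    using characteristic[OF t1, of a] by blast
  obtain \<gamma>2 where \<gamma>2: "continuous_on UNIV \<gamma>2" "\<gamma>2 t\<^sub>1 = b"
    "\<And>t. t \<in> {0..T} \<Longrightarrow> (\<gamma>2 has_real_derivative c t (\<gamma>2 t)) (at t within {0..T})"
    using characteristic[OF t1, of b] by blast
  have "\<exists>B. \<forall>t\<in>{0..T}. \<bar>\<gamma> t\<bar> \<le> B" if "continuous_on UNIV \<gamma>" for \<gamma> :: "real \<Rightarrow> real"
  proof -
    have "bounded (\<gamma> ` {0..T})"
      by (intro compact_imp_bounded compact_continuous_image continuous_on_subset[OF that]) auto
    then show ?thesis by (auto simp: bounded_real)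
  qed
  from this[OF \<gamma>1(1)] this[OF \<gamma>2(1)]
  obtain B1 B2 where B12: "\<forall>t\<in>{0..T}. \<bar>\<gamma>1 t\<bar> \<le> B1" "\<forall>t\<in>{0..T}. \<bar>\<gamma>2 t\<bar> \<le> B2" by auto
  \<comment> \<open>The extra 1 leaves room for the smooth curves, which stay within distance 1 of
    the characteristics.\<close>
  define B where "B = max B1 B2 + 1"
  have B: "\<bar>\<gamma>1 t\<bar> + 1 \<le> B" "\<bar>\<gamma>2 t\<bar> + 1 \<le> B" if "t \<in> {0..T}" for t
    using B12 that by (fastforce simp: B_def)+
  obtain Ms where Ms: "Ms \<ge> 0" "\<And>x. step' x \<le> Ms" using step'_bounded by blast
  \<comment> \<open>With m = n + 1, the speed error 1/m and the variation 2 Lc / m of c across the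
    strip add up to (1 + 2 Lc) / m; the factor m from differentiating the step cancels the
    denominator, and Ms bounds \<open>step'\<close>.\<close>
  define C0 where "C0 = Ms * (1 + 2 * Lc)"
  have C0: "C0 \<ge> 0" using Ms Lc by (simp add: C0_def)
  let ?A = "{0<..<T} \<times> {-B..B}"
  let ?v = "\<lambda>z. v (fst z) (snd z)"
  \<comment> \<open>The half-width 2/(n+1) has two parts: the layer of the step, and the distance
    between the smooth curve and the characteristic.\<close>
  define V where "V \<gamma> n z = (indicator {-(2 / real (Suc n))..2 / real (Suc n)} (\<gamma> (fst z) - snd z) :: real)"
    for \<gamma> :: "real \<Rightarrow> real" and n and z :: "real \<times> real"
  have V01: "0 \<le> V \<gamma> n z" "V \<gamma> n z \<le> 1" for \<gamma> n z by (auto simp: V_def indicator_def)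
  \<comment> \<open>G n bounds the flux through the two layers. It is dominated by a multiple of |v|
    on the box and tends to 0 off the two curves, a null set, so its integral tends to 0 although v
    is only locally integrable.\<close>
  define G where "G n z = indicator ?A z * (\<bar>?v z\<bar> * (C0 * (V \<gamma>1 n z + V \<gamma>2 n z)))" for n z
  have Gpos: "0 \<le> G n z" for n z using C0 V01 by (simp add: G_def)
  have iv: "integrable lborel (\<lambda>z. indicator ?A z * \<bar>?v z\<bar>)"
    using set_integrable_abs[of lborel ?A ?v] C_L1loc_loc_integrable[OF C1]
    by (simp add: loc_integrable_def set_integrable_def)
  have [measurable]: "\<gamma>1 \<in> borel_measurable borel" "\<gamma>2 \<in> borel_measurable borel"
    using \<gamma>1(1) \<gamma>2(1) by (auto intro: borel_measurable_continuous_onI)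
  have [measurable]: "(\<lambda>z. indicator ?A z * \<bar>?v z\<bar>) \<in> borel_measurable borel"
    using borel_measurable_integrable[OF iv] by simp
  have Geq: "G n z = (indicator ?A z * \<bar>?v z\<bar>) * (C0 * (V \<gamma>1 n z + V \<gamma>2 n z))" for n z
    by (simp add: G_def)
  have Gm: "G n \<in> borel_measurable borel" for n
    unfolding Geq[abs_def] V_def by measurable
  have dom: "norm (G n z) \<le> C0 * 2 * (indicator ?A z * \<bar>?v z\<bar>)" for n z
  proof -
    have "C0 * (V \<gamma>1 n z + V \<gamma>2 n z) \<le> C0 * 2"
      using V01(2)[of \<gamma>1 n z] V01(2)[of \<gamma>2 n z] C0 by (intro mult_left_mono) auto
    then have "(indicator ?A z * \<bar>?v z\<bar>) * (C0 * (V \<gamma>1 n z + V \<gamma>2 n z)) \<le> (indicator ?A z * \<bar>?v z\<bar>) * (C0 * 2)"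
      by (rule mult_left_mono) simp
    then show ?thesis using Gpos[of n z] by (simp add: Geq mult_ac)
  qed
  have idom: "integrable lborel (\<lambda>z. C0 * 2 * (indicator ?A z * \<bar>?v z\<bar>))"
    using iv by (rule integrable_mult_right)
  have Gi: "integrable lborel (G n)" for n
  proof (rule Bochner_Integration.integrable_bound[OF idom])
    show "AE z in lborel. norm (G n z) \<le> norm (C0 * 2 * (indicator ?A z * \<bar>?v z\<bar>))"
      using dom by (intro AE_I2) (metis abs_ge_self order_trans real_norm_def)
  qed (use Gm in simp)
  have off: "AE z in lborel. z \<in> {0..T} \<times> UNIV \<longrightarrow> snd z \<noteq> \<gamma>1 (fst z) \<and> snd z \<noteq> \<gamma>2 (fst z)"
  proof (rule AE_strip_of_slices)
    show "AE x in lborel. snd (t, x) \<noteq> \<gamma>1 (fst (t, x)) \<and> snd (t, x) \<noteq> \<gamma>2 (fst (t, x))" for t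
      using AE_lborel_singleton[of "\<gamma>1 t"] AE_lborel_singleton[of "\<gamma>2 t"] by eventually_elim simp
  qed measurable
  have Vlim: "(\<lambda>n. V \<gamma> n z) \<longlonglongrightarrow> 0" if "snd z \<noteq> \<gamma> (fst z)" for \<gamma> z
  proof (rule tendsto_eventually)
    define d where "d = \<bar>\<gamma> (fst z) - snd z\<bar>"
    have d: "d > 0" using that by (simp add: d_def)
    obtain N :: nat where N: "2 / d < N" using reals_Archimedean2 by blast
    have "V \<gamma> n z = 0" if "n \<ge> N" for n
    proof -
      have "2 / d < real (Suc n)" using N that by linarith
      then have "2 / real (Suc n) < d" using d by (simp add: field_simps)
      then show ?thesis by (auto simp: V_def d_def indicator_def)
    qed
    then show "\<forall>\<^sub>F n in sequentially. V \<gamma> n z = 0" unfolding eventually_sequentially by blast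
  qed
  have "(\<lambda>n. \<integral>z. G n z \<partial>lborel) \<longlonglongrightarrow> (\<integral>z. 0 \<partial>(lborel :: (real \<times> real) measure))"
  proof (rule integral_dominated_convergence[OF _ _ idom])
    show "AE z in lborel. (\<lambda>n. G n z) \<longlonglongrightarrow> 0"
      using off
    proof eventually_elim
      case (elim z)
      show ?case
      proof (cases "z \<in> ?A")
        case True
        then have "z \<in> {0..T} \<times> UNIV" by (auto simp: mem_Times_iff)
        then have "(\<lambda>n. V \<gamma>1 n z) \<longlonglongrightarrow> 0" "(\<lambda>n. V \<gamma>2 n z) \<longlonglongrightarrow> 0" using elim Vlim by auto
        then have "(\<lambda>n. G n z) \<longlonglongrightarrow> indicator ?A z * (\<bar>?v z\<bar> * (C0 * (0 + 0)))"
          unfolding G_def by (intro tendsto_intros)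
        then show ?thesis by simp
      qed (simp add: G_def)
    qed
  qed (use Gm dom in auto)
  then have E: "(\<lambda>n. \<integral>z. G n z \<partial>lborel) \<longlonglongrightarrow> 0" by simp
  \<comment> \<open>r1 and r2 are the positions at time t1 of the two smooth curves. The curves
    change with n, and only these positions are kept for the limit.\<close>
  have "\<exists>r1 r2. \<bar>r1 - a\<bar> \<le> 1 / real (Suc n) \<and> \<bar>r2 - b\<bar> \<le> 1 / real (Suc n) \<and>
      (\<forall>x. x \<notin> {-B..B} \<longrightarrow> step (real (Suc n) * (r2 - x)) * step (real (Suc n) * (x - r1)) = 0) \<and>
      (\<integral>x. v t\<^sub>1 x * (step (real (Suc n) * (r2 - x)) * step (real (Suc n) * (x - r1))) \<partial>lborel) \<le> (\<integral>z. G n z \<partial>lborel)" for n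
  proof -
    define m where "m = real (Suc n)"
    have m: "m \<ge> 1" by (simp add: m_def)
    then have m1: "0 < 1 / m" "1 / m \<le> 1" by auto
    obtain g1 g1' where g1: "smooth g1" "\<And>t. (g1 has_real_derivative g1' t) (at t)"
      "\<And>t. t \<in> {0..T} \<Longrightarrow> \<bar>g1 t - \<gamma>1 t\<bar> \<le> 1 / m" "\<And>t. t \<in> {0..T} \<Longrightarrow> \<bar>g1' t - c t (\<gamma>1 t)\<bar> \<le> 1 / m"
      using smooth_approximate_characteristic[OF \<gamma>1(1,3) m1(1)] by blast
    obtain g2 g2' where g2: "smooth g2" "\<And>t. (g2 has_real_derivative g2' t) (at t)"
      "\<And>t. t \<in> {0..T} \<Longrightarrow> \<bar>g2 t - \<gamma>2 t\<bar> \<le> 1 / m" "\<And>t. t \<in> {0..T} \<Longrightarrow> \<bar>g2' t - c t (\<gamma>2 t)\<bar> \<le> 1 / m"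
      using smooth_approximate_characteristic[OF \<gamma>2(1,3) m1(1)] by blast
    define \<Phi> where "\<Phi> z = step (m * (g2 (fst z) - snd z)) * step (m * (snd z - g1 (fst z)))" for z :: "real \<times> real"
    have s: "smooth \<Phi>"
      unfolding \<Phi>_def
      by (intro smooth_mult smooth_step_comp smooth_const smooth_diff smooth_snd
          smooth_compose[OF g1(1)] smooth_compose[OF g2(1)] smooth_fst)
    let ?S2 = "\<lambda>t x. step (m * (g2 t - x))" and ?S2' = "\<lambda>t x. step' (m * (g2 t - x))"
    let ?S1 = "\<lambda>t x. step (m * (x - g1 t))" and ?S1' = "\<lambda>t x. step' (m * (x - g1 t))"
    have dt: "dt \<Phi> (t, x) = ?S2' t x * (m * g2' t) * ?S1 t x - ?S1' t x * (m * g1' t) * ?S2 t x" for t x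
    proof (rule dt_eqI[OF s])
      have "((\<lambda>t. ?S2 t x) has_real_derivative ?S2' t x * (m * g2' t)) (at t)"
        by (rule DERIV_chain2[OF step_deriv]) (auto intro!: derivative_eq_intros g2(2))
      moreover have "((\<lambda>t. ?S1 t x) has_real_derivative ?S1' t x * (- (m * g1' t))) (at t)"
        by (rule DERIV_chain2[OF step_deriv]) (auto intro!: derivative_eq_intros g1(2))
      ultimately show "((\<lambda>t. \<Phi> (t, x)) has_real_derivative
          ?S2' t x * (m * g2' t) * ?S1 t x - ?S1' t x * (m * g1' t) * ?S2 t x) (at t)"
        unfolding \<Phi>_def fst_conv snd_conv by (rule DERIV_cong[OF DERIV_mult]) simp
    qed
    have dx: "dx \<Phi> (t, x) = - ?S2' t x * m * ?S1 t x + ?S1' t x * m * ?S2 t x" for t x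
    proof (rule dx_eqI[OF s])
      have "((\<lambda>x. ?S2 t x) has_real_derivative ?S2' t x * (- m)) (at x)"
        by (rule DERIV_chain2[OF step_deriv]) (auto intro!: derivative_eq_intros)
      moreover have "((\<lambda>x. ?S1 t x) has_real_derivative ?S1' t x * m) (at x)"
        by (rule DERIV_chain2[OF step_deriv]) (auto intro!: derivative_eq_intros)
      ultimately show "((\<lambda>x. \<Phi> (t, x)) has_real_derivative - ?S2' t x * m * ?S1 t x + ?S1' t x * m * ?S2 t x) (at x)"
        unfolding \<Phi>_def fst_conv snd_conv by (rule DERIV_cong[OF DERIV_mult]) simp
    qed
    have layer: "\<bar>step' y * (m * (g' - c t x))\<bar> \<le> C0 * V \<gamma> n (t, x)"
      if "\<bar>y\<bar> = m * \<bar>g - x\<bar>" "\<bar>g - \<gamma> t\<bar> \<le> 1 / m" "\<bar>g' - c t (\<gamma> t)\<bar> \<le> 1 / m" for y g g' \<gamma> t x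
    proof (cases "\<bar>y\<bar> \<le> 1")
      case False
      then have "step' y = 0" by (intro step'_0) auto
      then show ?thesis using C0 V01 by simp
    next
      case True
      then have "\<bar>g - x\<bar> \<le> 1 / m" using that(1) m by (simp add: field_simps)
      moreover have "2 / m = 1 / m + 1 / m" by simp
      ultimately have gx: "\<bar>\<gamma> t - x\<bar> \<le> 2 / m" using that(2) by linarith
      then have "- (2 / m) \<le> \<gamma> t - x" "\<gamma> t - x \<le> 2 / m" by linarith+
      then have V1: "V \<gamma> n (t, x) = 1" unfolding V_def m_def[symmetric] by (simp add: indicator_def)
      have "\<bar>g' - c t x\<bar> \<le> 1 / m + Lc * (2 / m)"
        using that(3) lip[of t "\<gamma> t" x] mult_left_mono[OF gx Lc(1)] by linarith
      then have "m * \<bar>g' - c t x\<bar> \<le> m * (1 / m + Lc * (2 / m))" using m by (intro mult_left_mono) auto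
      also have "\<dots> = 1 + 2 * Lc" using m by (simp add: field_simps)
      finally have "step' y * (m * \<bar>g' - c t x\<bar>) \<le> Ms * (1 + 2 * Lc)"
        using Ms m by (intro mult_mono) auto
      then show ?thesis using m by (simp add: V1 C0_def abs_mult)
    qed
    have zero: "\<Phi> (t, x) = 0" if "t \<in> {0..T}" "x \<notin> {-B..B}" for t x
    proof -
      have "\<bar>g1 t\<bar> \<le> B" "\<bar>g2 t\<bar> \<le> B" using g1(3)[OF that(1)] g2(3)[OF that(1)] B[OF that(1)] m1 by linarith+
      then have "g2 t - x \<le> 0 \<or> x - g1 t \<le> 0" using that(2) unfolding atLeastAtMost_iff by linarith
      then have "m * (g2 t - x) \<le> 0 \<or> m * (x - g1 t) \<le> 0" using m by (auto simp: mult_le_0_iff)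
      then show ?thesis by (auto simp: \<Phi>_def)
    qed
    have le: "(\<integral>x. v t\<^sub>1 x * \<Phi> (t\<^sub>1, x) \<partial>lborel) \<le> (\<integral>x. v 0 x * \<Phi> (0, x) \<partial>lborel) + (\<integral>z. G n z \<partial>lborel)"
    proof (rule weighted_mass_le[OF v s, where B = B])
      show "0 \<le> \<Phi> z" for z by (simp add: \<Phi>_def)
      show "0 \<le> (\<integral>z. G n z \<partial>lborel)" using Gpos by simp
      show "\<Phi> (t, x) = 0" if "t \<in> {0..T}" "x \<notin> {-B..B}" for t x using that by (rule zero)
      fix \<theta> :: "real \<Rightarrow> real" assume \<theta>: "\<And>t. 0 \<le> \<theta> t \<and> \<theta> t \<le> 1"
      show "(\<integral>z. indicator ?A z * (\<theta> (fst z) * (?v z * dt \<Phi> z + c (fst z) (snd z) * ?v z * dx \<Phi> z)) \<partial>lborel) \<le> (\<integral>z. G n z \<partial>lborel)"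
      proof (rule integral_le_of_AE_le[OF Gi AE_I2 AE_I2[OF Gpos]])
        fix z :: "real \<times> real"
        show "indicator ?A z * (\<theta> (fst z) * (?v z * dt \<Phi> z + c (fst z) (snd z) * ?v z * dx \<Phi> z)) \<le> G n z"
        proof (cases "z \<in> ?A")
          case True
          obtain t x where z: "z = (t, x)" by (cases z)
          have t: "t \<in> {0..T}" using True by (simp add: z)
          define P where "P = ?S1 t x * (?S2' t x * (m * (g2' t - c t x)))"
          define Q where "Q = ?S2 t x * (?S1' t x * (m * (g1' t - c t x)))"
          have "\<bar>?S2' t x * (m * (g2' t - c t x))\<bar> \<le> C0 * V \<gamma>2 n (t, x)"
            by (rule layer[where g = "g2 t" and \<gamma> = \<gamma>2 and t = t and g' = "g2' t", OF _ g2(3)[OF t] g2(4)[OF t]]) (use m in \<open>simp add: abs_mult\<close>)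
          then have P: "\<bar>P\<bar> \<le> C0 * V \<gamma>2 n (t, x)"
            unfolding P_def abs_mult[of "?S1 t x"]
            using mult_left_le_one_le[of "\<bar>?S2' t x * (m * (g2' t - c t x))\<bar>" "?S1 t x"] by simp
          have "\<bar>?S1' t x * (m * (g1' t - c t x))\<bar> \<le> C0 * V \<gamma>1 n (t, x)"
            by (rule layer[where g = "g1 t" and \<gamma> = \<gamma>1 and t = t and g' = "g1' t", OF _ g1(3)[OF t] g1(4)[OF t]]) (use m in \<open>simp add: abs_mult abs_minus_commute\<close>)
          then have Q: "\<bar>Q\<bar> \<le> C0 * V \<gamma>1 n (t, x)"
            unfolding Q_def abs_mult[of "?S2 t x"]
            using mult_left_le_one_le[of "\<bar>?S1' t x * (m * (g1' t - c t x))\<bar>" "?S2 t x"] by simp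
          have "\<bar>P - Q\<bar> \<le> C0 * (V \<gamma>1 n (t, x) + V \<gamma>2 n (t, x))"
            using P Q by (simp add: distrib_left)
          then have "\<bar>v t x\<bar> * \<bar>P - Q\<bar> \<le> \<bar>v t x\<bar> * (C0 * (V \<gamma>1 n (t, x) + V \<gamma>2 n (t, x)))"
            by (rule mult_left_mono) simp
          moreover have "v t x * (P - Q) \<le> \<bar>v t x\<bar> * \<bar>P - Q\<bar>" by (simp add: abs_mult[symmetric])
          moreover have "\<theta> t * (v t x * (P - Q)) \<le> \<bar>v t x * (P - Q)\<bar>"
            using mult_left_mono[OF abs_ge_self[of "v t x * (P - Q)"], of "\<theta> t"] \<theta>[of t]
              mult_left_le_one_le[of "\<bar>v t x * (P - Q)\<bar>" "\<theta> t"] by linarith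
          moreover have "\<bar>v t x * (P - Q)\<bar> = \<bar>v t x\<bar> * \<bar>P - Q\<bar>" by (rule abs_mult)
          ultimately have "\<theta> t * (v t x * (P - Q)) \<le> \<bar>v t x\<bar> * (C0 * (V \<gamma>1 n (t, x) + V \<gamma>2 n (t, x)))"
            by linarith
          moreover have "v t x * dt \<Phi> (t, x) + c t x * v t x * dx \<Phi> (t, x) = v t x * (P - Q)"
            unfolding dt dx P_def Q_def by (simp add: algebra_simps)
          ultimately show ?thesis using True by (simp add: z G_def)
        qed (simp add: G_def)
      qed
    qed (use t1 in auto)
    have "(\<integral>x. v 0 x * \<Phi> (0, x) \<partial>lborel) = 0"
    proof (rule integral_eq_zero_AE)
      show "AE x in lborel. v 0 x * \<Phi> (0, x) = 0" using init by eventually_elim simp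
    qed
    with le have "(\<integral>x. v t\<^sub>1 x * \<Phi> (t\<^sub>1, x) \<partial>lborel) \<le> (\<integral>z. G n z \<partial>lborel)" by simp
    then show ?thesis
      using g1(3)[OF t1] g2(3)[OF t1] zero[OF t1]
      by (intro exI[of _ "g1 t\<^sub>1"] exI[of _ "g2 t\<^sub>1"]) (simp add: \<Phi>_def \<gamma>1(2) \<gamma>2(2) m_def)
  qed
  then have "\<forall>n. \<exists>r1 r2. \<bar>r1 - a\<bar> \<le> 1 / real (Suc n) \<and> \<bar>r2 - b\<bar> \<le> 1 / real (Suc n) \<and>
      (\<forall>x. x \<notin> {-B..B} \<longrightarrow> step (real (Suc n) * (r2 - x)) * step (real (Suc n) * (x - r1)) = 0) \<and>
      (\<integral>x. v t\<^sub>1 x * (step (real (Suc n) * (r2 - x)) * step (real (Suc n) * (x - r1))) \<partial>lborel) \<le> (\<integral>z. G n z \<partial>lborel)"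
    by (rule allI)
  then obtain r1 r2 where r0: "\<forall>n. \<bar>r1 n - a\<bar> \<le> 1 / real (Suc n) \<and> \<bar>r2 n - b\<bar> \<le> 1 / real (Suc n) \<and>
      (\<forall>x. x \<notin> {-B..B} \<longrightarrow> step (real (Suc n) * (r2 n - x)) * step (real (Suc n) * (x - r1 n)) = 0) \<and>
      (\<integral>x. v t\<^sub>1 x * (step (real (Suc n) * (r2 n - x)) * step (real (Suc n) * (x - r1 n))) \<partial>lborel) \<le> (\<integral>z. G n z \<partial>lborel)"
    unfolding choice_iff by (elim exE)
  have r: "\<And>n. \<bar>r1 n - a\<bar> \<le> 1 / real (Suc n)" "\<And>n. \<bar>r2 n - b\<bar> \<le> 1 / real (Suc n)"
      "\<And>n x. x \<notin> {-B..B} \<Longrightarrow> step (real (Suc n) * (r2 n - x)) * step (real (Suc n) * (x - r1 n)) = 0"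
      "\<And>n. (\<integral>x. v t\<^sub>1 x * (step (real (Suc n) * (r2 n - x)) * step (real (Suc n) * (x - r1 n))) \<partial>lborel) \<le> (\<integral>z. G n z \<partial>lborel)"
    by (rule r0[rule_format, THEN conjunct1],
        rule r0[rule_format, THEN conjunct2, THEN conjunct1],
        rule r0[rule_format, THEN conjunct2, THEN conjunct2, THEN conjunct1, rule_format], assumption,
        rule r0[rule_format, THEN conjunct2, THEN conjunct2, THEN conjunct2])
  have i1: "integrable lborel (\<lambda>x. indicator {-B..B} x * v t\<^sub>1 x)"
    using C_L1loc_integrable[OF C1 t1, of B] by (simp add: set_integrable_def)
  have ab: "{a<..<b} \<subseteq> {-B..B}" using B[OF t1] \<gamma>1(2) \<gamma>2(2) by auto
  let ?w = "\<lambda>x. indicator {-B..B} x * v t\<^sub>1 x"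
  let ?q = "\<lambda>n x. step (real (Suc n) * (r2 n - x)) * step (real (Suc n) * (x - r1 n))"
  have wm: "?w \<in> borel_measurable borel" using borel_measurable_integrable[OF i1] by simp
  have lim: "(\<lambda>n. \<integral>x. ?w x * ?q n x \<partial>lborel) \<longlonglongrightarrow> (\<integral>x. ?w x * indicator {a<..<b} x \<partial>lborel)"
  proof (rule integral_dominated_convergence[where w = "\<lambda>x. \<bar>?w x\<bar>"])
    show "AE x in lborel. (\<lambda>n. ?w x * ?q n x) \<longlonglongrightarrow> ?w x * indicator {a<..<b} x"
      using AE_lborel_singleton[of a] AE_lborel_singleton[of b]
    proof eventually_elim
      case (elim x)
      have "\<bar>real (Suc n) * (r2 n - x) - real (Suc n) * (b - x)\<bar> \<le> 1" for n
      proof -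
        have "\<bar>real (Suc n) * (r2 n - x) - real (Suc n) * (b - x)\<bar> = real (Suc n) * \<bar>r2 n - b\<bar>"
          by (simp only: right_diff_distrib[symmetric] abs_mult) simp
        also have "\<dots> \<le> real (Suc n) * (1 / real (Suc n))" by (rule mult_left_mono[OF r(2)]) simp
        finally show ?thesis by simp
      qed
      then have "(\<lambda>n. step (real (Suc n) * (r2 n - x))) \<longlonglongrightarrow> (if b - x > 0 then 1 else 0)"
        by (rule step_limit_perturbed) (use elim in auto)
      moreover have "\<bar>real (Suc n) * (x - r1 n) - real (Suc n) * (x - a)\<bar> \<le> 1" for n
      proof -
        have "\<bar>real (Suc n) * (x - r1 n) - real (Suc n) * (x - a)\<bar> = real (Suc n) * \<bar>r1 n - a\<bar>"
          by (simp only: right_diff_distrib[symmetric] abs_mult) simp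
        also have "\<dots> \<le> real (Suc n) * (1 / real (Suc n))" by (rule mult_left_mono[OF r(1)]) simp
        finally show ?thesis by simp
      qed
      then have "(\<lambda>n. step (real (Suc n) * (x - r1 n))) \<longlonglongrightarrow> (if x - a > 0 then 1 else 0)"
        by (rule step_limit_perturbed) (use elim in auto)
      ultimately have "(\<lambda>n. ?w x * ?q n x) \<longlonglongrightarrow> ?w x * ((if b - x > 0 then 1 else 0) * (if x - a > 0 then 1 else 0))"
        by (intro tendsto_mult tendsto_const)
      moreover have "(if b - x > 0 then 1 else 0) * (if x - a > 0 then 1 else 0) = (indicator {a<..<b} x :: real)"
        by (simp add: indicator_def)
      ultimately show ?case by (simp only:)
    qed
    show "integrable lborel (\<lambda>x. \<bar>?w x\<bar>)" using i1 by (rule integrable_abs)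
    show "AE x in lborel. norm (?w x * ?q n x) \<le> \<bar>?w x\<bar>" for n
    proof (rule AE_I2)
      fix x
      have "0 \<le> ?q n x" "?q n x \<le> 1" by (auto simp: mult_le_one)
      then show "norm (?w x * ?q n x) \<le> \<bar>?w x\<bar>"
        unfolding real_norm_def abs_mult[of "?w x"] using mult_right_le_one_le[of "\<bar>?w x\<bar>" "?q n x"] by simp
    qed
  qed (use wm in measurable)
  have "?w x * ?q n x = v t\<^sub>1 x * ?q n x" for n x
  proof (cases "x \<in> {-B..B}")
    case False
    then have "?q n x = 0" by (rule r(3))
    then show ?thesis by (simp only: mult_zero_right)
  qed (simp only: indicator_simps mult_1)
  then have "\<exists>N. \<forall>n\<ge>N. (\<integral>x. ?w x * ?q n x \<partial>lborel) \<le> (\<integral>z. G n z \<partial>lborel)"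
    using r(4) by (simp only: simp_thms)
  from LIMSEQ_le[OF lim E this]
  have "(\<integral>x. ?w x * indicator {a<..<b} x \<partial>lborel) \<le> 0" .
  moreover have "?w x * indicator {a<..<b} x = indicator {a<..<b} x * v t\<^sub>1 x" for x
    using ab by (auto simp: indicator_def)
  ultimately show ?thesis by (simp only:)
qed

text \<open>By linearity the mass inequality holds for v and for - v, so every interval carries mass
  zero. Restricting to (-N,N) supplies the integrability needed to conclude that v vanishes
  there.\<close>

theorem zero_solution_unique:
  assumes v: "C_L1loc T v" and init: "AE x in lborel. v 0 x = 0"
    and eq: "\<And>\<phi>. test_function T \<phi> \<Longrightarrow> distr_div T v (\<lambda>t x. c t x * v t x) \<phi> = 0"
    and t: "t \<in> {0..T}"
  shows "AE x in lborel. v t x = 0"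
proof -
  have "conservation_ineq T v (\<lambda>t x. c t x * v t x)"
    using v loc_integrable_flux[OF v] eq by (simp add: conservation_ineq_def)
  note le = mass_between_characteristics[OF this init t]
  have eq': "(\<lambda>t x. c t x * - v t x) = (\<lambda>t x. - (c t x * v t x))" by simp
  have "conservation_ineq T (\<lambda>t x. - v t x) (\<lambda>t x. c t x * - v t x)"
    unfolding eq' conservation_ineq_def
    using C_L1loc_minus[OF v] loc_integrable_minus[OF loc_integrable_flux[OF v]] eq
    by (simp add: distr_div_minus)
  from mass_between_characteristics[OF this _ t] init
  have ge: "(\<integral>x. indicator {a<..<b} x * - v t x \<partial>lborel) \<le> 0" for a b by simp
  have mass: "(\<integral>x. indicator {a<..<b} x * v t x \<partial>lborel) = 0" for a b
    using le[of a b] ge[of a b] by simp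
  have "AE x in lborel. indicator {-real N<..<real N} x * v t x = 0" for N
  proof (rule AE_zero_of_tail_integrals)
    have "set_integrable lborel {-real N<..<real N} (v t)"
      by (rule set_integrable_subset[OF C_L1loc_integrable[OF v t, of "real N"]]) auto
    then show "integrable lborel (\<lambda>x. indicator {-real N<..<real N} x * v t x)"
      by (simp add: set_integrable_def)
    fix y
    have "indicator {y<..} x * (indicator {-real N<..<real N} x * v t x) =
        indicator {max y (-real N)<..<real N} x * v t x" for x
      by (auto simp: indicator_def)
    then show "(\<integral>x. indicator {y<..} x * (indicator {-real N<..<real N} x * v t x) \<partial>lborel) = 0"
      by (simp only: mass)
  qed
  then have "AE x in lborel. \<forall>N. indicator {-real N<..<real N} x * v t x = 0"
    unfolding AE_all_countable by (rule allI)
  then show ?thesis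
  proof eventually_elim
    case (elim x)
    obtain N :: nat where "\<bar>x\<bar> < N" using reals_Archimedean2 by blast
    then show ?case using elim[rule_format, of N] by (simp add: indicator_def abs_less_iff)
  qed
qed

end

section \<open>Infinite variation of almost-everywhere classes\<close>

lemma AE_open_witness:
  fixes a b :: real
  assumes "AE x in lborel. P x" "a < b"
  obtains x where "a < x" "x < b" "P x"
proof -
  have "\<not> (\<forall>x\<in>{a<..<b}. \<not> P x)"
  proof
    assume "\<forall>x\<in>{a<..<b}. \<not> P x"
    then have "AE x in lborel. x \<notin> {a<..<b}" using assms(1) by (auto elim!: eventually_mono)
    then have "{a<..<b} \<in> null_sets lborel" by (simp add: AE_iff_null_sets)
    then show False using \<open>a < b\<close> by (auto simp: null_sets_def)
  qed
  then show ?thesis using that by auto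
qed

text \<open>Only the disjoint pairs of points with indices 2k and 2k + 1 are counted. Each
  contributes at least the k-th term of a divergent series, and the other increments are
  nonnegative.\<close>

lemma TV_infinite:
  fixes Z :: "nat \<Rightarrow> real"
  assumes mono: "strict_mono Z" and m: "\<And>k. 0 \<le> m k"
    and gap: "\<And>k. m k \<le> \<bar>w (Z (2 * k + 1)) - w (Z (2 * k))\<bar>"
    and nsum: "\<not> summable (\<lambda>k. m k powr (1 / \<sigma>))" and "0 < \<sigma>"
  shows "TV \<sigma> w = \<infinity>"
proof -
  \<comment> \<open>\<open>TV\<close> numbers its points from 1, \<open>Z\<close> from 0.\<close>
  define X where "X i = Z (i - 1)" for i
  define S where "S N = (\<Sum>i = 2..N. ennreal (\<bar>w (X i) - w (X (i - 1))\<bar> powr (1 / \<sigma>)))" for N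
  have X: "strict_mono_on {1..N} X" for N
  proof (rule strict_mono_onI)
    fix i j assume "i \<in> {1..N}" "j \<in> {1..N}" "i < j"
    then have "i - 1 < j - 1" by simp
    then show "X i < X j" unfolding X_def by (rule strict_monoD[OF mono])
  qed
  have S_le: "S N \<le> TV \<sigma> w" if "2 \<le> N" for N
    unfolding TV_def S_def
    by (rule SUP_upper2[where i = "(N, X)"]) (simp_all add: that X[unfolded One_nat_def])
  have lower: "ennreal (\<Sum>k<N. m k powr (1 / \<sigma>)) \<le> S (2 * N)" for N
  proof (induction N)
    case 0
    then show ?case by (simp add: S_def)
  next
    case (Suc N)
    let ?t = "\<lambda>i. ennreal (\<bar>w (X i) - w (X (i - 1))\<bar> powr (1 / \<sigma>))"
    have "X (2 * N + 2) = Z (2 * N + 1)" "X (2 * N + 2 - 1) = Z (2 * N)" by (simp_all add: X_def)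
    then have t: "ennreal (m N powr (1 / \<sigma>)) \<le> ?t (2 * N + 2)"
      using gap[of N] m[of N] \<open>0 < \<sigma>\<close> by (auto intro!: ennreal_leI powr_mono2)
    have "S (2 * N) \<le> S (2 * N + 1)" unfolding S_def by (rule sum_mono2) auto
    moreover have "S (2 * Suc N) = S (2 * N + 1) + ?t (2 * N + 2)" by (simp add: S_def)
    ultimately have "S (2 * N) + ?t (2 * N + 2) \<le> S (2 * Suc N)" by (simp add: add_right_mono)
    note le = this
    have "ennreal (\<Sum>k<Suc N. m k powr (1 / \<sigma>)) =
        ennreal (\<Sum>k<N. m k powr (1 / \<sigma>)) + ennreal (m N powr (1 / \<sigma>))"
      by (simp add: ennreal_plus sum_nonneg)
    also have "\<dots> \<le> S (2 * N) + ?t (2 * N + 2)" by (rule add_mono[OF Suc t])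
    also have "\<dots> \<le> S (2 * Suc N)" by (rule le)
    finally show ?case .
  qed
  show ?thesis
  proof (rule ccontr)
    assume "TV \<sigma> w \<noteq> \<infinity>"
    then obtain r where r: "0 \<le> r" "TV \<sigma> w = ennreal r" by (cases "TV \<sigma> w") auto
    have "(\<Sum>k<N. m k powr (1 / \<sigma>)) \<le> r" for N
    proof (cases N)
      case 0
      then show ?thesis using r by simp
    next
      case (Suc N')
      have "ennreal (\<Sum>k<N. m k powr (1 / \<sigma>)) \<le> ennreal r"
        using order_trans[OF lower[of N] S_le[of "2 * N"]] r(2) Suc by simp
      then show ?thesis using r(1) by (simp add: ennreal_le_iff)
    qed
    then have "summable (\<lambda>k. m k powr (1 / \<sigma>))"
      by (intro summableI_nonneg_bounded[of _ r]) simp_all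
    with nsum show False by contradiction
  qed
qed

text \<open>Any representative agrees with w at points just to the right of each \<open>Z j\<close>,
  before \<open>Z (Suc j)\<close>, where continuity keeps the value within m/2 of
  \<open>w (Z j)\<close>. A jump of 2 m thus shrinks to m at worst, and the order of the points is
  preserved.\<close>

lemma TV_ae_infinite:
  fixes Z :: "nat \<Rightarrow> real"
  assumes mono: "strict_mono Z" and cont: "\<And>j. isCont w (Z j)" and m: "\<And>k. 0 < m k"
    and gap: "\<And>k. 2 * m k \<le> \<bar>w (Z (2 * k + 1)) - w (Z (2 * k))\<bar>"
    and nsum: "\<not> summable (\<lambda>k. m k powr (1 / \<sigma>))" and "0 < \<sigma>"
  shows "TV_ae \<sigma> w = \<infinity>"
proof -
  have "TV \<sigma> w' = \<infinity>" if w': "AE x in lborel. w' x = w x" for w'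
  proof -
    have "\<exists>y. Z j < y \<and> y < Z (Suc j) \<and> \<bar>w' y - w (Z j)\<bar> < m (j div 2) / 2" for j
    proof -
      have "\<exists>d>0. \<forall>x. dist x (Z j) < d \<longrightarrow> dist (w x) (w (Z j)) < m (j div 2) / 2"
        using cont[of j, unfolded continuous_at_eps_delta, rule_format, of "m (j div 2) / 2"] m[of "j div 2"]
        by simp
      then obtain d where d: "d > 0" "\<And>x. dist x (Z j) < d \<Longrightarrow> dist (w x) (w (Z j)) < m (j div 2) / 2" by blast
      have "Z j < min (Z (Suc j)) (Z j + d)" using d(1) strict_monoD[OF mono, of j "Suc j"] by simp
      then obtain y where "Z j < y" "y < min (Z (Suc j)) (Z j + d)" "w' y = w y"
        by (rule AE_open_witness[OF w'])
      then show ?thesis using d(2)[of y] by (auto simp: dist_real_def)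
    qed
    then obtain Y where Y: "\<And>j. Z j < Y j" "\<And>j. Y j < Z (Suc j)" "\<And>j. \<bar>w' (Y j) - w (Z j)\<bar> < m (j div 2) / 2"
      by metis
    show ?thesis
    proof (rule TV_infinite[where Z = Y and m = m])
      show "strict_mono Y"
        unfolding strict_mono_Suc_iff using less_trans[OF Y(2) Y(1)] by blast
      show "m k \<le> \<bar>w' (Y (2 * k + 1)) - w' (Y (2 * k))\<bar>" for k
      proof -
        have "2 * k div 2 = k" "(2 * k + 1) div 2 = k" by simp_all
        then show ?thesis using gap[of k] Y(3)[of "2 * k"] Y(3)[of "2 * k + 1"] by (simp only:)
      qed
    qed (use m nsum \<open>0 < \<sigma>\<close> in \<open>auto intro: less_imp_le\<close>)
  qed
  then have "\<infinity> \<le> TV_ae \<sigma> w"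
    unfolding TV_ae_def by (intro INF_greatest) auto
  then show ?thesis by (simp add: top_unique)
qed

lemma TV_ae_cong:
  assumes "AE x in lborel. u x = v x" shows "TV_ae \<sigma> u = TV_ae \<sigma> v"
proof -
  have "(AE x in lborel. w' x = u x) \<longleftrightarrow> (AE x in lborel. w' x = v x)" for w' :: "real \<Rightarrow> real"
  proof
    show "AE x in lborel. w' x = v x" if "AE x in lborel. w' x = u x"
      using that assms by eventually_elim simp
    show "AE x in lborel. w' x = u x" if "AE x in lborel. w' x = v x"
      using that assms by eventually_elim simp
  qed
  then show ?thesis by (simp add: TV_ae_def)
qed

section \<open>A set whose distance function has the required bumps\<close>

definition node :: "nat \<Rightarrow> real" where "node n = - 1 / ln (real (n + 2))"

text \<open>The distance to this set is a row of tents of slope 1, one over each interval between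
  consecutive nodes, with height half the gap. The half-lines make it vanish outside a bounded
  interval, and the slope gives the Lipschitz bound for the datum at once.\<close>

definition nodes :: "real set" where "nodes = {..node 0} \<union> {0..} \<union> range node"

definition gap :: "nat \<Rightarrow> real" where "gap n = node (Suc n) - node n"

lemma ln_pos: "0 < ln (real (n + 2))" by (simp add: ln_gt_zero)

lemma node_neg: "node n < 0" using ln_pos[of n] by (simp add: node_def)

lemma gap_pos: "0 < gap n"
proof -
  have "ln (real (n + 2)) < ln (real (Suc n + 2))" by simp
  then have "1 / ln (real (Suc n + 2)) < 1 / ln (real (n + 2))"
    using ln_pos[of n] by (intro divide_strict_left_mono mult_pos_pos) (auto simp: ln_gt_zero)
  then show ?thesis by (simp add: gap_def node_def)
qed

lemma strict_mono_node: "strict_mono node"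
  using gap_pos by (simp add: strict_mono_Suc_iff gap_def)

text \<open>This is why the datum is supported in [-2,2].\<close>

lemma node_0_ge: "-2 \<le> node 0"
  using ln2_ge_two_thirds by (simp add: node_def field_simps)

lemma infdist_node: "infdist (node n) nodes = 0"
  by (rule infdist_zero) (auto simp: nodes_def)

lemma infdist_midpoint: "gap n / 2 \<le> infdist (node n + gap n / 2) nodes"
proof -
  have ne: "nodes \<noteq> {}" by (auto simp: nodes_def)
  have "gap n / 2 \<le> dist (node n + gap n / 2) c" if "c \<in> nodes" for c
  proof -
    have "c \<le> node n \<or> node (Suc n) \<le> c"
    proof -
      consider "c \<le> node 0" | "0 \<le> c" | k where "c = node k" using \<open>c \<in> nodes\<close> by (auto simp: nodes_def)
      then show ?thesis
      proof cases
        case 1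
        have "node 0 \<le> node n" using strict_mono_less_eq[OF strict_mono_node] by simp
        then show ?thesis using 1 by linarith
      next
        case 2
        then show ?thesis using node_neg[of "Suc n"] by linarith
      next
        case (3 k)
        have "k \<le> n \<or> Suc n \<le> k" by linarith
        then show ?thesis unfolding 3 using strict_mono_less_eq[OF strict_mono_node] by blast
      qed
    qed
    then show ?thesis
    proof
      assume "c \<le> node n"
      then have "gap n / 2 \<le> (node n + gap n / 2) - c" by simp
      then show ?thesis unfolding dist_real_def by linarith
    next
      assume "node (Suc n) \<le> c"
      then have "gap n / 2 \<le> c - (node n + gap n / 2)" by (simp add: gap_def field_simps)
      then show ?thesis unfolding dist_real_def by linarith
    qed
  qed
  then show ?thesis unfolding infdist_def if_not_P[OF ne] by (rule cINF_greatest[OF ne])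
qed

text \<open>The gaps \<open>1 / ln (n + 2) - 1 / ln (n + 3)\<close> decay like \<open>1 / (n (ln n)\<^sup>2)\<close>: summable, but no power with
  exponent below \<open>1\<close> is.\<close>

lemma not_summable_gap_powr:
  assumes \<theta>: "0 < \<theta>" "\<theta> < 1" shows "\<not> summable (\<lambda>n. gap n powr \<theta>)"
proof
  assume "summable (\<lambda>n. gap n powr \<theta>)"
  moreover have "\<forall>\<^sub>F n in sequentially. norm (inverse (real (Suc n))) \<le> gap n powr \<theta>"
  proof -
    have "\<forall>\<^sub>F n in sequentially. inverse (real n + 1) \<le> (1 / ln (real n + 2) - 1 / ln (real n + 3)) powr \<theta>"
      using \<theta> by real_asymp
    then show ?thesis
    proof eventually_elim
      case (elim n)
      have "gap n = 1 / ln (real n + 2) - 1 / ln (real n + 3)"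
        by (simp add: gap_def node_def add.commute)
      then show ?case using elim by (simp add: add.commute)
    qed
  qed
  ultimately have "summable (\<lambda>n. inverse (real (Suc n)))"
    by (rule summable_comparison_test_ev[rotated])
  then show False
    using not_summable_harmonic[where 'a = real] summable_Suc_iff[of "\<lambda>n. inverse (real n)"] by simp
qed

lemma not_summable_scaled_gap_powr:
  assumes "0 < C" "0 < \<theta>" "\<theta> < 1" shows "\<not> summable (\<lambda>n. C * gap n powr \<theta>)"
proof
  assume "summable (\<lambda>n. C * gap n powr \<theta>)"
  then have "summable (\<lambda>n. gap n powr \<theta>)"
    using assms(1) summable_cmult_iff[of C "\<lambda>n. gap n powr \<theta>"] by simp
  with not_summable_gap_powr[OF assms(2,3)] show False by contradiction
qed

section \<open>The explicit solution of the transport equation\<close>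

text \<open>To the left of -1/pi the argument is frozen at -1/pi, where sin(1/y) = sin(-pi) = 0. The
  cut-off thus creates no jump, and the origin remains the only discontinuity.\<close>

definition sine_profile :: "real \<Rightarrow> real" where
  "sine_profile y = (if y < 0 then sin (1 / max y (- 1 / pi)) else 0)"

lemma sine_profile_outside: "y \<notin> {-1..0} \<Longrightarrow> sine_profile y = 0"
proof -
  assume y: "y \<notin> {-1..0}"
  show ?thesis
  proof (cases "y < 0")
    case True
    have "-1 < - 1 / pi" using pi_gt3 by (simp add: field_simps)
    moreover have "y < -1" using y True by auto
    ultimately have "max y (- 1 / pi) = - 1 / pi" by (intro max_absorb2) linarith
    then show ?thesis by (simp add: sine_profile_def)
  qed (simp add: sine_profile_def)
qed

lemma sine_profile_bounded: "\<bar>sine_profile y\<bar> \<le> 1"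
  by (simp add: sine_profile_def)

lemma sine_profile_measurable [measurable]: "sine_profile \<in> borel_measurable borel"
  unfolding sine_profile_def[abs_def] by measurable

lemma isCont_sine_profile: assumes "y \<noteq> 0" shows "isCont sine_profile y"
proof (cases "y < 0")
  case True
  have "\<forall>\<^sub>F x in nhds y. x \<in> {..<0}" using True by (intro eventually_nhds_in_open) auto
  then have ev: "\<forall>\<^sub>F x in nhds y. sine_profile x = sin (1 / max x (- 1 / pi))"
    by eventually_elim (simp add: sine_profile_def)
  have n: "max y (- 1 / pi) < 0" using True pi_gt_zero by (simp add: max_def)
  then have "isCont (\<lambda>x. sin (1 / max x (- 1 / pi))) y"
    by (intro continuous_intros) (metis n less_irrefl)
  then show ?thesis using isCont_cong[OF ev] by simp
next
  case False
  then have "\<forall>\<^sub>F x in nhds y. x \<in> {0<..}" using assms by (intro eventually_nhds_in_open) auto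
  then have ev: "\<forall>\<^sub>F x in nhds y. sine_profile x = 0"
    by eventually_elim (simp add: sine_profile_def)
  show ?thesis using isCont_cong[OF ev] by simp
qed

text \<open>Points where sin(1/y) is 1 or -1 in alternation, accumulating at 0. The shift by 2 keeps
  all of them to the right of -1/pi, where the argument is not frozen.\<close>

definition peak :: "nat \<Rightarrow> real" where "peak j = - 1 / (pi * real (j + 2) - pi / 2)"

lemma peak_denominator: "pi < pi * real (j + 2) - pi / 2"
proof -
  have "pi * real (j + 2) = pi * real j + 2 * pi" by (simp add: algebra_simps)
  moreover have "0 \<le> pi * real j" by simp
  ultimately show ?thesis using pi_gt_zero by linarith
qed

lemma peak_neg: "peak j < 0"
  using peak_denominator[of j] pi_gt_zero by (simp add: peak_def)

lemma strict_mono_peak: "strict_mono peak"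
  unfolding strict_mono_Suc_iff
proof
  fix j
  have "0 < pi * real (j + 2) - pi / 2" "0 < pi * real (Suc j + 2) - pi / 2"
    using peak_denominator[of j] peak_denominator[of "Suc j"] pi_gt_zero by linarith+
  then have "1 / (pi * real (Suc j + 2) - pi / 2) < 1 / (pi * real (j + 2) - pi / 2)"
    by (intro divide_strict_left_mono mult_pos_pos) auto
  then show "peak j < peak (Suc j)" by (simp add: peak_def)
qed

lemma sine_profile_peak: "sine_profile (peak j) = (-1) ^ j"
proof -
  let ?d = "pi * real (j + 2) - pi / 2"
  have d: "pi < ?d" by (rule peak_denominator)
  have "- 1 / pi \<le> peak j" using d pi_gt_zero by (simp add: peak_def frac_le)
  then have "sine_profile (peak j) = sin (1 / peak j)"
    using peak_neg[of j] by (simp add: sine_profile_def max_absorb1)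
  also have "1 / peak j = - ?d" using d pi_gt_zero by (simp add: peak_def)
  also have "sin (- ?d) = - sin (pi * real (j + 2) - pi / 2)" by (rule sin_minus)
  also have "\<dots> = cos (pi * real (j + 2))" by (simp only: sin_diff cos_pi_half sin_pi_half)
  also have "\<dots> = (-1) ^ (j + 2)" using cos_npi[of "j + 2"] by (simp only: mult.commute)
  finally show ?thesis by simp
qed

lemma compactly_supportedI: "(\<And>x. x \<notin> {a..b} \<Longrightarrow> w x = 0) \<Longrightarrow> compactly_supported w"
  unfolding compactly_supported_def by (intro exI[of _ "{a..b}"]) auto

lemma in_Linf_UNIV:
  assumes "w \<in> borel_measurable borel" "\<And>x. \<bar>w x\<bar> \<le> C"
  shows "in_Linf UNIV (w :: real \<Rightarrow> real)"
  unfolding in_Linf_def set_borel_measurable_def using assms by auto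

section \<open>Transport of the data along characteristics\<close>

context burgers_data
begin

lemma isCont_usol: "isCont (usol t) x"
proof -
  have "continuous_on UNIV (\<lambda>x. usol t x)"
    using continuous_on_compose2[OF continuous_usol[of UNIV], of UNIV "\<lambda>x. (t, x)"] by (simp add: continuous_intros)
  then show ?thesis by (simp add: continuous_on_eq_continuous_at)
qed

lemma measurable_usol_slice: "usol t \<in> borel_measurable borel"
proof -
  have "continuous_on UNIV (usol t)" using isCont_usol by (simp add: continuous_at_imp_continuous_on)
  then show ?thesis by (rule borel_measurable_continuous_onI)
qed

lemma usol_line: "t \<in> {0..T} \<Longrightarrow> usol t (y + w\<^sub>0 y * t) = w\<^sub>0 y powr (1 / p)"
  by (simp add: usol_def wsol_line)

lemma strict_mono_line:
  assumes t: "t \<in> {0..T}" and "x < y" shows "x + w\<^sub>0 x * t < y + w\<^sub>0 y * t"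
proof -
  have "\<bar>w\<^sub>0 x - w\<^sub>0 y\<bar> * t \<le> (lam * \<bar>x - y\<bar>) * t" using t lip by (intro mult_right_mono) auto
  also have "\<dots> = (lam * t) * \<bar>x - y\<bar>" by simp
  also have "\<dots> \<le> 1 / 8 * \<bar>x - y\<bar>" using lam_clamp(1)[of t] t by (intro mult_right_mono) auto
  finally have "\<bar>w\<^sub>0 x * t - w\<^sub>0 y * t\<bar> \<le> 1 / 8 * \<bar>x - y\<bar>" using t by (simp add: abs_mult left_diff_distrib[symmetric])
  moreover have "\<bar>x - y\<bar> = y - x" using \<open>x < y\<close> by simp
  ultimately have "w\<^sub>0 x * t - w\<^sub>0 y * t \<le> 1 / 8 * (y - x)" using abs_le_D1 by metis
  then show ?thesis using \<open>x < y\<close> by (simp add: field_simps)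
qed

end

text \<open>The condition on L is that of \<open>transport\<close> with Lc = 2 lam L, the Lipschitz
  constant in space of h composed with the wave speed.\<close>

locale triangular_data = burgers_data +
  fixes h :: "real \<Rightarrow> real" and L :: real
  assumes h: "L-lipschitz_on UNIV h" and L: "4 * T * lam * L \<le> 1 / 2"
begin

definition c :: "real \<Rightarrow> real \<Rightarrow> real" where "c t x = h (wsol t x)"

text \<open>The profile occupies [-1,0] and drifts by at most |h 0| T. With this offset it stays at
  distance at least 1 from [-A,A] for all times in [0,T].\<close>

definition shift :: real where "shift = A + 2 + \<bar>h 0\<bar> * T"

definition vsol :: "real \<Rightarrow> real \<Rightarrow> real" where "vsol t x = sine_profile (x - h 0 * t - shift)"

lemma L_ge_0: "0 \<le> L" using h by (rule lipschitz_on_nonneg)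

sublocale transport T "2 * lam * L" c
proof
  show "0 < T" by (rule T)
  show "0 \<le> 2 * lam * L" using lam L_ge_0 by simp
  show "2 * T * (2 * lam * L) \<le> 1 / 2" using L by (simp add: mult_ac)
  show "continuous_on UNIV (\<lambda>z. c (fst z) (snd z))"
    unfolding c_def
    by (rule continuous_on_compose2[OF lipschitz_on_continuous_on[OF h] continuous_wsol]) simp
  fix t x y
  have "\<bar>c t x - c t y\<bar> \<le> L * \<bar>wsol t x - wsol t y\<bar>"
    using lipschitz_onD[OF h, of "wsol t x" "wsol t y"] by (simp add: c_def dist_real_def)
  also have "\<dots> \<le> L * (2 * lam * \<bar>x - y\<bar>)"
    using wsol_lip[of t x t y] by (intro mult_left_mono L_ge_0) simp
  finally show "\<bar>c t x - c t y\<bar> \<le> 2 * lam * L * \<bar>x - y\<bar>" by (simp add: mult_ac)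
qed

lemma vsol_outside:
  assumes t: "t \<in> {0..T}" and x: "x \<le> A" shows "vsol t x = 0"
proof -
  have "\<bar>h 0 * t\<bar> \<le> \<bar>h 0\<bar> * T" using t by (simp add: abs_mult mult_left_mono)
  then have "x - h 0 * t - shift \<notin> {-1..0}" using x unfolding shift_def atLeastAtMost_iff by linarith
  then show ?thesis unfolding vsol_def by (rule sine_profile_outside)
qed

lemma vsol_bounded: "\<bar>vsol t x\<bar> \<le> 1"
  by (simp add: vsol_def sine_profile_bounded)

lemma vsol_measurable [measurable]: "(\<lambda>z. vsol (fst z) (snd z)) \<in> borel_measurable borel"
  unfolding vsol_def by measurable

lemma C_L1loc_vsol: "C_L1loc T vsol"
proof (rule C_L1loc_pointwise[OF vsol_measurable vsol_bounded])
  fix t0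
  \<comment> \<open>Pointwise continuity in time can fail only at the point where the oscillations
    accumulate at time t0.\<close>
  show "AE x in lborel. ((\<lambda>t. vsol t x) \<longlongrightarrow> vsol t0 x) (at t0 within {0..T})"
    using AE_lborel_singleton[of "h 0 * t0 + shift"]
  proof eventually_elim
    case (elim x)
    have "isCont sine_profile (x - h 0 * t0 - shift)" using elim by (intro isCont_sine_profile) auto
    moreover have "((\<lambda>t. x - h 0 * t - shift) \<longlongrightarrow> x - h 0 * t0 - shift) (at t0 within {0..T})"
      by (intro tendsto_intros)
    ultimately show ?case unfolding vsol_def by (rule isCont_tendsto_compose)
  qed
qed

lemma weak_vsol:
  assumes \<phi>: "test_function T \<phi>"
  shows "distr_div T vsol (\<lambda>t x. c t x * vsol t x) \<phi> = 0"
proof -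
  obtain B where B: "closure {z. \<phi> z \<noteq> 0} \<subseteq> {0<..<T} \<times> {-B..B}"
    using test_function_box[OF \<phi>] by metis
  have eq: "vsol (fst z) (snd z) * dt \<phi> z + c (fst z) (snd z) * vsol (fst z) (snd z) * dx \<phi> z =
      sine_profile (snd z - h 0 * fst z - shift) * (dt \<phi> z + h 0 * dx \<phi> z)" for z
  proof (cases "z \<in> {0<..<T} \<times> {-B..B}")
    case False
    then have "z \<notin> closure {z. \<phi> z \<noteq> 0}" using B by blast
    then show ?thesis using frechet_derivative_zero_outside_support[of z \<phi>] by simp
  next
    case True
    obtain t x where z: "z = (t, x)" by (cases z)
    have t: "t \<in> {0..T}" using True by (simp add: z)
    have "c t x * vsol t x = h 0 * vsol t x"
    proof (cases "x \<le> A")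
      case False
      then have "wsol t x = 0" by (intro wsol_outside) auto
      then show ?thesis by (simp add: c_def)
    qed (simp add: vsol_outside[OF t])
    then have "vsol t x * dt \<phi> z + c t x * vsol t x * dx \<phi> z = vsol t x * (dt \<phi> z + h 0 * dx \<phi> z)"
      by (simp only:) (simp add: algebra_simps)
    then show ?thesis by (simp add: z vsol_def)
  qed
  have "(\<integral>z. sine_profile (snd z - h 0 * fst z - shift) * (dt \<phi> z + h 0 * dx \<phi> z) \<partial>lborel) = 0"
    by (rule integral_translated_profile[OF \<phi>, of "\<lambda>y. sine_profile (y - shift)" 1 "h 0"])
      (auto simp: sine_profile_bounded)
  then show ?thesis by (simp add: distr_div_eq[OF \<phi>] eq)
qed

lemma v_unique:
  assumes v: "C_L1loc T v" and init: "AE x in lborel. v 0 x = vsol 0 x"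
    and eq: "\<And>\<phi>. test_function T \<phi> \<Longrightarrow> distr_div T v (\<lambda>t x. c t x * v t x) \<phi> = 0"
    and t: "t \<in> {0..T}"
  shows "AE x in lborel. v t x = vsol t x"
proof -
  have "AE x in lborel. v t x + - vsol t x = 0"
  proof (rule zero_solution_unique[where v = "\<lambda>t x. v t x + - vsol t x", OF _ _ _ t])
    show "C_L1loc T (\<lambda>t x. v t x + - vsol t x)"
      by (intro C_L1loc_add C_L1loc_minus v C_L1loc_vsol)
    show "AE x in lborel. v 0 x + - vsol 0 x = 0" using init by eventually_elim simp
    fix \<phi> assume \<phi>: "test_function T \<phi>"
    have i: "loc_integrable T v" "loc_integrable T (\<lambda>t x. c t x * v t x)"
      "loc_integrable T (\<lambda>t x. - vsol t x)" "loc_integrable T (\<lambda>t x. - (c t x * vsol t x))"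
      by (intro C_L1loc_loc_integrable v loc_integrable_flux loc_integrable_minus C_L1loc_vsol)+
    show "distr_div T (\<lambda>t x. v t x + - vsol t x) (\<lambda>t x. c t x * (v t x + - vsol t x)) \<phi> = 0"
      using distr_div_add[OF i \<phi>] eq[OF \<phi>] weak_vsol[OF \<phi>] distr_div_minus[OF \<phi>, of vsol]
      by (simp add: right_diff_distrib)
  qed
  then show ?thesis by eventually_elim simp
qed

lemma TV_vsol:
  assumes "0 < \<sigma>" shows "TV_ae \<sigma> (vsol t) = \<infinity>"
proof (rule TV_ae_infinite[where Z = "\<lambda>j. peak j + (h 0 * t + shift)" and m = "\<lambda>_. 1"])
  have peak: "vsol t (peak j + (h 0 * t + shift)) = (-1) ^ j" for j
    by (simp add: vsol_def sine_profile_peak)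
  show "strict_mono (\<lambda>j. peak j + (h 0 * t + shift))"
    using strict_mono_peak by (simp add: strict_mono_def)
  show "isCont (vsol t) (peak j + (h 0 * t + shift))" for j
  proof -
    have "isCont sine_profile (peak j + (h 0 * t + shift) - h 0 * t - shift)"
      using peak_neg[of j] by (intro isCont_sine_profile) simp
    moreover have "isCont (\<lambda>x. x - h 0 * t - shift) (peak j + (h 0 * t + shift))"
      by (intro continuous_intros)
    ultimately show ?thesis unfolding vsol_def[abs_def] by (rule isCont_o2[rotated])
  qed
  show "2 * 1 \<le> \<bar>vsol t (peak (2 * k + 1) + (h 0 * t + shift)) - vsol t (peak (2 * k) + (h 0 * t + shift))\<bar>" for k
    unfolding peak by simp
  show "\<not> summable (\<lambda>k. 1 powr (1 / \<sigma>) :: real)" by (simp add: summable_const_iff)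
qed (use assms in auto)

end

section \<open>Infinite variation of u\<close>

context burgers_data
begin

text \<open>Nodes and midpoints of the tents are moved by the increasing map y +
  \<open>w\<^sub>0\<close> (y) t, along which the values of u are preserved. Jumps of order
  gap^(1/p), raised to 1/(1/p + eps), give a power of the gap with exponent below 1.\<close>

lemma TV_usol:
  assumes "0 < lam" and w0: "\<And>x. w\<^sub>0 x = lam * infdist x nodes" and t: "t \<in> {0..T}" and "0 < \<epsilon>"
  shows "TV_ae (1 / p + \<epsilon>) (usol t) = \<infinity>"
proof -
  define Z where "Z j = (if even j then node (j div 2) else node (j div 2) + gap (j div 2) / 2)" for j :: nat
  define \<sigma> where "\<sigma> = 1 / p + \<epsilon>"
  have \<sigma>: "0 < \<sigma>" using p \<open>0 < \<epsilon>\<close> by (simp add: \<sigma>_def add_pos_pos)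
  \<comment> \<open>Half of a lower bound for the jump between a node and the next midpoint, because
    \<open>TV_ae_infinite\<close> asks for jumps of size 2 m.\<close>
  define m where "m k = (lam * (gap k / 2)) powr (1 / p) / 2" for k
  have Z: "Z (2 * k) = node k" "Z (2 * k + 1) = node k + gap k / 2" for k by (simp_all add: Z_def)
  have Zmono: "strict_mono Z"
    unfolding strict_mono_Suc_iff
  proof
    fix j :: nat
    define k where "k = j div 2"
    have "j = 2 * k \<or> j = 2 * k + 1" by (auto simp: k_def)
    then show "Z j < Z (Suc j)"
    proof
      assume "j = 2 * k"
      then show ?thesis using Z[of k] gap_pos[of k] by simp
    next
      assume j: "j = 2 * k + 1"
      then have "Z (Suc j) = node (Suc k)" using Z(1)[of "Suc k"] by simp
      moreover have "node k + gap k / 2 < node (Suc k)" using gap_pos[of k] by (simp add: gap_def field_simps)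
      ultimately show ?thesis using Z(2)[of k] j by simp
    qed
  qed
  have "TV_ae \<sigma> (usol t) = \<infinity>"
  proof (rule TV_ae_infinite[where Z = "\<lambda>j. Z j + w\<^sub>0 (Z j) * t" and m = m])
    show "strict_mono (\<lambda>j. Z j + w\<^sub>0 (Z j) * t)"
      by (intro strict_monoI strict_mono_line[OF t] strict_monoD[OF Zmono])
    show "0 < m k" for k using gap_pos[of k] \<open>0 < lam\<close> by (simp add: m_def)
    show "2 * m k \<le> \<bar>usol t (Z (2 * k + 1) + w\<^sub>0 (Z (2 * k + 1)) * t) - usol t (Z (2 * k) + w\<^sub>0 (Z (2 * k)) * t)\<bar>" for k
    proof -
      have "usol t (Z (2 * k) + w\<^sub>0 (Z (2 * k)) * t) = 0"
        unfolding usol_line[OF t] Z unfolding w0 by (simp add: infdist_node)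
      moreover have "(lam * (gap k / 2)) powr (1 / p) \<le> usol t (Z (2 * k + 1) + w\<^sub>0 (Z (2 * k + 1)) * t)"
        unfolding usol_line[OF t] Z unfolding w0
        using infdist_midpoint[of k] gap_pos[of k] \<open>0 < lam\<close> p by (intro powr_mono2 mult_left_mono) auto
      ultimately show ?thesis by (simp add: m_def)
    qed
    have eq: "m k powr (1 / \<sigma>) = ((lam / 2) powr (1 / p) / 2) powr (1 / \<sigma>) * gap k powr (1 / p / \<sigma>)" for k
    proof -
      have mk: "m k = ((lam / 2) powr (1 / p) / 2) * gap k powr (1 / p)"
        using gap_pos[of k] \<open>0 < lam\<close> powr_mult[of "lam / 2" "gap k" "1 / p"] by (simp add: m_def)
      have "m k powr (1 / \<sigma>) = ((lam / 2) powr (1 / p) / 2) powr (1 / \<sigma>) * (gap k powr (1 / p)) powr (1 / \<sigma>)"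
        unfolding mk by (rule powr_mult)
      also have "(gap k powr (1 / p)) powr (1 / \<sigma>) = gap k powr (1 / p / \<sigma>)" by (simp add: powr_powr)
      finally show ?thesis .
    qed
    have C: "0 < ((lam / 2) powr (1 / p) / 2) powr (1 / \<sigma>)" using \<open>0 < lam\<close> by simp
    have "1 / p < \<sigma>" using \<open>0 < \<epsilon>\<close> by (simp add: \<sigma>_def)
    then have \<theta>: "1 / p / \<sigma> < 1" using \<sigma> by (simp only: divide_less_eq_1_pos)
    have "0 < 1 / p / \<sigma>" using p \<sigma> by simp
    then show "\<not> summable (\<lambda>k. m k powr (1 / \<sigma>))"
      unfolding eq by (rule not_summable_scaled_gap_powr[OF C _ \<theta>])
  qed (use \<sigma> isCont_usol in auto)
  then show ?thesis by (simp add: \<sigma>_def)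
qed

end

section \<open>Identification of every solution with the explicit one\<close>

context triangular_data
begin

lemma deriv_f: "deriv f = (\<lambda>u. sgn u * \<bar>u\<bar> powr p)"
  using DERIV_imp_deriv[OF f_deriv] by (intro ext)

lemma speed_usol: "(h \<circ> deriv f) (usol t x) = c t x"
  by (simp add: c_def deriv_f_nonneg usol_bounds wsol_eq_usol)

lemma measurable_speed [measurable]: "h \<circ> deriv f \<in> borel_measurable borel"
proof -
  have [measurable]: "h \<in> borel_measurable borel"
    by (rule borel_measurable_continuous_onI[OF lipschitz_on_continuous_on[OF h]])
  show ?thesis unfolding deriv_f o_def by measurable
qed

lemma solution_exists:
  "triangular_entropy_solution T f (h \<circ> deriv f) (usol 0) (vsol 0) usol vsol"
  unfolding triangular_entropy_solution_def weak_transport_solution_def speed_usol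
  using kruzhkov_usol C_L1loc_vsol weak_vsol by simp

text \<open>Once u equals \<open>usol\<close> almost everywhere, the velocity g(u) may be replaced
  by its continuous representative c, Lipschitz in space, and the uniqueness theorem for the linear
  equation applies.\<close>

lemma solution_unique:
  assumes sol: "triangular_entropy_solution T f (h \<circ> deriv f) (usol 0) (vsol 0) u v" and t: "t \<in> {0..T}"
  shows "AE x in lborel. u t x = usol t x" and "AE x in lborel. v t x = vsol t x"
proof -
  interpret S: burgers_solution T p lam A w\<^sub>0 u
    using sol by unfold_locales (simp add: triangular_entropy_solution_def)
  show "AE x in lborel. u t x = usol t x" by (rule S.u_unique[OF t])
  have v: "C_L1loc T v" and init: "AE x in lborel. v 0 x = vsol 0 x"
    and eq: "\<And>\<phi>. test_function T \<phi> \<Longrightarrow> distr_div T v (\<lambda>t x. (h \<circ> deriv f) (u t x) * v t x) \<phi> = 0"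
    using sol by (auto simp: triangular_entropy_solution_def weak_transport_solution_def)
  let ?S = "{0..T} \<times> (UNIV :: real set)"
  note [measurable] = C_L1loc_measurable[OF S.C_L1loc_u] C_L1loc_measurable[OF v]
  have S[measurable]: "?S \<in> sets borel" by (simp add: closed_Times borel_closed)
  have "AE z in lborel. z \<in> ?S \<longrightarrow> indicator ?S z * u (fst z) (snd z) = usol (fst z) (snd z)"
  proof (rule AE_strip_of_slices)
    show "AE x in lborel. indicator ?S (t, x) * u (fst (t, x)) (snd (t, x)) = usol (fst (t, x)) (snd (t, x))"
      if "t \<in> {0..T}" for t
      using S.u_unique[OF that] by eventually_elim (use that in simp)
  qed measurable
  then have ae: "AE z in lborel. z \<in> ?S \<longrightarrow>
      (h \<circ> deriv f) (u (fst z) (snd z)) * v (fst z) (snd z) = c (fst z) (snd z) * v (fst z) (snd z)"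
  proof eventually_elim
    case (elim z)
    show ?case
    proof
      assume "z \<in> ?S"
      then have "u (fst z) (snd z) = usol (fst z) (snd z)" using elim by simp
      then show "(h \<circ> deriv f) (u (fst z) (snd z)) * v (fst z) (snd z) = c (fst z) (snd z) * v (fst z) (snd z)"
        by (simp only: speed_usol)
    qed
  qed
  \<comment> \<open>Integrability of g(u) v is not a clause of the weak formulation; it is inferred
    from the almost-everywhere equality with c v.\<close>
  have li: "loc_integrable T (\<lambda>t x. (h \<circ> deriv f) (u t x) * v t x)"
    unfolding loc_integrable_def set_integrable_def
  proof
    fix B :: real
    let ?A = "{0<..<T} \<times> {-B..B}"
    have [measurable]: "?A \<in> sets borel" by (auto simp: borel_prod[symmetric])
    show "integrable lborel (\<lambda>z. indicator ?A z *\<^sub>R ((h \<circ> deriv f) (u (fst z) (snd z)) * v (fst z) (snd z)))"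
    proof (rule integrable_cong_AE_imp)
      show "integrable lborel (\<lambda>z. indicator ?A z *\<^sub>R (c (fst z) (snd z) * v (fst z) (snd z)))"
        using loc_integrable_flux[OF v] by (simp add: loc_integrable_def set_integrable_def)
      show "AE z in lborel. indicator ?A z *\<^sub>R (c (fst z) (snd z) * v (fst z) (snd z)) =
          indicator ?A z *\<^sub>R ((h \<circ> deriv f) (u (fst z) (snd z)) * v (fst z) (snd z))"
        using ae
      proof eventually_elim
        case (elim z)
        then show ?case by (cases "z \<in> ?A") (auto simp: mem_Times_iff)
      qed
      have "(\<lambda>z. indicator ?A z *\<^sub>R ((h \<circ> deriv f) (u (fst z) (snd z)) * v (fst z) (snd z))) =
          (\<lambda>z. indicator ?A z * ((h \<circ> deriv f) (indicator ?S z * u (fst z) (snd z)) * (indicator ?S z * v (fst z) (snd z))))"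
      proof
        fix z
        show "indicator ?A z *\<^sub>R ((h \<circ> deriv f) (u (fst z) (snd z)) * v (fst z) (snd z)) =
          indicator ?A z * ((h \<circ> deriv f) (indicator ?S z * u (fst z) (snd z)) * (indicator ?S z * v (fst z) (snd z)))"
          by (cases "z \<in> ?A") (auto simp: mem_Times_iff)
      qed
      also have "\<dots> \<in> borel_measurable lborel" by measurable
      finally show "(\<lambda>z. indicator ?A z *\<^sub>R ((h \<circ> deriv f) (u (fst z) (snd z)) * v (fst z) (snd z))) \<in> borel_measurable lborel" .
    qed
  qed
  show "AE x in lborel. v t x = vsol t x"
  proof (rule v_unique[OF v init _ t])
    fix \<phi> assume \<phi>: "test_function T \<phi>"
    have "distr_div T v (\<lambda>t x. c t x * v t x) \<phi> = distr_div T v (\<lambda>t x. (h \<circ> deriv f) (u t x) * v t x) \<phi>"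
    proof (rule distr_div_cong_AE[OF _ _ _ li \<phi>])
      show "AE z in lborel. z \<in> ?S \<longrightarrow>
          c (fst z) (snd z) * v (fst z) (snd z) = (h \<circ> deriv f) (u (fst z) (snd z)) * v (fst z) (snd z)"
        using ae by eventually_elim (simp only: eq_commute)
    qed (auto intro: C_L1loc_loc_integrable v loc_integrable_flux)
    then show "distr_div T v (\<lambda>t x. c t x * v t x) \<phi> = 0" using eq[OF \<phi>] by (simp only:)
  qed
qed

text \<open>For u the bound belongs to the notion of solution. For v it does not, and it is read off
  from the identification with \<open>vsol\<close>.\<close>

lemma solution_in_Linf:
  assumes sol: "triangular_entropy_solution T f (h \<circ> deriv f) (usol 0) (vsol 0) u v"
  shows "in_Linf ({0..T} \<times> UNIV) (\<lambda>(t, x). u t x)" and "in_Linf ({0..T} \<times> UNIV) (\<lambda>(t, x). v t x)"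
proof -
  show "in_Linf ({0..T} \<times> UNIV) (\<lambda>(t, x). u t x)"
    using sol by (simp add: triangular_entropy_solution_def kruzhkov_solution_def)
  have v: "C_L1loc T v" using sol by (simp add: triangular_entropy_solution_def weak_transport_solution_def)
  let ?S = "{0..T} \<times> (UNIV :: real set)"
  note [measurable] = C_L1loc_measurable[OF v]
  have "AE z in lborel. z \<in> ?S \<longrightarrow> \<bar>indicator ?S z * v (fst z) (snd z)\<bar> \<le> 1"
  proof (rule AE_strip_of_slices)
    show "AE x in lborel. \<bar>indicator ?S (t, x) * v (fst (t, x)) (snd (t, x))\<bar> \<le> 1" if "t \<in> {0..T}" for t
      using solution_unique(2)[OF sol that] by eventually_elim (use vsol_bounded that in simp)
  qed measurable
  then have "AE z in lborel. z \<in> ?S \<longrightarrow> \<bar>case z of (t, x) \<Rightarrow> v t x\<bar> \<le> 1"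
    by eventually_elim (auto simp: case_prod_beta)
  moreover have "set_borel_measurable lborel ?S (\<lambda>(t, x). v t x)" using v by (simp add: C_L1loc_def)
  ultimately show "in_Linf ?S (\<lambda>(t, x). v t x)" unfolding in_Linf_def by blast
qed

end

theorem theorem5p1:
  fixes T p s :: real and f g h :: "real \<Rightarrow> real"
  assumes "T > 0" and "p \<ge> 1" and "s = 1 / p"
    and "f = (\<lambda>u. \<bar>u\<bar> powr (p + 1) / (p + 1))"
    and "\<exists>L. L-lipschitz_on UNIV h"
    and "g = h \<circ> deriv f"
  shows "\<exists>u\<^sub>0 v\<^sub>0 :: real \<Rightarrow> real.
    in_Linf UNIV u\<^sub>0 \<and> compactly_supported u\<^sub>0 \<and>
    in_Linf UNIV v\<^sub>0 \<and> compactly_supported v\<^sub>0 \<and>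
    (\<exists>u v. triangular_entropy_solution T f g u\<^sub>0 v\<^sub>0 u v) \<and>
    (\<forall>u v. triangular_entropy_solution T f g u\<^sub>0 v\<^sub>0 u v \<longrightarrow>
       in_Linf ({0..T} \<times> UNIV) (\<lambda>(t, x). u t x) \<and>
       in_Linf ({0..T} \<times> UNIV) (\<lambda>(t, x). v t x) \<and>
       (\<forall>t \<in> {0..T}.
          (\<forall>\<epsilon>>0. TV_ae (s + \<epsilon>) (u t) = \<infinity>) \<and>
          (\<forall>s' \<in> {0<..1}. TV_ae s' (v t) = \<infinity>)))"
proof -
  obtain L where L: "L-lipschitz_on UNIV h" using assms(5) by blast
  then have L0: "0 \<le> L" by (rule lipschitz_on_nonneg)
  \<comment> \<open>The divisor L + 1 covers L = 0. With this choice lam T <= 1/8 and 4 T lam L = L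
    / (2 (L + 1)) <= 1/2, the two smallness conditions of the locale.\<close>
  define lam where "lam = 1 / (8 * T * (L + 1))"
  have lam: "0 < lam" using \<open>T > 0\<close> L0 by (simp add: lam_def)
  have lamT: "lam * T = 1 / (8 * (L + 1))" using \<open>T > 0\<close> by (simp add: lam_def)
  define w0 where "w0 x = lam * infdist x nodes" for x
  interpret D: triangular_data T p lam 2 w0 h L
  proof
    show "T > 0" "p \<ge> 1" by fact+
    show "lam \<ge> 0" using lam by simp
    show "lam * T \<le> 1 / 8" unfolding lamT using L0 by (simp add: field_simps)
    have "4 * T * lam * L = 4 * (lam * T) * L" by simp
    also have "\<dots> \<le> 1 / 2" unfolding lamT using L0 by (simp add: field_simps)
    finally show "4 * T * lam * L \<le> 1 / 2" .
    show "L-lipschitz_on UNIV h" by (rule L)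
    show "\<bar>w0 x - w0 y\<bar> \<le> lam * \<bar>x - y\<bar>" for x y
    proof -
      have "\<bar>w0 x - w0 y\<bar> = lam * \<bar>infdist x nodes - infdist y nodes\<bar>"
        using lam by (simp add: w0_def right_diff_distrib[symmetric] abs_mult)
      also have "\<dots> \<le> lam * \<bar>x - y\<bar>"
        using infdist_triangle_abs[of x nodes y] lam by (intro mult_left_mono) (auto simp: dist_real_def)
      finally show ?thesis .
    qed
    show "0 \<le> w0 x" for x using lam by (simp add: w0_def infdist_nonneg)
    show "w0 x = 0" if "x \<notin> {-2..2}" for x
    proof -
      have "x \<in> nodes" using that node_0_ge by (auto simp: nodes_def)
      then show ?thesis by (simp add: w0_def)
    qed
  qed simp
  have f: "f = D.f" unfolding assms(4) by (simp add: D.f_def[abs_def])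
  have g: "g = h \<circ> deriv D.f" using assms(6) f by simp
  show ?thesis
    unfolding f g
  proof (rule exI[of _ "D.usol 0"], rule exI[of _ "D.vsol 0"], intro conjI allI impI ballI)
    show "in_Linf UNIV (D.usol 0)"
      by (rule in_Linf_UNIV[OF D.measurable_usol_slice, of _ "D.W powr (1 / p)"])
        (use D.usol_bounds in simp)
    show "compactly_supported (D.usol 0)"
      by (rule compactly_supportedI[of "-2" 2]) (rule D.usol_outside)
    show "in_Linf UNIV (D.vsol 0)"
    proof (rule in_Linf_UNIV[OF _ D.vsol_bounded])
      show "D.vsol 0 \<in> borel_measurable borel" unfolding D.vsol_def by measurable
    qed
    show "compactly_supported (D.vsol 0)"
    proof (rule compactly_supportedI[of "D.shift - 1" D.shift])
      show "D.vsol 0 x = 0" if "x \<notin> {D.shift - 1..D.shift}" for x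
        unfolding D.vsol_def by (rule sine_profile_outside) (use that in auto)
    qed
    show "\<exists>u v. triangular_entropy_solution T D.f (h \<circ> deriv D.f) (D.usol 0) (D.vsol 0) u v"
      using D.solution_exists by blast
    fix u v assume sol: "triangular_entropy_solution T D.f (h \<circ> deriv D.f) (D.usol 0) (D.vsol 0) u v"
    show "in_Linf ({0..T} \<times> UNIV) (\<lambda>(t, x). u t x)" "in_Linf ({0..T} \<times> UNIV) (\<lambda>(t, x). v t x)"
      by (rule D.solution_in_Linf[OF sol])+
    fix t assume t: "t \<in> {0..T}"
    show "TV_ae (s + \<epsilon>) (u t) = \<infinity>" if "0 < \<epsilon>" for \<epsilon>
      using D.TV_usol[OF lam w0_def t that] TV_ae_cong[OF D.solution_unique(1)[OF sol t]] assms(3) by simp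
    show "TV_ae s' (v t) = \<infinity>" if "s' \<in> {0<..1}" for s'
      using D.TV_vsol[of s' t] that TV_ae_cong[OF D.solution_unique(2)[OF sol t]] by simp
  qed
qed

end
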